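(* Let $0<T<1$. For $U_0\in H^s(\mathbb R_{x_1}\times\mathbb R_{x_2})$ let $$ U(x_1,x_2,t)=\frac{1}{(2\pi)^2}\int_{k_1\in\mathbb R}\int_{k_2\in\mathbb R}e^{ik_1x_1+ik_2x_2-i(k_1^2+k_2^2)t}\,\widehat U_0(k_1,k_2)\,dk_2dk_1 $$ be the solution of the linear Schrödinger initial value problem $$ iU_t+U_{x_1x_1}+U_{x_2x_2}=0,\quad (x_1,x_2,t)\in\mathbb R\times\mathbb R\times(0,T),\qquad U(x_1,x_2,0)=U_0(x_1,x_2),\quad (x_1,x_2)\in\mathbb R\times\mathbb R . $$ Then $$ \sup_{t\in[0,T]}\|U(t)\|_{H^s(\mathbb R_{x_1}\times\mathbb R_{x_2})}=\|U_0\|_{H^s(\mathbb R_{x_1}\times\mathbb R_{x_2})},\qquad s\in\mathbb R, $$ and $$ \sup_{x_2\in\mathbb R}\|U(x_2)\|_{B_T^s}\leqslant c_s\|U_0\|_{H^s(\mathbb R_{x_1}\times\mathbb R_{x_2})},\qquad s\geqslant0, $$ where $c_s>0$ depends only on $s$ and $U(x_2)$ denotes the function $(x_1,t)\mapsto U(x_1,x_2,t)$.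
   Context: $\widehat U_0(k_1,k_2)=\int_{\mathbb R}\int_{\mathbb R}e^{-ik_1x_1-ik_2x_2}U_0(x_1,x_2)\,dx_2dx_1$, and $\|U_0\|_{H^s(\mathbb R^2)}^2=\int_{\mathbb R}\int_{\mathbb R}(1+k_1^2+k_2^2)^s|\widehat U_0(k_1,k_2)|^2dk_2dk_1$. $H_t^m(0,T)$ is the usual Sobolev space of restrictions to $(0,T)$ of elements of $H^m(\mathbb R_t)$, with the infimum norm. With $\widehat g^{x_1}(k_1,t)=\int_{\mathbb R}e^{-ik_1x_1}g(x_1,t)\,dx_1$, the space $B_T^s$ consists of the $g\in L^2(\mathbb R_{x_1}\times[0,T])$ with $$ \|g\|_{B_T^s}=\left(\int_{\mathbb R}\big\|e^{ik_1^2t}\,\widehat g^{x_1}(k_1,t)\big\|^2_{H_t^{\frac{2s+1}{4}}(0,T)}dk_1\right)^{\frac12}+\left(\int_{\mathbb R}(1+k_1^2)^s\big\|e^{ik_1^2t}\,\widehat g^{x_1}(k_1,t)\big\|^2_{H_t^{\frac14}(0,T)}dk_1\right)^{\frac12}<\infty . $$ *)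

theory Defs
  imports "HOL-Analysis.Analysis"
begin

section \<open>Schwartz functions and tempered distributions\<close>

fun iter_deriv :: "'a::euclidean_space list \<Rightarrow> ('a \<Rightarrow> complex) \<Rightarrow> 'a \<Rightarrow> complex" where
  "iter_deriv [] f = f"
| "iter_deriv (v # vs) f = (\<lambda>x. frechet_derivative (iter_deriv vs f) (at x) v)"

definition schwartz :: "('a::euclidean_space \<Rightarrow> complex) \<Rightarrow> bool" where
  "schwartz f \<longleftrightarrow> (\<forall>vs. set vs \<subseteq> Basis \<longrightarrow>
     (\<forall>x. iter_deriv vs f differentiable (at x)) \<and>
     (\<forall>N::nat. bounded (range (\<lambda>x. (1 + norm x) ^ N *\<^sub>R iter_deriv vs f x))))"

definition schwartz_seminorm :: "nat \<Rightarrow> ('a::euclidean_space \<Rightarrow> complex) \<Rightarrow> real" where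
  "schwartz_seminorm N f =
     (SUP (vs, x) \<in> {vs. set vs \<subseteq> Basis \<and> length vs \<le> N} \<times> UNIV.
        (1 + norm x) ^ N * norm (iter_deriv vs f x))"

text \<open>A distribution is a functional on all functions, but only its values on Schwartz
  functions carry meaning; two distributions are equal when they agree there.\<close>

type_synonym 'a distr = "('a \<Rightarrow> complex) \<Rightarrow> complex"

definition tempered :: "'a::euclidean_space distr \<Rightarrow> bool" where
  "tempered u \<longleftrightarrow>
     (\<forall>\<phi> \<psi> a. schwartz \<phi> \<and> schwartz \<psi> \<longrightarrow>
        u (\<lambda>x. \<phi> x + a * \<psi> x) = u \<phi> + a * u \<psi>) \<and>
     (\<exists>N C. \<forall>\<phi>. schwartz \<phi> \<longrightarrow> norm (u \<phi>) \<le> C * schwartz_seminorm N \<phi>)"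

definition distr_of :: "('a::euclidean_space \<Rightarrow> complex) \<Rightarrow> 'a distr" where
  "distr_of f = (\<lambda>\<phi>. LINT x|lborel. f x * \<phi> x)"

text \<open>On an open set \<open>A\<close>, the distribution \<open>u\<close> is the function \<open>f\<close>, tested against smooth
  functions with compact support in \<open>A\<close>.\<close>

definition is_function_on :: "'a::euclidean_space set \<Rightarrow> 'a distr \<Rightarrow> ('a \<Rightarrow> complex) \<Rightarrow> bool" where
  "is_function_on A u f \<longleftrightarrow>
     (\<forall>\<phi>. schwartz \<phi> \<and> compact (closure {x. \<phi> x \<noteq> 0}) \<and> closure {x. \<phi> x \<noteq> 0} \<subseteq> A \<longrightarrow>
        set_integrable lborel A (\<lambda>x. f x * \<phi> x) \<and> u \<phi> = (LINT x:A|lborel. f x * \<phi> x))"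

definition square_integrable_on :: "'a::euclidean_space set \<Rightarrow> ('a \<Rightarrow> complex) \<Rightarrow> bool" where
  "square_integrable_on A f \<longleftrightarrow>
     set_borel_measurable lborel A f \<and> (\<integral>\<^sup>+x\<in>A. ennreal ((norm (f x))\<^sup>2) \<partial>lborel) < \<infinity>"


section \<open>Fourier transform\<close>

definition fourier :: "('a::euclidean_space \<Rightarrow> complex) \<Rightarrow> 'a \<Rightarrow> complex" where
  "fourier f = (\<lambda>k. LINT x|lborel. cis (- (k \<bullet> x)) * f x)"

text \<open>The Fourier transform of the tempered distribution \<open>u\<close> is the function \<open>v\<close>.  Such a \<open>v\<close>
  is unique up to a null set.\<close>

definition has_fourier :: "'a::euclidean_space distr \<Rightarrow> ('a \<Rightarrow> complex) \<Rightarrow> bool" where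
  "has_fourier u v \<longleftrightarrow> v \<in> borel_measurable lborel \<and>
     (\<forall>\<phi>. schwartz \<phi> \<longrightarrow>
        integrable lborel (\<lambda>k. v k * \<phi> k) \<and> u (fourier \<phi>) = (LINT k|lborel. v k * \<phi> k))"

definition fourier_fun :: "'a::euclidean_space distr \<Rightarrow> 'a \<Rightarrow> complex" where
  "fourier_fun u = (SOME v. has_fourier u v)"


section \<open>Sobolev spaces\<close>

definition ennreal_sqrt :: "ennreal \<Rightarrow> ennreal" where
  "ennreal_sqrt x = (if x = \<infinity> then \<infinity> else ennreal (sqrt (enn2real x)))"

text \<open>All norms below take the value \<open>\<infinity>\<close> outside the space in question.\<close>

definition sobolev_norm :: "real \<Rightarrow> 'a::euclidean_space distr \<Rightarrow> ennreal" where
  "sobolev_norm s u =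
     (if tempered u \<and> (\<exists>v. has_fourier u v)
      then ennreal_sqrt
        (\<integral>\<^sup>+k. ennreal ((1 + (norm k)\<^sup>2) powr s * (norm (fourier_fun u k))\<^sup>2) \<partial>lborel)
      else \<infinity>)"

definition sobolev_space :: "real \<Rightarrow> 'a::euclidean_space distr set" where
  "sobolev_space s = {u. tempered u \<and> sobolev_norm s u < \<infinity>}"

text \<open>The restriction norm of \<open>H\<^sup>m(0,T)\<close> for \<open>m \<ge> 0\<close>, where the elements of \<open>H\<^sup>m(\<real>)\<close> are
  square integrable functions.\<close>

definition sobolev_norm_interval :: "real \<Rightarrow> real \<Rightarrow> (real \<Rightarrow> complex) \<Rightarrow> ennreal" where
  "sobolev_norm_interval m T f =
     (INF F \<in> {F. square_integrable_on UNIV F \<and>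
                  (AE t in lborel. t \<in> {0<..<T} \<longrightarrow> F t = f t)}.
        sobolev_norm m (distr_of F))"


section \<open>The space \<open>B\<^sub>T\<^sup>s\<close>\<close>

text \<open>\<open>h\<close> is the Fourier transform of \<open>g\<close> in the first variable: for almost every \<open>t\<close>, the
  \<open>L\<^sup>2\<close> function \<open>g(\<cdot>,t)\<close> has Fourier transform \<open>h(\<cdot>,t)\<close>, with \<open>h\<close> jointly measurable.
  For \<open>g\<close> in \<open>L\<^sup>2(\<real> \<times> [0,T])\<close> such an \<open>h\<close> exists and is unique up to a null set.\<close>

definition has_partial_fourier ::
    "real \<Rightarrow> (real \<times> real \<Rightarrow> complex) \<Rightarrow> (real \<times> real \<Rightarrow> complex) \<Rightarrow> bool" where
  "has_partial_fourier T g h \<longleftrightarrow>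
     set_borel_measurable lborel (UNIV \<times> {0..T}) h \<and>
     (AE t in lborel. t \<in> {0..T} \<longrightarrow>
        has_fourier (distr_of (\<lambda>x1. g (x1, t))) (\<lambda>k1. h (k1, t)))"

definition partial_fourier :: "real \<Rightarrow> (real \<times> real \<Rightarrow> complex) \<Rightarrow> real \<times> real \<Rightarrow> complex" where
  "partial_fourier T g = (SOME h. has_partial_fourier T g h)"

definition B_norm :: "real \<Rightarrow> real \<Rightarrow> (real \<times> real \<Rightarrow> complex) \<Rightarrow> ennreal" where
  "B_norm s T g =
     (if square_integrable_on (UNIV \<times> {0..T}) g
      then
        ennreal_sqrt (\<integral>\<^sup>+k1.
          (sobolev_norm_interval ((2 * s + 1) / 4) T
             (\<lambda>t. cis (k1\<^sup>2 * t) * partial_fourier T g (k1, t)))\<^sup>2 \<partial>lborel)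
        + ennreal_sqrt (\<integral>\<^sup>+k1.
          ennreal ((1 + k1\<^sup>2) powr s) *
          (sobolev_norm_interval (1 / 4) T
             (\<lambda>t. cis (k1\<^sup>2 * t) * partial_fourier T g (k1, t)))\<^sup>2 \<partial>lborel)
      else \<infinity>)"


section \<open>The linear Schroedinger initial value problem\<close>

definition schroedinger_kernel :: "real \<times> real \<Rightarrow> real \<Rightarrow> real \<Rightarrow> real \<Rightarrow> complex" where
  "schroedinger_kernel = (\<lambda>(k1, k2) x1 x2 t.
     cis (k1 * x1 + k2 * x2 - (k1\<^sup>2 + k2\<^sup>2) * t))"

text \<open>For \<open>U\<^sub>0\<close> in \<open>H\<^sup>s\<close> the transform \<open>v = fourier_fun U\<^sub>0\<close> need not be integrable, and the
  solution formula
    \<open>U(x\<^sub>1,x\<^sub>2,t) = 1/(2\<pi>)\<^sup>2 \<integral> schroedinger_kernel k x\<^sub>1 x\<^sub>2 t * v(k) dk\<close>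
  is an oscillatory integral: it is tested against a Schwartz function, of \<open>(x\<^sub>1,x\<^sub>2)\<close> for
  fixed \<open>t\<close> or of \<open>(x\<^sub>1,t)\<close> for fixed \<open>x\<^sub>2\<close>, before integrating in \<open>k\<close>.  If \<open>v\<close> is
  integrable, this is testing the slice of the classical function, by Fubini.\<close>

definition solution_at_time ::
    "(real \<times> real) distr \<Rightarrow> real \<Rightarrow> (real \<times> real) distr" where
  "solution_at_time U0 t = (\<lambda>\<phi>.
     1 / (2 * of_real pi)\<^sup>2 *
     (LINT k|lborel. fourier_fun U0 k *
        (LINT (x1, x2)|lborel. schroedinger_kernel k x1 x2 t * \<phi> (x1, x2))))"

definition solution_at_x2 ::
    "(real \<times> real) distr \<Rightarrow> real \<Rightarrow> (real \<times> real) distr" where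
  "solution_at_x2 U0 x2 = (\<lambda>\<phi>.
     1 / (2 * of_real pi)\<^sup>2 *
     (LINT k|lborel. fourier_fun U0 k *
        (LINT (x1, t)|lborel. schroedinger_kernel k x1 x2 t * \<phi> (x1, t))))"

definition solves_schroedinger_ivp ::
    "real \<Rightarrow> (real \<times> real) distr \<Rightarrow> (real \<Rightarrow> (real \<times> real) distr) \<Rightarrow> bool" where
  "solves_schroedinger_ivp T U0 U \<longleftrightarrow>
     (\<forall>t\<in>{0..T}. tempered (U t)) \<and>
     (\<forall>\<phi>. schwartz \<phi> \<longrightarrow>
        U 0 \<phi> = U0 \<phi> \<and>
        continuous_on {0..T} (\<lambda>t. U t \<phi>) \<and>
        (\<forall>t\<in>{0<..<T}. \<exists>D. ((\<lambda>\<tau>. U \<tau> \<phi>) has_vector_derivative D) (at t) \<and>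
           \<i> * D + U t (iter_deriv [(1, 0), (1, 0)] \<phi>)
                 + U t (iter_deriv [(0, 1), (0, 1)] \<phi>) = 0))"

end

theory Submission
  imports Defs "HOL-Probability.Characteristic_Functions"
begin

text \<open>
  Let \<open>v\<close> be the Fourier transform of \<open>U\<^sub>0\<close>.  At time \<open>t\<close> the solution has the transform
  \<open>cis (- |k|\<^sup>2 t) v(k)\<close>, which has the same modulus as \<open>v\<close>; hence every \<open>H\<^sup>s\<close> norm is conserved.
  That the oscillatory formula solves the problem is differentiation under the integral, the
  initial value being Fourier inversion on Schwartz functions (\<open>initial_value_problem\<close>).

  On the line \<open>x\<^sub>2 = const\<close> the transform of the solution in \<open>x\<^sub>1\<close>, times \<open>cis (k\<^sub>1\<^sup>2 t)\<close>, is the integral of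
  \<open>cis (k\<^sub>2 x\<^sub>2 - k\<^sub>2\<^sup>2 t) v(k\<^sub>1, k\<^sub>2) / (2 \<pi>)\<close> over \<open>k\<^sub>2\<close>: a superposition of oscillations in \<open>t\<close> with frequency
  \<open>\<tau> = - k\<^sub>2\<^sup>2\<close>.  Passing from \<open>k\<^sub>2\<close> to \<open>\<tau>\<close> costs the Jacobian \<open>2 |k\<^sub>2|\<close>, so the square of the \<open>H\<^sup>m\<close> norm in time is
  controlled by the integral of \<open>(1 + k\<^sub>2\<^sup>2) powr (2 m - 1/2) |v|\<^sup>2\<close>.  The exponent \<open>m = (2 s + 1) / 4\<close> produces the
  weight \<open>(1 + k\<^sub>2\<^sup>2) powr s\<close> and \<open>m = 1/4\<close> produces the weight 1; both terms of the norm of \<open>B\<^sub>T\<^sup>s\<close> are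
  thus bounded by the \<open>H\<^sup>s\<close> norm of \<open>U\<^sub>0\<close>.  The Jacobian degenerates at \<open>k\<^sub>2 = 0\<close>, but only times
  between 0 and 1 matter: multiplied by a Schwartz function of time that is 1 there, each frequency is
  smeared by a rapidly decreasing factor, and the transform in time becomes the absolutely
  convergent integral \<open>profile\<close>.  The estimate is then a weighted Cauchy-Schwarz inequality
  (\<open>profile_bound\<close>), with a constant that depends on \<open>m\<close> only.

  For \<open>v\<close> merely square integrable the trace itself is a limit.  On bounded data with bounded
  support it is a classical integral, and the maps from the data to the trace and to its partial
  transform are bounded in \<open>L\<^sup>2\<close> (\<open>lateral_hat_bound\<close>, \<open>lateral_bound\<close>).  A sequence of truncations that converges fast
  enough yields traces which converge almost everywhere under a square integrable bound
  (\<open>fast_L2_limit\<close>), so all the pairings with Schwartz functions survive the limit on almost every slice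
  (\<open>lateral_limits\<close>).  The transforms found in this way are those chosen in the definition of the
  norms, because a distribution has at most one transform up to null sets (\<open>has_fourier_unique\<close>).
\<close>

section \<open>Schwartz functions and their multipliers\<close>

abbreviation dderiv :: "'a::euclidean_space \<Rightarrow> ('a \<Rightarrow> complex) \<Rightarrow> 'a \<Rightarrow> complex" where
  "dderiv b f \<equiv> (\<lambda>x. frechet_derivative f (at x) b)"

text \<open>Both Schwartz functions and functions with derivatives of polynomial growth are
  described by one growth condition \<open>B\<close> on all derivatives; \<open>tame B n\<close> asks it up to order \<open>n\<close>.  The recursion
  differentiates \<open>f\<close> first, so that closure properties follow by induction on the order.\<close>

fun tame :: "(('a::euclidean_space \<Rightarrow> complex) \<Rightarrow> bool) \<Rightarrow> nat \<Rightarrow> ('a \<Rightarrow> complex) \<Rightarrow> bool" where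
  "tame B 0 f \<longleftrightarrow> B f \<and> (\<forall>x. f differentiable at x)"
| "tame B (Suc n) f \<longleftrightarrow> B f \<and> (\<forall>x. f differentiable at x) \<and> (\<forall>b\<in>Basis. tame B n (dderiv b f))"

definition poly_bounded :: "('a::euclidean_space \<Rightarrow> complex) \<Rightarrow> bool" where
  "poly_bounded f \<longleftrightarrow> (\<exists>N C. \<forall>x. norm (f x) \<le> C * (1 + norm x) ^ N)"

definition rapid :: "('a::euclidean_space \<Rightarrow> complex) \<Rightarrow> bool" where
  "rapid f \<longleftrightarrow> (\<forall>N. \<exists>C. \<forall>x. (1 + norm x) ^ N * norm (f x) \<le> C)"

text \<open>The functions whose product with every Schwartz function is again one.\<close>

definition multiplier :: "('a::euclidean_space \<Rightarrow> complex) \<Rightarrow> bool" where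
  "multiplier f \<longleftrightarrow> (\<forall>n. tame poly_bounded n f)"

text \<open>The recursion of \<open>iter_deriv\<close> differentiates last what \<open>tame\<close> differentiates first.\<close>

lemma iter_deriv_snoc: "iter_deriv (vs @ [b]) f = iter_deriv vs (dderiv b f)"
  by (induction vs) auto

lemma tame_head: "tame B n f \<Longrightarrow> B f \<and> (\<forall>x. f differentiable at x)"
  by (cases n) auto

lemma tame_iff_iter_deriv:
  "tame B n f \<longleftrightarrow> (\<forall>vs. set vs \<subseteq> Basis \<and> length vs \<le> n \<longrightarrow>
      B (iter_deriv vs f) \<and> (\<forall>x. iter_deriv vs f differentiable at x))"
proof (induction n arbitrary: f)
  case (Suc n)
  show ?case (is "_ \<longleftrightarrow> ?R")
  proof
    assume a: "tame B (Suc n) f"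
    show ?R
    proof (intro allI impI)
      fix vs :: "'a list" assume vs: "set vs \<subseteq> Basis \<and> length vs \<le> Suc n"
      show "B (iter_deriv vs f) \<and> (\<forall>x. iter_deriv vs f differentiable at x)"
      proof (cases vs rule: rev_cases)
        case (snoc ws b)
        then have "tame B n (dderiv b f)" using a vs by auto
        then show ?thesis using Suc.IH[of "dderiv b f"] vs snoc by (auto simp: iter_deriv_snoc)
      qed (use a in auto)
    qed
  next
    assume r: ?R
    have "tame B n (dderiv b f)" if "b \<in> Basis" for b
      unfolding Suc.IH
    proof (intro allI impI)
      fix vs :: "'a list" assume "set vs \<subseteq> Basis \<and> length vs \<le> n"
      then show "B (iter_deriv vs (dderiv b f)) \<and> (\<forall>x. iter_deriv vs (dderiv b f) differentiable at x)"
        using r[rule_format, of "vs @ [b]"] that by (simp add: iter_deriv_snoc)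
    qed
    moreover have "B f \<and> (\<forall>x. f differentiable at x)" using r[rule_format, of "[]"] by simp
    ultimately show "tame B (Suc n) f" by simp
  qed
qed auto

lemma tame_Suc_D: "tame B (Suc n) f \<Longrightarrow> tame B n f"
  by (meson le_SucI tame_iff_iter_deriv)

lemma rapid_iff_bounded:
  "rapid f \<longleftrightarrow> (\<forall>N. bounded (range (\<lambda>x. (1 + norm x) ^ N *\<^sub>R f x)))"
  unfolding rapid_def bounded_iff by (auto simp: image_iff)

lemma schwartz_iff_tame: "schwartz f \<longleftrightarrow> (\<forall>n. tame rapid n f)"
  unfolding schwartz_def tame_iff_iter_deriv rapid_iff_bounded by blast

lemma frechet_derivative_plus_complex:
  fixes f g :: "'a::euclidean_space \<Rightarrow> complex"
  assumes "f differentiable at x" "g differentiable at x"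
  shows "frechet_derivative (\<lambda>x. f x + g x) (at x)
    = (\<lambda>h. frechet_derivative f (at x) h + frechet_derivative g (at x) h)"
proof -
  have "((\<lambda>x. f x + g x) has_derivative
      (\<lambda>h. frechet_derivative f (at x) h + frechet_derivative g (at x) h)) (at x)"
    using assms by (intro has_derivative_add) (auto simp: frechet_derivative_works)
  then show ?thesis by (metis frechet_derivative_at)
qed

lemma tame_add:
  assumes "\<And>f g. B f \<Longrightarrow> B g \<Longrightarrow> B (\<lambda>x. f x + g x)"
  shows "tame B n f \<Longrightarrow> tame B n g \<Longrightarrow> tame B n (\<lambda>x. f x + g x)"
proof (induction n arbitrary: f g)
  case (Suc n)
  have "dderiv b (\<lambda>x. f x + g x) = (\<lambda>x. dderiv b f x + dderiv b g x)" for b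
    using Suc.prems by (intro ext fun_cong[OF frechet_derivative_plus_complex]) auto
  then show ?case using Suc assms by auto
qed (use assms in auto)

lemma frechet_derivative_mult_complex:
  fixes f g :: "'a::euclidean_space \<Rightarrow> complex"
  assumes "f differentiable at x" "g differentiable at x"
  shows "frechet_derivative (\<lambda>x. f x * g x) (at x)
    = (\<lambda>h. f x * frechet_derivative g (at x) h + frechet_derivative f (at x) h * g x)"
proof -
  have "((\<lambda>x. f x * g x) has_derivative
      (\<lambda>h. f x * frechet_derivative g (at x) h + frechet_derivative f (at x) h * g x)) (at x)"
    using assms by (intro has_derivative_mult) (auto simp: frechet_derivative_works)
  then show ?thesis by (metis frechet_derivative_at)
qed

text \<open>The Leibniz rule trades one order of \<open>f * g\<close> for a sum of two products of lower order.\<close>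

lemma tame_mult:
  assumes B: "\<And>f g. B1 f \<Longrightarrow> B2 g \<Longrightarrow> B3 (\<lambda>x. f x * g x)"
    and B3: "\<And>f g. B3 f \<Longrightarrow> B3 g \<Longrightarrow> B3 (\<lambda>x. f x + g x)"
  shows "tame B1 n f \<Longrightarrow> tame B2 n g \<Longrightarrow> tame B3 n (\<lambda>x. f x * g x)"
proof (induction n arbitrary: f g)
  case (Suc n)
  have 1: "dderiv b (\<lambda>x. f x * g x) = (\<lambda>x. f x * dderiv b g x + dderiv b f x * g x)" for b
    using Suc.prems by (intro ext) (simp add: frechet_derivative_mult_complex)
  have "tame B3 n (\<lambda>x. f x * dderiv b g x + dderiv b f x * g x)" if "b \<in> Basis" for b
    by (intro tame_add[of B3] B3 Suc.IH) (use Suc.prems that tame_Suc_D in auto)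
  then show ?case using Suc B 1 by auto
qed (use B in auto)

text \<open>To control all derivatives it is enough to place \<open>f\<close> in a family that is closed under
  partial derivatives and each of whose members satisfies the growth condition.\<close>

lemma tame_coinduct:
  assumes "\<And>f. f \<in> S \<Longrightarrow> B f \<and> (\<forall>x. f differentiable at x) \<and> (\<forall>b\<in>Basis. dderiv b f \<in> S)"
  shows "f \<in> S \<Longrightarrow> tame B n f"
  by (induction n arbitrary: f) (use assms in auto)

lemma rapid_add: "rapid f \<Longrightarrow> rapid g \<Longrightarrow> rapid (\<lambda>x. f x + g x)"
  unfolding rapid_def
proof (intro allI)
  fix N assume "\<forall>N. \<exists>C. \<forall>x. (1 + norm x) ^ N * norm (f x) \<le> C"
    "\<forall>N. \<exists>C. \<forall>x. (1 + norm x) ^ N * norm (g x) \<le> C"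
  then obtain C D where C: "\<And>x. (1 + norm x) ^ N * norm (f x) \<le> C"
    and D: "\<And>x. (1 + norm x) ^ N * norm (g x) \<le> D" by metis
  have "(1 + norm x) ^ N * norm (f x + g x) \<le> C + D" for x
  proof -
    have "(1 + norm x) ^ N * norm (f x + g x) \<le> (1 + norm x) ^ N * (norm (f x) + norm (g x))"
      by (intro mult_left_mono norm_triangle_ineq) simp
    then show ?thesis using C[of x] D[of x] by (simp add: distrib_left)
  qed
  then show "\<exists>C. \<forall>x. (1 + norm x) ^ N * norm (f x + g x) \<le> C" by blast
qed

lemma poly_boundedE:
  assumes "poly_bounded f"
  obtains N C where "C \<ge> 0" "\<And>x. norm (f x) \<le> C * (1 + norm x) ^ N"
proof -
  obtain N C where a: "\<And>x. norm (f x) \<le> C * (1 + norm x) ^ N"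
    using assms unfolding poly_bounded_def by blast
  have "0 \<le> C" using a[of 0] order_trans[OF norm_ge_zero a[of 0]] by simp
  then show ?thesis using a that by blast
qed

lemma poly_bounded_add:
  assumes "poly_bounded f" "poly_bounded g" shows "poly_bounded (\<lambda>x. f x + g x)"
proof -
  obtain N C where C: "C \<ge> 0" "\<And>x. norm (f x) \<le> C * (1 + norm x) ^ N" by (rule poly_boundedE[OF assms(1)]) blast
  obtain M D where D: "D \<ge> 0" "\<And>x. norm (g x) \<le> D * (1 + norm x) ^ M" by (rule poly_boundedE[OF assms(2)]) blast
  have "norm (f x + g x) \<le> (C + D) * (1 + norm x) ^ (N + M)" for x
  proof -
    have "norm (f x) \<le> C * (1 + norm x) ^ (N + M)"
      by (rule order_trans[OF C(2)], intro mult_left_mono power_increasing) (use C in auto)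
    moreover have "norm (g x) \<le> D * (1 + norm x) ^ (N + M)"
      by (rule order_trans[OF D(2)], intro mult_left_mono power_increasing) (use D in auto)
    ultimately show ?thesis using norm_triangle_ineq[of "f x" "g x"] by (simp add: distrib_right)
  qed
  then show ?thesis unfolding poly_bounded_def by blast
qed

lemma poly_bounded_mult:
  assumes "poly_bounded f" "poly_bounded g" shows "poly_bounded (\<lambda>x. f x * g x)"
proof -
  obtain N C where C: "C \<ge> 0" "\<And>x. norm (f x) \<le> C * (1 + norm x) ^ N" by (rule poly_boundedE[OF assms(1)]) blast
  obtain M D where D: "D \<ge> 0" "\<And>x. norm (g x) \<le> D * (1 + norm x) ^ M" by (rule poly_boundedE[OF assms(2)]) blast
  have "norm (f x * g x) \<le> (C * D) * (1 + norm x) ^ (N + M)" for x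
    using mult_mono[OF C(2)[of x] D(2)[of x]] C by (simp add: norm_mult power_add algebra_simps)
  then show ?thesis unfolding poly_bounded_def by blast
qed

lemma poly_bounded_times_rapid:
  assumes "poly_bounded f" "rapid g" shows "rapid (\<lambda>x. f x * g x)"
  unfolding rapid_def
proof
  fix K
  obtain N C where C: "C \<ge> 0" "\<And>x. norm (f x) \<le> C * (1 + norm x) ^ N" by (rule poly_boundedE[OF assms(1)]) blast
  obtain D where D: "\<And>x. (1 + norm x) ^ (N + K) * norm (g x) \<le> D" using assms(2) unfolding rapid_def by metis
  have "(1 + norm x) ^ K * norm (f x * g x) \<le> C * D" for x
  proof -
    have "(1 + norm x) ^ K * norm (f x * g x) \<le> (1 + norm x) ^ K * ((C * (1 + norm x) ^ N) * norm (g x))"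
      unfolding norm_mult by (intro mult_left_mono mult_right_mono C) auto
    also have "\<dots> = C * ((1 + norm x) ^ (N + K) * norm (g x))" by (simp add: power_add)
    also have "\<dots> \<le> C * D" by (intro mult_left_mono D C)
    finally show ?thesis .
  qed
  then show "\<exists>C. \<forall>x. (1 + norm x) ^ K * norm (f x * g x) \<le> C" by blast
qed

lemma schwartz_add: "schwartz f \<Longrightarrow> schwartz g \<Longrightarrow> schwartz (\<lambda>x. f x + g x)"
  unfolding schwartz_iff_tame by (blast intro: tame_add rapid_add)

lemma multiplier_add: "multiplier f \<Longrightarrow> multiplier g \<Longrightarrow> multiplier (\<lambda>x. f x + g x)"
  unfolding multiplier_def by (blast intro: tame_add poly_bounded_add)

lemma multiplier_mult: "multiplier f \<Longrightarrow> multiplier g \<Longrightarrow> multiplier (\<lambda>x. f x * g x)"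
  unfolding multiplier_def
  by (intro allI tame_mult[of poly_bounded poly_bounded]) (auto intro: poly_bounded_add poly_bounded_mult)

lemma multiplier_times_schwartz: "multiplier f \<Longrightarrow> schwartz g \<Longrightarrow> schwartz (\<lambda>x. f x * g x)"
  unfolding multiplier_def schwartz_iff_tame
  by (intro allI tame_mult[of poly_bounded rapid]) (auto intro: rapid_add poly_bounded_times_rapid)

lemma poly_bounded_const: "poly_bounded (\<lambda>x. c)"
  unfolding poly_bounded_def by (rule exI[of _ 0], rule exI[of _ "norm c"]) auto

lemma multiplier_const [simp]: "multiplier (\<lambda>x. c)"
  unfolding multiplier_def
  by (intro allI tame_coinduct[of "range (\<lambda>c x. c)"]) (auto simp: poly_bounded_const)

lemma schwartz_cmult: "schwartz f \<Longrightarrow> schwartz (\<lambda>x. c * f x)"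
  by (rule multiplier_times_schwartz) auto

lemma multiplier_dderiv: "multiplier f \<Longrightarrow> b \<in> Basis \<Longrightarrow> multiplier (dderiv b f)"
  unfolding multiplier_def by (metis tame.simps(2))

lemma schwartz_dderiv: "schwartz f \<Longrightarrow> b \<in> Basis \<Longrightarrow> schwartz (dderiv b f)"
  unfolding schwartz_iff_tame by (metis tame.simps(2))

lemma multiplier_differentiable: "multiplier f \<Longrightarrow> f differentiable at x"
  unfolding multiplier_def using tame_head by blast

lemma schwartz_differentiable: "schwartz f \<Longrightarrow> f differentiable at x"
  unfolding schwartz_iff_tame using tame_head by blast

lemma schwartz_continuous: "schwartz f \<Longrightarrow> continuous_on S f"
  by (meson continuous_at_imp_continuous_on differentiable_imp_continuous_within schwartz_differentiable)

lemma schwartz_measurable [measurable_dest]: "schwartz f \<Longrightarrow> f \<in> borel_measurable borel"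
  by (rule borel_measurable_continuous_onI) (rule schwartz_continuous)

lemma schwartz_rapid: "schwartz f \<Longrightarrow> \<exists>C. \<forall>x. (1 + norm x) ^ N * norm (f x) \<le> C"
  by (metis schwartz_iff_tame tame_head rapid_def)

lemma dderivI: "(\<And>x. (f has_derivative D x) (at x)) \<Longrightarrow> dderiv b f = (\<lambda>x. D x b)"
  using frechet_derivative_at by metis

lemma multiplier_inner: "multiplier (\<lambda>x. complex_of_real (x \<bullet> b))"
proof -
  have d: "((\<lambda>x. complex_of_real (x \<bullet> b)) has_derivative (\<lambda>h. complex_of_real (h \<bullet> b))) (at x)" for x
    by (auto intro!: derivative_eq_intros)
  have p: "poly_bounded (\<lambda>x. complex_of_real (x \<bullet> b))"
    unfolding poly_bounded_def
  proof (rule exI[of _ 1], rule exI[of _ "norm b"], rule allI)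
    fix x show "norm (complex_of_real (x \<bullet> b)) \<le> norm b * (1 + norm x) ^ 1"
      using Cauchy_Schwarz_ineq2[of x b] by (simp add: algebra_simps add_increasing)
  qed
  have q: "(\<lambda>x. complex_of_real (x \<bullet> b)) differentiable at x" for x
    using d differentiable_def by blast
  have e: "dderiv c (\<lambda>x. complex_of_real (x \<bullet> b)) = (\<lambda>x. complex_of_real (c \<bullet> b))" for c
    by (rule dderivI[OF d])
  have "tame poly_bounded n (\<lambda>x. complex_of_real (x \<bullet> b))" for n
    using p q multiplier_const[unfolded multiplier_def] by (cases n) (simp_all only: tame.simps e, auto)
  then show ?thesis unfolding multiplier_def by simp
qed

lemma cis_has_derivative [derivative_intros]:
  assumes "(f has_derivative f') (at x within S)"
  shows "((\<lambda>x. cis (f x)) has_derivative (\<lambda>h. \<i> * of_real (f' h) * cis (f x))) (at x within S)"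
proof -
  have "(cis has_vector_derivative (\<i> * cis (f x))) (at (f x))"
    unfolding cis_conv_exp[abs_def] by (rule has_vector_derivative_eq_rhs,
      rule has_vector_derivative_real_field) (auto intro!: derivative_eq_intros)
  then have "(cis has_derivative (\<lambda>h. h *\<^sub>R (\<i> * cis (f x)))) (at (f x))"
    by (simp add: has_vector_derivative_def)
  from has_derivative_compose[OF assms this] show ?thesis
    by (simp add: scaleR_conv_of_real algebra_simps)
qed

lemma multiplier_cis: "multiplier (\<lambda>x. cis (k \<bullet> x))"
proof -
  let ?S = "range (\<lambda>c x. c * cis (k \<bullet> x))"
  have d: "((\<lambda>x. c * cis (k \<bullet> x)) has_derivative (\<lambda>h. c * (\<i> * of_real (k \<bullet> h) * cis (k \<bullet> x)))) (at x)" for c x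
    by (auto intro!: derivative_eq_intros)
  have "multiplier f" if "f \<in> ?S" for f
    unfolding multiplier_def
  proof (intro allI tame_coinduct[of ?S] conjI ballI that)
    fix f assume "f \<in> ?S"
    then obtain c where f: "f = (\<lambda>x. c * cis (k \<bullet> x))" by auto
    show "poly_bounded f" unfolding poly_bounded_def f
      by (rule exI[of _ 0], rule exI[of _ "norm c"]) (auto simp: norm_mult)
    show "f differentiable at x" for x using d f differentiable_def by blast
    show "dderiv b f \<in> ?S" for b
      unfolding f dderivI[OF d]
      by (rule range_eqI[of _ _ "c * (\<i> * of_real (k \<bullet> b))"]) (simp add: algebra_simps)
  qed
  from this[OF range_eqI[of _ _ 1]] show ?thesis by simp
qed

section \<open>Schwartz functions made from exponentials\<close>

text \<open>For positive \<open>u\<close> the derivative of \<open>p(1/u) exp(-1/u)\<close> has the same shape with another polynomial, so this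
  family is closed under differentiation; it contains the standard smooth function that vanishes
  exactly on the nonpositive half line.\<close>

definition flat_exp :: "real poly \<Rightarrow> real \<Rightarrow> real" where
  "flat_exp p u = (if u > 0 then poly p (1 / u) * exp (- (1 / u)) else 0)"

text \<open>The factor \<open>y ^ n\<close> makes the induction on the polynomial go through: each step of Horner's
  scheme raises the power of \<open>y\<close> by one.\<close>

lemma poly_exp_bounded: "\<exists>C. \<forall>y\<ge>0. \<bar>poly p y\<bar> * y ^ n * exp (- y) \<le> (C::real)"
proof (induction p arbitrary: n)
  case (pCons a p)
  obtain C where C: "\<And>y. y \<ge> 0 \<Longrightarrow> \<bar>poly p y\<bar> * y ^ (Suc n) * exp (- y) \<le> C" using pCons by metis
  have "\<bar>poly (pCons a p) y\<bar> * y ^ n * exp (- y) \<le> \<bar>a\<bar> * fact n + C" if "y \<ge> 0" for y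
  proof -
    have "(\<lambda>k. inverse (fact k) *\<^sub>R y ^ k) sums exp y" by (rule exp_converges)
    then have "sum (\<lambda>k. inverse (fact k) *\<^sub>R y ^ k) {n} \<le> exp y"
      using that by (intro sum_le_suminf[where f="\<lambda>k. inverse (fact k) *\<^sub>R y ^ k", THEN order_trans])
        (auto simp: sums_iff)
    then have "y ^ n * exp (- y) \<le> fact n" by (simp add: field_simps exp_minus)
    then have "\<bar>a\<bar> * (y ^ n * exp (- y)) \<le> \<bar>a\<bar> * fact n" by (intro mult_left_mono) auto
    moreover have "\<bar>poly (pCons a p) y\<bar> * y ^ n * exp (- y)
        \<le> (\<bar>a\<bar> + y * \<bar>poly p y\<bar>) * (y ^ n * exp (- y))"
      unfolding mult.assoc using that by (intro mult_right_mono) (auto simp: abs_mult intro: abs_triangle_ineq[THEN order_trans])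
    ultimately show ?thesis using C[OF that] by (simp add: algebra_simps)
  qed
  then show ?case by blast
qed (auto intro!: exI[of _ 0])

lemma flat_bounded: "\<exists>C. \<forall>u. \<bar>flat_exp p u\<bar> \<le> C * \<bar>u\<bar> ^ n"
proof -
  obtain C where C: "\<And>y. y \<ge> 0 \<Longrightarrow> \<bar>poly p y\<bar> * y ^ n * exp (- y) \<le> C" using poly_exp_bounded by metis
  have C0: "0 \<le> C" by (rule order_trans[OF _ C[of 1]]) auto
  have "\<bar>flat_exp p u\<bar> \<le> C * \<bar>u\<bar> ^ n" for u
    using C[of "1 / u"] C0 by (auto simp: flat_exp_def abs_mult field_simps)
  then show ?thesis by blast
qed

text \<open>At the origin the quotient \<open>flat_exp p h / h\<close> tends to 0 since \<open>flat_exp p\<close> vanishes there to second order.\<close>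

lemma flat_deriv: "(flat_exp p has_real_derivative flat_exp (monom 1 2 * (p - pderiv p)) u) (at u)"
proof -
  consider "u > 0" | "u < 0" | "u = 0" by linarith
  then show ?thesis
  proof cases
    case 1
    have "((\<lambda>u. poly p (1 / u) * exp (- (1 / u))) has_real_derivative flat_exp (monom 1 2 * (p - pderiv p)) u) (at u)"
      using 1 by (auto intro!: derivative_eq_intros simp: flat_exp_def poly_monom field_simps power2_eq_square)
    moreover have "eventually (\<lambda>v. flat_exp p v = poly p (1 / v) * exp (- (1 / v))) (nhds u)"
      using eventually_nhds_in_open[of "{0<..}" u] 1 by (auto simp: flat_exp_def elim: eventually_mono)
    ultimately show ?thesis by (subst DERIV_cong_ev[OF refl _ refl]) auto
  next
    case 2
    have "eventually (\<lambda>v. flat_exp p v = 0) (nhds u)"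
      using eventually_nhds_in_open[of "{..<0}" u] 2 by (auto simp: flat_exp_def elim: eventually_mono)
    moreover have "((\<lambda>v. 0) has_real_derivative flat_exp (monom 1 2 * (p - pderiv p)) u) (at u)"
      using 2 by (auto simp: flat_exp_def)
    ultimately show ?thesis by (subst DERIV_cong_ev[OF refl _ refl]) auto
  next
    case 3
    obtain C where C: "\<And>u. \<bar>flat_exp p u\<bar> \<le> C * \<bar>u\<bar> ^ 2" using flat_bounded by metis
    have "(\<lambda>h. flat_exp p h / h) \<midarrow>0\<rightarrow> 0"
    proof (rule Lim_null_comparison[where g="\<lambda>h. C * \<bar>h\<bar>"])
      show "\<forall>\<^sub>F h in at 0. norm (flat_exp p h / h) \<le> C * \<bar>h\<bar>"
        unfolding eventually_at using C
        by (intro exI[of _ 1]) (auto simp: divide_le_eq power2_eq_square mult.assoc)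
    qed (auto intro!: tendsto_eq_intros)
    then show ?thesis using 3 by (simp add: has_field_derivative_iff flat_exp_def)
  qed
qed

lemma multiplier_flat: "multiplier (\<lambda>x. complex_of_real (flat_exp p (\<alpha> * (x \<bullet> b) + \<beta>)))"
proof -
  let ?g = "\<lambda>p x. complex_of_real (flat_exp p (\<alpha> * (x \<bullet> b) + \<beta>))"
  let ?S = "range ?g"
  let ?q = "\<lambda>p. monom 1 2 * (p - pderiv p) :: real poly"
  have d: "(?g p has_derivative (\<lambda>h. complex_of_real ((\<alpha> * (h \<bullet> b)) * flat_exp (?q p) (\<alpha> * (x \<bullet> b) + \<beta>)))) (at x)" for p x
    by (rule has_derivative_of_real, rule has_derivative_eq_rhs,
        rule DERIV_compose_FDERIV[OF flat_deriv[of p]], rule derivative_intros, rule derivative_intros,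
        rule derivative_intros, rule derivative_intros, rule derivative_intros, auto)
  have "multiplier f" if "f \<in> ?S" for f
    unfolding multiplier_def
  proof (intro allI tame_coinduct[of ?S] conjI ballI that)
    fix f assume "f \<in> ?S"
    then obtain p where f: "f = ?g p" by auto
    obtain C where C: "\<And>u. \<bar>flat_exp p u\<bar> \<le> C" using flat_bounded[of p 0] by auto
    show "poly_bounded f" unfolding poly_bounded_def f
      by (rule exI[of _ 0], rule exI[of _ C]) (auto simp: C)
    show "f differentiable at x" for x using d f differentiable_def by blast
    show "dderiv c f \<in> ?S" for c
      unfolding f dderivI[OF d]
      by (rule range_eqI[of _ _ "smult (\<alpha> * (c \<bullet> b)) (?q p)"]) (auto simp: flat_exp_def)
  qed
  then show ?thesis by blast
qed

lemma power_times_gauss_bounded: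
  fixes c :: real assumes "c > 0"
  shows "\<exists>C. \<forall>r\<ge>0. (1 + r) ^ K * exp (- (c * r\<^sup>2)) \<le> C"
proof -
  obtain C :: real where C: "\<And>y. y \<ge> 0 \<Longrightarrow> \<bar>poly 1 y\<bar> * y ^ K * exp (- y) \<le> C"
    using poly_exp_bounded[of 1 K] by blast
  have "(1 + r) ^ K * exp (- (c * r\<^sup>2)) \<le> C * exp (1 + 1 / (4 * c))" if "r \<ge> 0" for r
  proof -
    have "0 \<le> c * (r - 1 / (2 * c))\<^sup>2" using assms by simp
    also have "\<dots> = c * r\<^sup>2 - r + 1 / (4 * c)" using assms by (simp add: power2_diff field_simps power2_eq_square)
    finally have "exp (- (c * r\<^sup>2)) \<le> exp (- (1 + r)) * exp (1 + 1 / (4 * c))"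
      by (simp add: exp_add[symmetric])
    then have "(1 + r) ^ K * exp (- (c * r\<^sup>2)) \<le> (1 + r) ^ K * (exp (- (1 + r)) * exp (1 + 1 / (4 * c)))"
      using that by (intro mult_left_mono) auto
    also have "\<dots> \<le> C * exp (1 + 1 / (4 * c))"
      unfolding mult.assoc[symmetric] using C[of "1 + r"] that by (intro mult_right_mono) auto
    finally show ?thesis .
  qed
  then show ?thesis by blast
qed

text \<open>The multiples of \<open>exp (- p)\<close> by multipliers form a family closed under derivatives, and a quadratic
  lower bound for \<open>p\<close> makes every member rapidly decreasing.  The Gaussian and the cutoff in
  time are the two instances.\<close>

lemma schwartz_exp:
  fixes p :: "'a::euclidean_space \<Rightarrow> real"
  assumes p: "multiplier (\<lambda>x. complex_of_real (p x))"
    and c: "c > 0" and low: "\<And>x. p x \<ge> c * (norm x)\<^sup>2 - d"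
  shows "schwartz (\<lambda>x. complex_of_real (exp (- p x)))"
proof -
  let ?P = "\<lambda>x. complex_of_real (p x)"
  let ?G = "\<lambda>x. exp (- ?P x)"
  let ?S = "{\<lambda>x. m x * ?G x | m. multiplier m}"
  have d: "((\<lambda>x. m x * ?G x) has_derivative
      (\<lambda>h. m x * (?G x * (- frechet_derivative ?P (at x) h)) + frechet_derivative m (at x) h * ?G x)) (at x)"
    if "multiplier m" for m x
  proof (rule has_derivative_mult)
    show "(m has_derivative frechet_derivative m (at x)) (at x)"
      using multiplier_differentiable[OF that] frechet_derivative_works by blast
    have 1: "((\<lambda>x. - ?P x) has_derivative (\<lambda>h. - frechet_derivative ?P (at x) h)) (at x)"
      using multiplier_differentiable[OF p, of x] frechet_derivative_works by (intro has_derivative_minus) blast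
    have 2: "(exp has_derivative (\<lambda>h. exp (- ?P x) * h)) (at (- ?P x))"
      by (meson DERIV_exp has_field_derivative_def)
    show "(?G has_derivative (\<lambda>h. ?G x * - frechet_derivative ?P (at x) h)) (at x)"
      using has_derivative_compose[OF 1 2] .
  qed
  have "schwartz f" if "f \<in> ?S" for f
    unfolding schwartz_iff_tame
  proof (intro allI tame_coinduct[of ?S] conjI ballI that)
    fix f assume "f \<in> ?S"
    then obtain m where f: "f = (\<lambda>x. m x * ?G x)" and m: "multiplier m" by auto
    have "rapid ?G"
      unfolding rapid_def
    proof
      fix K
      obtain C where C: "\<And>r. r\<ge>0 \<Longrightarrow> (1 + r) ^ K * exp (- (c * r\<^sup>2)) \<le> C"
        using power_times_gauss_bounded[OF c] by metis
      have "(1 + norm x) ^ K * norm (?G x) \<le> C * exp d" for x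
      proof -
        have "exp (- p x) \<le> exp (- (c * (norm x)\<^sup>2)) * exp d"
          using low[of x] by (simp add: exp_add[symmetric])
        then have "(1 + norm x) ^ K * norm (?G x) \<le> (1 + norm x) ^ K * (exp (- (c * (norm x)\<^sup>2)) * exp d)"
          by (intro mult_left_mono) auto
        also have "\<dots> \<le> C * exp d"
          unfolding mult.assoc[symmetric] using C[of "norm x"] by (intro mult_right_mono) auto
        finally show ?thesis .
      qed
      then show "\<exists>C. \<forall>x. (1 + norm x) ^ K * norm (?G x) \<le> C" by blast
    qed
    moreover have "poly_bounded m" using m unfolding multiplier_def using tame_head by blast
    ultimately show "rapid f" unfolding f using poly_bounded_times_rapid by blast
    show "f differentiable at x" for x using d[OF m] f differentiable_def by blast
    show "dderiv b f \<in> ?S" if b: "b \<in> Basis" for b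
    proof -
      have "multiplier (\<lambda>x. (-1) * (m x * dderiv b ?P x) + dderiv b m x)"
        by (intro multiplier_add multiplier_mult multiplier_dderiv p m b) auto
      moreover have "dderiv b f = (\<lambda>x. ((-1) * (m x * dderiv b ?P x) + dderiv b m x) * ?G x)"
        unfolding f dderivI[OF d[OF m]] by (auto simp: algebra_simps)
      ultimately show ?thesis by (intro CollectI exI conjI)
    qed
  qed
  moreover have "(\<lambda>x. 1 * ?G x) \<in> ?S" by (intro CollectI exI conjI) (rule refl, rule multiplier_const)
  ultimately have "schwartz (\<lambda>x. 1 * ?G x)" by blast
  then have "schwartz ?G" by simp
  then show ?thesis by (simp add: exp_of_real[symmetric])
qed

lemma multiplier_norm2: "multiplier (\<lambda>x::'a::euclidean_space. complex_of_real ((norm x)\<^sup>2))"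
proof -
  have "multiplier (\<lambda>x::'a. \<Sum>b\<in>F. complex_of_real (x \<bullet> b) * complex_of_real (x \<bullet> b))" if "finite F" for F
    using that by induction (auto intro!: multiplier_add multiplier_mult multiplier_inner)
  from this[of Basis] show ?thesis
    unfolding power2_norm_eq_inner by (subst euclidean_inner) simp
qed

lemma schwartz_gauss:
  assumes "a > 0" shows "schwartz (\<lambda>x::'a::euclidean_space. complex_of_real (exp (- (a * (norm x)\<^sup>2))))"
proof (rule schwartz_exp[where c=a and d=0])
  show "multiplier (\<lambda>x::'a. complex_of_real (a * (norm x)\<^sup>2))"
    using multiplier_mult[OF multiplier_const multiplier_norm2, of "of_real a"] by simp
qed (use assms in auto)

text \<open>The bracket vanishes exactly on \<open>{0..1}\<close> and is bounded below far away, so this is a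
  Schwartz function which is 1 on \<open>{0..1}\<close> although it has full support.\<close>

definition cutoff :: "real \<Rightarrow> real" where
  "cutoff t = exp (- (t\<^sup>2 * (flat_exp 1 (t - 1) + flat_exp 1 (- t))))"

lemma schwartz_cutoff_power:
  assumes "n > 0" shows "schwartz (\<lambda>t. complex_of_real (cutoff t ^ n))"
proof -
  have nn: "0 \<le> flat_exp 1 u" for u by (simp add: flat_exp_def)
  have low: "flat_exp 1 u \<ge> exp (- 1)" if "u \<ge> 1" for u using that by (simp add: flat_exp_def)
  have "schwartz (\<lambda>t. complex_of_real (exp (- (n * (t\<^sup>2 * (flat_exp 1 (t - 1) + flat_exp 1 (- t)))))))"
  proof (rule schwartz_exp[where c="exp (-1)" and d="4 * exp (-1)"])
    have "multiplier (\<lambda>t::real. complex_of_real n * ((complex_of_real (t \<bullet> 1) * complex_of_real (t \<bullet> 1)) *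
       (complex_of_real (flat_exp 1 (1 * (t \<bullet> 1) + (-1))) + complex_of_real (flat_exp 1 ((-1) * (t \<bullet> 1) + 0)))))"
      by (intro multiplier_mult multiplier_add multiplier_inner multiplier_flat multiplier_const)
    then show "multiplier (\<lambda>t. complex_of_real (n * (t\<^sup>2 * (flat_exp 1 (t - 1) + flat_exp 1 (- t)))))"
      by (simp add: power2_eq_square)
    fix t :: real
    show "exp (- 1) * (norm t)\<^sup>2 - 4 * exp (- 1) \<le> n * (t\<^sup>2 * (flat_exp 1 (t - 1) + flat_exp 1 (- t)))"
    proof (cases "\<bar>t\<bar> \<ge> 2")
      case True
      then have "flat_exp 1 (t - 1) + flat_exp 1 (- t) \<ge> exp (- 1)"
        using low[of "t - 1"] low[of "- t"] nn[of "t - 1"] nn[of "- t"] by (cases "t \<ge> 2") (auto simp: abs_if split: if_splits)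
      then have "exp (- 1) * t\<^sup>2 \<le> t\<^sup>2 * (flat_exp 1 (t - 1) + flat_exp 1 (- t))"
        by (subst mult.commute, intro mult_left_mono) auto
      also have "\<dots> \<le> n * (t\<^sup>2 * (flat_exp 1 (t - 1) + flat_exp 1 (- t)))"
        using assms nn[of "t - 1"] nn[of "- t"]
          mult_right_mono[of 1 "real n" "t\<^sup>2 * (flat_exp 1 (t - 1) + flat_exp 1 (- t))"] by auto
      finally have f: "exp (- 1) * t\<^sup>2 \<le> n * (t\<^sup>2 * (flat_exp 1 (t - 1) + flat_exp 1 (- t)))" .
      have "0 \<le> 4 * exp (- 1::real)" by simp
      then show ?thesis using f unfolding real_norm_def power2_abs by linarith
    next
      case False
      then have "\<bar>t\<bar>\<^sup>2 \<le> 2\<^sup>2" by (intro power_mono) auto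
      then have "exp (- 1) * (norm t)\<^sup>2 - 4 * exp (- 1) \<le> 0" by simp
      moreover have "0 \<le> n * (t\<^sup>2 * (flat_exp 1 (t - 1) + flat_exp 1 (- t)))" using nn by simp
      ultimately show ?thesis by linarith
    qed
  qed simp
  then show ?thesis by (simp add: cutoff_def exp_of_nat_mult[symmetric])
qed

lemma cutoff_eq_1: "0 \<le> t \<Longrightarrow> t \<le> 1 \<Longrightarrow> cutoff t = 1"
  by (simp add: cutoff_def flat_exp_def)

section \<open>The Fourier transform on Schwartz functions\<close>

text \<open>An exponent for which \<open>1 / (1 + norm x) ^ n\<close> is integrable, with room to spare.\<close>

definition decay_order :: "'a::euclidean_space itself \<Rightarrow> nat" where
  "decay_order _ = DIM('a) + 2"

text \<open>Where \<open>k \<le> norm x < k + 1\<close> the integrand is at most \<open>1 / (1 + k) ^ n\<close>.  The volume of the ball of radius \<open>k + 1\<close> is a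
  multiple of \<open>(k + 1) ^ DIM('a)\<close>, and the exponent leaves the convergent sum of inverse squares.\<close>

lemma integrable_decay:
  "integrable lborel (\<lambda>x::'a::euclidean_space. 1 / (1 + norm x) ^ decay_order TYPE('a))"
proof (rule integrableI_bounded)
  let ?d = "DIM('a)"
  let ?m = "decay_order TYPE('a)"
  let ?V = "unit_ball_vol ?d"
  have pt: "ennreal (norm (1 / (1 + norm x) ^ ?m))
      \<le> (\<Sum>k. ennreal (1 / (1 + real k) ^ ?m) * indicator (ball 0 (real k + 1)) x)" for x :: 'a
  proof -
    define k where "k = nat \<lfloor>norm x\<rfloor>"
    have k: "real k \<le> norm x" "norm x < real k + 1" unfolding k_def
      by simp_all
    have "(1 + real k) ^ ?m \<le> (1 + norm x) ^ ?m" using k by (intro power_mono) auto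
    then have "ennreal (norm (1 / (1 + norm x) ^ ?m)) \<le> ennreal (1 / (1 + real k) ^ ?m)"
      by (intro ennreal_leI) (auto intro!: divide_left_mono mult_pos_pos simp: add_pos_nonneg)
    also have "\<dots> = (\<Sum>k\<in>{k}. ennreal (1 / (1 + real k) ^ ?m) * indicator (ball 0 (real k + 1)) x)"
      using k by simp
    also have "\<dots> \<le> (\<Sum>k. ennreal (1 / (1 + real k) ^ ?m) * indicator (ball 0 (real k + 1)) x)"
      by (intro sum_le_suminf) auto
    finally show ?thesis .
  qed
  have sm: "summable (\<lambda>k. ?V * (1 / (1 + real k) ^ 2))"
    using inverse_power_summable[of 2, where 'a=real] summable_Suc_iff[of "\<lambda>k. inverse (real k ^ 2)"]
    by (intro summable_mult) (simp add: inverse_eq_divide add.commute)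
  have "(\<integral>\<^sup>+x. ennreal (norm (1 / (1 + norm x) ^ ?m)) \<partial>(lborel::'a measure))
      \<le> (\<integral>\<^sup>+x. (\<Sum>k. ennreal (1 / (1 + real k) ^ ?m) * indicator (ball 0 (real k + 1)) x) \<partial>(lborel::'a measure))"
    by (intro nn_integral_mono pt)
  also have "\<dots> = (\<Sum>k. \<integral>\<^sup>+x. ennreal (1 / (1 + real k) ^ ?m) * indicator (ball (0::'a) (real k + 1)) x \<partial>lborel)"
  proof (rule nn_integral_suminf)
    have [measurable]: "ball (0::'a) r \<in> sets borel" for r by auto
    show "(\<lambda>x::'a. ennreal (1 / (1 + real k) ^ ?m) * indicator (ball 0 (real k + 1)) x) \<in> borel_measurable lborel" for k
      by measurable
  qed
  also have "\<dots> = (\<Sum>k. ennreal (?V * (1 / (1 + real k) ^ 2)))"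
  proof (intro suminf_cong)
    fix k
    have "(1 / (1 + real k) ^ ?m) * (?V * (real k + 1) ^ ?d) = ?V * (1 / (1 + real k) ^ 2)"
      by (simp add: decay_order_def power_add power2_eq_square add.commute)
    then have "ennreal (1 / (1 + real k) ^ ?m) * ennreal (?V * (real k + 1) ^ ?d) = ennreal (?V * (1 / (1 + real k) ^ 2))"
      by (subst ennreal_mult'[symmetric]) auto
    then show "(\<integral>\<^sup>+x. ennreal (1 / (1 + real k) ^ ?m) * indicator (ball (0::'a) (real k + 1)) x \<partial>lborel)
        = ennreal (?V * (1 / (1 + real k) ^ 2))"
      by (subst nn_integral_cmult_indicator) (simp_all add: emeasure_ball)
  qed
  also have "\<dots> < \<infinity>"
    using sm by (subst suminf_ennreal2) auto
  finally show "(\<integral>\<^sup>+x. ennreal (norm (1 / (1 + norm x) ^ ?m)) \<partial>(lborel::'a measure)) < \<infinity>" .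
qed auto

lemma bdd_above_seminorm:
  assumes "schwartz f"
  shows "bdd_above ((\<lambda>(vs, x). (1 + norm x) ^ N * norm (iter_deriv vs f x)) `
    ({vs. set vs \<subseteq> (Basis :: 'a::euclidean_space set) \<and> length vs \<le> N} \<times> UNIV))"
proof -
  let ?L = "{vs. set vs \<subseteq> (Basis :: 'a set) \<and> length vs \<le> N}"
  have "\<exists>C. \<forall>x. (1 + norm x) ^ N * norm (iter_deriv vs f x) \<le> C" if "vs \<in> ?L" for vs
    using assms that unfolding schwartz_def bounded_iff by (fastforce simp: image_iff)
  then obtain C where C: "\<And>vs x. vs \<in> ?L \<Longrightarrow> (1 + norm x) ^ N * norm (iter_deriv vs f x) \<le> C vs" by metis
  have fin: "finite ?L" by (rule finite_lists_length_le) auto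
  show ?thesis
  proof (rule bdd_aboveI2, clarify)
    fix vs :: "'a list" and x assume vs: "set vs \<subseteq> Basis" "length vs \<le> N"
    have "(1 + norm x) ^ N * norm (iter_deriv vs f x) \<le> C vs" using C vs by simp
    also have "\<dots> \<le> Max (C ` ?L)" using fin vs by (intro Max_ge) auto
    finally show "(1 + norm x) ^ N * norm (iter_deriv vs f x) \<le> Max (C ` ?L)" .
  qed
qed

lemma schwartz_seminorm_upper:
  assumes "schwartz f" "set vs \<subseteq> Basis" "length vs \<le> N"
  shows "(1 + norm x) ^ N * norm (iter_deriv vs f x) \<le> schwartz_seminorm N f"
  unfolding schwartz_seminorm_def
  using cSUP_upper[OF _ bdd_above_seminorm[OF assms(1)], of "(vs, x)" N] assms by simp

lemma schwartz_seminorm_bound: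
  "schwartz f \<Longrightarrow> (1 + norm x) ^ N * norm (f x) \<le> schwartz_seminorm N f"
  using schwartz_seminorm_upper[of f "[]" N x] by simp

lemma schwartz_seminorm_nonneg: "schwartz f \<Longrightarrow> 0 \<le> schwartz_seminorm N f"
  by (rule order_trans[OF _ schwartz_seminorm_bound[of f 0]]) auto

lemma schwartz_seminorm_least:
  assumes "\<And>vs x. set vs \<subseteq> Basis \<Longrightarrow> length vs \<le> N \<Longrightarrow> (1 + norm x) ^ N * norm (iter_deriv vs f x) \<le> C"
  shows "schwartz_seminorm N (f :: 'a::euclidean_space \<Rightarrow> complex) \<le> C"
  unfolding schwartz_seminorm_def
proof (rule cSUP_least)
  show "{vs. set vs \<subseteq> (Basis :: 'a set) \<and> length vs \<le> N} \<times> (UNIV :: 'a set) \<noteq> {}"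
    by (auto intro!: exI[of _ "[]"])
qed (use assms in auto)

lemma schwartz_seminorm_dderiv:
  assumes "schwartz f" "b \<in> Basis"
  shows "schwartz_seminorm N (dderiv b f) \<le> schwartz_seminorm (Suc N) f"
proof (rule schwartz_seminorm_least)
  fix vs :: "'a list" and x :: 'a assume vs: "set vs \<subseteq> Basis" "length vs \<le> N"
  have "(1 + norm x) ^ N * norm (iter_deriv vs (dderiv b f) x)
      \<le> (1 + norm x) ^ Suc N * norm (iter_deriv (vs @ [b]) f x)"
    unfolding iter_deriv_snoc by (intro mult_right_mono power_increasing) auto
  also have "\<dots> \<le> schwartz_seminorm (Suc N) f"
    using vs assms by (intro schwartz_seminorm_upper) auto
  finally show "(1 + norm x) ^ N * norm (iter_deriv vs (dderiv b f) x) \<le> schwartz_seminorm (Suc N) f" .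
qed

lemma schwartz_seminorm_Suc:
  assumes "schwartz f"
  shows "schwartz_seminorm N f \<le> schwartz_seminorm (Suc N) f"
proof (rule schwartz_seminorm_least)
  fix vs :: "'a list" and x :: 'a assume vs: "set vs \<subseteq> Basis" "length vs \<le> N"
  have "(1 + norm x) ^ N * norm (iter_deriv vs f x) \<le> (1 + norm x) ^ Suc N * norm (iter_deriv vs f x)"
    by (intro mult_right_mono power_increasing) auto
  also have "\<dots> \<le> schwartz_seminorm (Suc N) f"
    using vs assms by (intro schwartz_seminorm_upper) auto
  finally show "(1 + norm x) ^ N * norm (iter_deriv vs f x) \<le> schwartz_seminorm (Suc N) f" .
qed

lemma schwartz_norm_le:
  "schwartz f \<Longrightarrow> norm (f x) \<le> schwartz_seminorm N f / (1 + norm x) ^ N"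
  using schwartz_seminorm_bound[of f x N] by (subst pos_le_divide_eq) (auto simp: add_pos_nonneg mult.commute)

lemma schwartz_integrable:
  fixes f :: "'a::euclidean_space \<Rightarrow> complex"
  assumes "schwartz f"
  shows "integrable lborel f"
    and "(LINT x|lborel. norm (f x))
      \<le> (LINT x::'a|lborel. 1 / (1 + norm x) ^ decay_order TYPE('a)) * schwartz_seminorm (decay_order TYPE('a)) f"
proof -
  let ?w = "\<lambda>x::'a. 1 / (1 + norm x) ^ decay_order TYPE('a)"
  have i: "integrable lborel (\<lambda>x. ?w x * schwartz_seminorm (decay_order TYPE('a)) f)"
    by (intro integrable_mult_left) (use integrable_decay[where 'a='a] in auto)
  have b: "norm (f x) \<le> ?w x * schwartz_seminorm (decay_order TYPE('a)) f" for x
    using schwartz_norm_le[OF assms, of x "decay_order TYPE('a)"] by simp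
  show 1: "integrable lborel f"
    by (rule Bochner_Integration.integrable_bound[OF i])
      (use assms b schwartz_seminorm_nonneg[OF assms] in \<open>auto intro: schwartz_measurable\<close>)
  have "(LINT x|lborel. norm (f x)) \<le> (LINT x|lborel. ?w x * schwartz_seminorm (decay_order TYPE('a)) f)"
    by (intro integral_mono integrable_norm 1 i b)
  then show "(LINT x|lborel. norm (f x)) \<le> (LINT x|lborel. ?w x) * schwartz_seminorm (decay_order TYPE('a)) f"
    by (simp only: integral_mult_left_zero)
qed

lemma norm_fourier_le: "norm (fourier f k) \<le> (LINT x|lborel. norm (f x))"
  unfolding fourier_def by (rule order_trans[OF integral_norm_bound]) (simp add: norm_mult)

lemma integrable_cis_mult:
  assumes "integrable M f" "g \<in> borel_measurable M"
  shows "integrable M (\<lambda>x. cis (g x) * f x :: complex)"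
proof (rule Bochner_Integration.integrable_bound[OF assms(1)])
  have [measurable]: "f \<in> borel_measurable M" "g \<in> borel_measurable M" using assms by auto
  have [measurable]: "cis \<in> borel_measurable borel"
    by (intro borel_measurable_continuous_onI continuous_intros)
  show "(\<lambda>x. cis (g x) * f x) \<in> borel_measurable M" by measurable
qed (simp add: norm_mult)

text \<open>A remainder that is quadratic in \<open>h\<close>, uniformly in \<open>a\<close>: it permits differentiation under the
  integral sign by a direct estimate.\<close>

lemma cis_quadratic_bound: "norm (cis (a + h) - cis a - \<i> * h * cis a) \<le> h\<^sup>2"
proof -
  have "cis (a + h) - cis a - \<i> * h * cis a = cis a * (cis h - (1 + \<i> * h))"
    by (simp add: cis_mult[symmetric] algebra_simps)
  then have "norm (cis (a + h) - cis a - \<i> * h * cis a) = norm (cis h - (1 + \<i> * h))"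
    by (simp add: norm_mult)
  also have "\<dots> \<le> h\<^sup>2 / 2"
    using iexp_approx1[of h 1] by (simp add: cis_conv_exp numeral_2_eq_2)
  also have "\<dots> \<le> h\<^sup>2" by simp
  finally show ?thesis .
qed

lemma schwartz_times_inner: "schwartz f \<Longrightarrow> schwartz (\<lambda>x. - \<i> * of_real (x \<bullet> b) * f x)"
  by (intro multiplier_times_schwartz multiplier_mult multiplier_inner multiplier_const)

text \<open>The remainder of the first order expansion is at most \<open>K * (norm h)\<^sup>2\<close>, where \<open>K\<close> is the second
  moment of \<open>f\<close>.\<close>

lemma fourier_has_derivative:
  assumes f: "schwartz f"
  shows "(fourier f has_derivative (\<lambda>h. \<Sum>b\<in>Basis. (h \<bullet> b) *\<^sub>R fourier (\<lambda>x. - \<i> * of_real (x \<bullet> b) * f x) k)) (at k)"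
    (is "(_ has_derivative ?D) _")
proof -
  note [measurable] = schwartz_measurable[OF f]
  have if': "integrable lborel f" and iF: "\<And>b. integrable lborel (\<lambda>x. - \<i> * of_real (x \<bullet> b) * f x)"
    using schwartz_integrable schwartz_times_inner f by blast+
  have "integrable lborel (\<lambda>x. \<Sum>b\<in>Basis. - \<i> * of_real (x \<bullet> b) * (- \<i> * of_real (x \<bullet> b) * f x))"
    by (intro Bochner_Integration.integrable_sum schwartz_integrable schwartz_times_inner f)
  then
  have i2: "integrable lborel (\<lambda>x. norm (\<Sum>b\<in>Basis. - \<i> * of_real (x \<bullet> b) * (- \<i> * of_real (x \<bullet> b) * f x)))"
    by (rule integrable_norm)
  have "norm (\<Sum>b\<in>Basis. - \<i> * of_real (x \<bullet> b) * (- \<i> * of_real (x \<bullet> b) * f x)) = (norm x)\<^sup>2 * norm (f x)" for x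
  proof -
    have "(\<Sum>b\<in>Basis. - \<i> * of_real (x \<bullet> b) * (- \<i> * of_real (x \<bullet> b) * f x))
        = (\<Sum>b\<in>Basis. - (of_real ((x \<bullet> b) * (x \<bullet> b)) * f x))"
      by (intro sum.cong) (auto simp: algebra_simps)
    also have "\<dots> = - (of_real (\<Sum>b\<in>Basis. (x \<bullet> b) * (x \<bullet> b)) * f x)"
      by (simp add: sum_negf sum_distrib_right)
    finally show ?thesis
      by (simp add: euclidean_inner[of x x, symmetric] norm_mult power2_norm_eq_inner)
  qed
  with i2 have i2: "integrable lborel (\<lambda>x. (norm x)\<^sup>2 * norm (f x))" by simp
  define K where "K = (LINT x|lborel. (norm x)\<^sup>2 * norm (f x))"
  have key: "norm (fourier f (k + h) - fourier f k - ?D h) \<le> K * (norm h)\<^sup>2" for h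
  proof -
    let ?d = "\<lambda>x. cis (- (k \<bullet> x)) * (- \<i> * of_real (h \<bullet> x) * f x)"
    have D: "?D h = (LINT x|lborel. ?d x)" and iD: "integrable lborel ?d"
    proof -
      have "(\<Sum>b\<in>Basis. (h \<bullet> b) *\<^sub>R (cis (- (k \<bullet> x)) * (- \<i> * of_real (x \<bullet> b) * f x))) = ?d x" for x
      proof -
        have "(\<Sum>b\<in>Basis. (h \<bullet> b) *\<^sub>R (cis (- (k \<bullet> x)) * (- \<i> * of_real (x \<bullet> b) * f x)))
          = (\<Sum>b\<in>Basis. (cis (- (k \<bullet> x)) * (- \<i> * of_real ((h \<bullet> b) * (x \<bullet> b)) * f x)))"
          by (intro sum.cong) (auto simp: scaleR_conv_of_real)
        also have "\<dots> = (cis (- (k \<bullet> x)) * (- \<i> * of_real (\<Sum>b\<in>Basis. (h \<bullet> b) * (x \<bullet> b)) * f x))"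
          by (simp add: sum_distrib_left sum_distrib_right sum_negf)
        finally show ?thesis by (simp add: euclidean_inner[of h x, symmetric])
      qed
      moreover have "integrable lborel (\<lambda>x. (h \<bullet> b) *\<^sub>R (cis (- (k \<bullet> x)) * (- \<i> * of_real (x \<bullet> b) * f x)))" for b
        by (intro integrable_scaleR_right integrable_cis_mult iF) auto
      ultimately show "?D h = (LINT x|lborel. ?d x)" "integrable lborel ?d"
        unfolding fourier_def
        using Bochner_Integration.integral_sum[of Basis lborel "\<lambda>b x. (h \<bullet> b) *\<^sub>R (cis (- (k \<bullet> x)) * (- \<i> * of_real (x \<bullet> b) * f x))"]
          Bochner_Integration.integrable_sum[of Basis lborel "\<lambda>b x. (h \<bullet> b) *\<^sub>R (cis (- (k \<bullet> x)) * (- \<i> * of_real (x \<bullet> b) * f x))"]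
        by simp_all
    qed
    have iA: "integrable lborel (\<lambda>x. cis (- (l \<bullet> x)) * f x)" for l
      by (intro integrable_cis_mult if') auto
    have "norm (fourier f (k + h) - fourier f k - ?D h) =
        norm (LINT x|lborel. cis (- ((k + h) \<bullet> x)) * f x - cis (- (k \<bullet> x)) * f x - ?d x)"
      unfolding D unfolding fourier_def using iA iD by (simp add: Bochner_Integration.integral_diff)
    also have "\<dots> \<le> (LINT x|lborel. (norm h)\<^sup>2 * ((norm x)\<^sup>2 * norm (f x)))"
    proof (rule order_trans[OF integral_norm_bound integral_mono])
      fix x :: 'a
      have "cis (- ((k + h) \<bullet> x)) * f x - cis (- (k \<bullet> x)) * f x - ?d x
        = (cis (- (k \<bullet> x) + - (h \<bullet> x)) - cis (- (k \<bullet> x)) - \<i> * of_real (- (h \<bullet> x)) * cis (- (k \<bullet> x))) * f x"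
        by (simp add: inner_add_left algebra_simps)
      then have "norm (cis (- ((k + h) \<bullet> x)) * f x - cis (- (k \<bullet> x)) * f x - ?d x)
        \<le> (- (h \<bullet> x))\<^sup>2 * norm (f x)"
        using cis_quadratic_bound[of "- (k \<bullet> x)" "- (h \<bullet> x)"] mult_right_mono[OF _ norm_ge_zero]
        by (metis norm_mult)
      also have "\<dots> \<le> (norm h * norm x)\<^sup>2 * norm (f x)"
        using Cauchy_Schwarz_ineq2[of h x] by (intro mult_right_mono) (simp_all add: abs_le_square_iff[symmetric])
      finally show "norm (cis (- ((k + h) \<bullet> x)) * f x - cis (- (k \<bullet> x)) * f x - ?d x) \<le> (norm h)\<^sup>2 * ((norm x)\<^sup>2 * norm (f x))"
        by (simp add: power_mult_distrib mult.assoc)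
    qed (use iA iD i2 in auto)
    also have "\<dots> = K * (norm h)\<^sup>2" unfolding K_def by (simp add: mult.commute)
    finally show ?thesis .
  qed
  show ?thesis
  proof (rule has_derivativeI)
    show "bounded_linear ?D"
      by (intro bounded_linear_sum bounded_linear_intros)
    show "((\<lambda>y. ((fourier f y - fourier f k) - ?D (y - k)) /\<^sub>R norm (y - k)) \<longlongrightarrow> 0) (at k)"
    proof (rule Lim_null_comparison)
      show "\<forall>\<^sub>F y in at k. norm (((fourier f y - fourier f k) - ?D (y - k)) /\<^sub>R norm (y - k)) \<le> K * norm (y - k)"
      proof (intro eventuallyI)
        fix y
        have "norm (fourier f y - fourier f k - ?D (y - k)) \<le> K * (norm (y - k))\<^sup>2"
          using key[of "y - k"] by simp
        then show "norm (((fourier f y - fourier f k) - ?D (y - k)) /\<^sub>R norm (y - k)) \<le> K * norm (y - k)"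
          by (cases "y = k") (simp_all only: norm_scaleR, simp_all add: field_simps power2_eq_square)
      qed
      show "((\<lambda>y. K * norm (y - k)) \<longlongrightarrow> 0) (at k)"
        by (auto intro!: tendsto_eq_intros)
    qed
  qed
qed

lemma fourier_dderiv:
  assumes "schwartz f" "b \<in> Basis"
  shows "dderiv b (fourier f) = fourier (\<lambda>x. - \<i> * of_real (x \<bullet> b) * f x)"
proof -
  have "(\<Sum>c\<in>Basis. (b \<bullet> c) *\<^sub>R fourier (\<lambda>x. - \<i> * of_real (x \<bullet> c) * f x) k)
    = fourier (\<lambda>x. - \<i> * of_real (x \<bullet> b) * f x) k" for k
  proof -
    have "(\<Sum>c\<in>Basis. (b \<bullet> c) *\<^sub>R fourier (\<lambda>x. - \<i> * of_real (x \<bullet> c) * f x) k)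
      = (\<Sum>c\<in>Basis. if c = b then fourier (\<lambda>x. - \<i> * of_real (x \<bullet> c) * f x) k else 0)"
      using assms(2) by (intro sum.cong) (auto simp: inner_Basis)
    then show ?thesis using assms(2) by simp
  qed
  then show ?thesis using dderivI[OF fourier_has_derivative[OF assms(1)]] by simp
qed

lemma lborel_integral_shift:
  fixes f :: "'a::euclidean_space \<Rightarrow> 'b::{banach,second_countable_topology}"
  assumes [measurable]: "f \<in> borel_measurable borel"
  shows "(LINT x|lborel. f (c + x)) = (LINT x|lborel. f x)"
proof -
  have "(LINT x|lborel. f x) = (LINT x|distr lborel borel ((+) c). f x)" by (simp only: lborel_distr_plus)
  also have "\<dots> = (LINT x|lborel. f (c + x))" by (subst integral_distr) auto
  finally show ?thesis by simp
qed

text \<open>Difference quotients have integral 0 by translation invariance, and they converge to the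
  derivative under an integrable bound that the mean value theorem provides.  This replaces
  integration by parts in a space of any dimension.\<close>

lemma integral_dderiv:
  assumes f: "schwartz f" and b: "b \<in> Basis"
  shows "(LINT x|lborel. dderiv b f x) = 0"
proof -
  let ?N = "decay_order TYPE('a)"
  let ?D = "dderiv b f"
  have D: "schwartz ?D" by (rule schwartz_dderiv[OF f b])
  note [measurable] = schwartz_measurable[OF f] schwartz_measurable[OF D]
  define B where "B = schwartz_seminorm ?N ?D"
  have B0: "0 \<le> B" unfolding B_def by (rule schwartz_seminorm_nonneg[OF D])
  \<comment> \<open>the steps are at most 1, so \<open>1 + norm x\<close> changes at most by the factor 2 along them\<close>
  let ?h = "\<lambda>n. 1 / real (Suc n)"
  let ?q = "\<lambda>n x. (f (?h n *\<^sub>R b + x) - f x) /\<^sub>R ?h n"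
  have fd: "((\<lambda>s. f (s *\<^sub>R b + x)) has_derivative (\<lambda>r. r *\<^sub>R ?D (s *\<^sub>R b + x))) (at s)" for s x
  proof -
    have "((\<lambda>s. s *\<^sub>R b + x) has_derivative (\<lambda>r. r *\<^sub>R b)) (at s)" by (auto intro!: derivative_eq_intros)
    moreover have fr: "(f has_derivative frechet_derivative f (at (s *\<^sub>R b + x))) (at (s *\<^sub>R b + x))"
      using schwartz_differentiable[OF f] frechet_derivative_works by blast
    ultimately have "((\<lambda>s. f (s *\<^sub>R b + x)) has_derivative (\<lambda>r. frechet_derivative f (at (s *\<^sub>R b + x)) (r *\<^sub>R b))) (at s)"
      by (rule has_derivative_compose)
    then show ?thesis using linear_scale[OF has_derivative_linear[OF fr]] by simp
  qed
  have "(\<lambda>n. LINT x|lborel. ?q n x) \<longlonglongrightarrow> (LINT x|lborel. ?D x)"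
  proof (rule integral_dominated_convergence[where w="\<lambda>x. (B * 2 ^ ?N) * (1 / (1 + norm x) ^ ?N)"])
    show "integrable lborel (\<lambda>x::'a. (B * 2 ^ ?N) * (1 / (1 + norm x) ^ ?N))"
      by (intro integrable_mult_right integrable_decay)
    show "AE x in lborel. (\<lambda>n. ?q n x) \<longlonglongrightarrow> ?D x"
    proof (rule AE_I2)
      fix x
      have "((\<lambda>s. f (s *\<^sub>R b + x)) has_vector_derivative ?D x) (at 0)"
        using fd[of x 0] by (simp add: has_vector_derivative_def)
      then have "((\<lambda>s. (f (s *\<^sub>R b + x) - f x) /\<^sub>R s) \<longlongrightarrow> ?D x) (at 0)"
      proof -
        assume "((\<lambda>s. f (s *\<^sub>R b + x)) has_vector_derivative ?D x) (at 0)"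
        then have "((\<lambda>s. norm (f (s *\<^sub>R b + x) - f x - s *\<^sub>R ?D x) / norm s) \<longlongrightarrow> 0) (at 0)"
          unfolding has_vector_derivative_def has_derivative_at by simp
        moreover have "\<forall>\<^sub>F s in at 0. norm (f (s *\<^sub>R b + x) - f x - s *\<^sub>R ?D x) / norm s
            = norm ((f (s *\<^sub>R b + x) - f x) /\<^sub>R s - ?D x)"
          unfolding eventually_at
        proof (intro exI[of _ 1] conjI ballI impI, goal_cases)
          case (2 s)
          then have "(f (s *\<^sub>R b + x) - f x) /\<^sub>R s - ?D x = (f (s *\<^sub>R b + x) - f x - s *\<^sub>R ?D x) /\<^sub>R s"
            by (simp add: scaleR_diff_right)
          then show ?case by (simp add: divide_inverse mult.commute)
        qed simp
        ultimately have "((\<lambda>s. norm ((f (s *\<^sub>R b + x) - f x) /\<^sub>R s - ?D x)) \<longlongrightarrow> 0) (at 0)"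
          by (rule Lim_transform_eventually)
        then show ?thesis
          by (rule LIM_zero_cancel[OF tendsto_norm_zero_cancel])
      qed
      moreover have "filterlim ?h (at 0) sequentially"
        unfolding filterlim_at using LIMSEQ_Suc[OF lim_1_over_n] by auto
      ultimately show "(\<lambda>n. ?q n x) \<longlonglongrightarrow> ?D x" by (rule filterlim_compose)
    qed
    show "AE x in lborel. norm (?q n x) \<le> (B * 2 ^ ?N) * (1 / (1 + norm x) ^ ?N)" for n
    proof (rule AE_I2)
      fix x
      have "\<exists>s\<in>{0<..<?h n}. norm (f (?h n *\<^sub>R b + x) - f (0 *\<^sub>R b + x)) \<le> norm ((?h n - 0) *\<^sub>R ?D (s *\<^sub>R b + x))"
        by (rule mvt_general[of 0 "?h n" "\<lambda>s. f (s *\<^sub>R b + x)"])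
          (simp, rule has_derivative_continuous_on, rule has_derivative_at_withinI, rule fd, rule fd)
      then obtain s where s: "0 < s" "s < ?h n"
        and le: "norm (f (?h n *\<^sub>R b + x) - f x) \<le> ?h n * norm (?D (s *\<^sub>R b + x))" by auto
      have "?h n \<le> 1" by simp
      then have "s \<le> 1" using s by linarith
      have "norm x \<le> norm (s *\<^sub>R b + x) + norm (s *\<^sub>R b)"
        using norm_triangle_ineq4[of "s *\<^sub>R b + x" "s *\<^sub>R b"] by simp
      moreover have "norm (s *\<^sub>R b) \<le> 1" using b s \<open>s \<le> 1\<close> by simp
      ultimately have "norm x \<le> norm (s *\<^sub>R b + x) + 1"
        by (meson add_left_mono order_trans)
      then have "1 + norm x \<le> 2 * (1 + norm (s *\<^sub>R b + x))"
        using norm_ge_zero[of "s *\<^sub>R b + x"] by argo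
      then have "(1 + norm x) ^ ?N \<le> 2 ^ ?N * (1 + norm (s *\<^sub>R b + x)) ^ ?N"
        unfolding power_mult_distrib[symmetric] by (intro power_mono) auto
      then have "(1 + norm x) ^ ?N * norm (?D (s *\<^sub>R b + x)) \<le> 2 ^ ?N * (1 + norm (s *\<^sub>R b + x)) ^ ?N * norm (?D (s *\<^sub>R b + x))"
        by (intro mult_right_mono) auto
      also have "\<dots> \<le> 2 ^ ?N * B"
        unfolding B_def mult.assoc by (intro mult_left_mono schwartz_seminorm_bound D) auto
      finally have "norm (?D (s *\<^sub>R b + x)) \<le> (B * 2 ^ ?N) * (1 / (1 + norm x) ^ ?N)"
        by (simp add: pos_le_divide_eq add_pos_nonneg mult.commute del: power_Suc power_add)
      moreover have "norm (?q n x) \<le> norm (?D (s *\<^sub>R b + x))"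
      proof -
        have "norm (?q n x) = inverse (?h n) * norm (f (?h n *\<^sub>R b + x) - f x)" by simp
        also have "\<dots> \<le> inverse (?h n) * (?h n * norm (?D (s *\<^sub>R b + x)))"
          by (rule mult_left_mono[OF le]) simp
        finally show ?thesis by simp
      qed
      ultimately show "norm (?q n x) \<le> (B * 2 ^ ?N) * (1 / (1 + norm x) ^ ?N)" by linarith
    qed
  qed simp_all
  moreover have "(LINT x|lborel. ?q n x) = 0" for n
  proof -
    have i: "integrable lborel f" by (rule schwartz_integrable[OF f])
    have "integrable lborel (\<lambda>x. f (?h n *\<^sub>R b + x))"
      using i integrable_distr_eq[of "(+) (?h n *\<^sub>R b)" lborel borel f] by (simp add: lborel_distr_plus)
    then show ?thesis using i lborel_integral_shift[of f "?h n *\<^sub>R b"]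
      by (simp add: Bochner_Integration.integral_diff)
  qed
  ultimately show ?thesis by (simp add: LIMSEQ_const_iff)
qed

lemma fourier_of_dderiv:
  assumes f: "schwartz f" and b: "b \<in> Basis"
  shows "fourier (dderiv b f) k = \<i> * of_real (k \<bullet> b) * fourier f k"
proof -
  let ?e = "\<lambda>x. cis ((-k) \<bullet> x)"
  have e: "(?e has_derivative (\<lambda>h. \<i> * of_real ((-k) \<bullet> h) * ?e x)) (at x)" for x
    by (auto intro!: derivative_eq_intros)
  have S: "schwartz (\<lambda>x. ?e x * f x)" by (intro multiplier_times_schwartz multiplier_cis f)
  have "dderiv b (\<lambda>x. ?e x * f x) = (\<lambda>x. cis (- (k \<bullet> x)) * dderiv b f x - \<i> * of_real (k \<bullet> b) * (cis (- (k \<bullet> x)) * f x))"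
  proof
    fix x
    have "((\<lambda>x. ?e x * f x) has_derivative
        (\<lambda>h. ?e x * frechet_derivative f (at x) h + \<i> * of_real ((-k) \<bullet> h) * ?e x * f x)) (at x)"
      using schwartz_differentiable[OF f] by (intro has_derivative_mult e) (simp add: frechet_derivative_works)
    from frechet_derivative_at[OF this, symmetric]
    show "dderiv b (\<lambda>x. ?e x * f x) x = cis (- (k \<bullet> x)) * dderiv b f x - \<i> * of_real (k \<bullet> b) * (cis (- (k \<bullet> x)) * f x)"
      by simp
  qed
  with integral_dderiv[OF S b]
  have "0 = (LINT x|lborel. cis (- (k \<bullet> x)) * dderiv b f x - \<i> * of_real (k \<bullet> b) * (cis (- (k \<bullet> x)) * f x))" by simp
  also have "\<dots> = fourier (dderiv b f) k - \<i> * of_real (k \<bullet> b) * fourier f k"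
  proof -
    have "integrable lborel (\<lambda>x. cis (- (k \<bullet> x)) * dderiv b f x)" "integrable lborel (\<lambda>x. cis (- (k \<bullet> x)) * f x)"
      by (intro integrable_cis_mult schwartz_integrable schwartz_dderiv f b; simp)+
    then show ?thesis unfolding fourier_def by (subst Bochner_Integration.integral_diff) simp_all
  qed
  finally show ?thesis by simp
qed

text \<open>Multiplying the transform by a coordinate amounts to transforming a derivative, so each
  factor \<open>1 + norm k\<close> costs one derivative of \<open>f\<close>.  The bound is uniform in \<open>f\<close>, as continuity of tempered
  distributions requires.\<close>

lemma fourier_decay:
  "\<exists>C\<ge>0. \<forall>f. schwartz f \<longrightarrow> (\<forall>k::'a::euclidean_space.
     (1 + norm k) ^ N * norm (fourier f k) \<le> C * schwartz_seminorm (decay_order TYPE('a) + N) f)"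
proof (induction N)
  case 0
  let ?I = "LINT x::'a|lborel. 1 / (1 + norm x) ^ decay_order TYPE('a)"
  have "0 \<le> ?I" by (intro integral_nonneg_AE) auto
  moreover have "norm (fourier f k) \<le> ?I * schwartz_seminorm (decay_order TYPE('a)) f" if "schwartz f" for f and k :: 'a
    by (rule order_trans[OF norm_fourier_le schwartz_integrable(2)[OF that]])
  ultimately show ?case by (intro exI[of _ ?I]) simp
next
  case (Suc N)
  then obtain C where C0: "C \<ge> 0" and C': "\<forall>f. schwartz f \<longrightarrow> (\<forall>k::'a.
     (1 + norm k) ^ N * norm (fourier f k) \<le> C * schwartz_seminorm (decay_order TYPE('a) + N) f)" by (elim exE conjE)
  note C = C'[rule_format]
  have "(1 + norm k) ^ Suc N * norm (fourier f k) \<le> (C * (1 + DIM('a))) * schwartz_seminorm (decay_order TYPE('a) + Suc N) f"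
    if f: "schwartz f" for f :: "'a \<Rightarrow> complex" and k
  proof -
    let ?S = "schwartz_seminorm (decay_order TYPE('a) + Suc N) f"
    have mono: "schwartz_seminorm (decay_order TYPE('a) + N) f \<le> ?S"
      using schwartz_seminorm_Suc[OF f, of "decay_order TYPE('a) + N"] by simp
    have "norm k \<le> (\<Sum>b\<in>Basis. \<bar>k \<bullet> b\<bar>)" by (rule norm_le_l1)
    then have "(1 + norm k) * norm (fourier f k) \<le> (1 + (\<Sum>b\<in>Basis. \<bar>k \<bullet> b\<bar>)) * norm (fourier f k)"
      by (intro mult_right_mono) auto
    also have "\<dots> = norm (fourier f k) + (\<Sum>b\<in>Basis. norm (fourier (dderiv b f) k))"
      by (simp add: fourier_of_dderiv[OF f] norm_mult distrib_right sum_distrib_right)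
    finally have "(1 + norm k) ^ N * ((1 + norm k) * norm (fourier f k))
      \<le> (1 + norm k) ^ N * (norm (fourier f k) + (\<Sum>b\<in>Basis. norm (fourier (dderiv b f) k)))"
      by (intro mult_left_mono) auto
    then have "(1 + norm k) ^ Suc N * norm (fourier f k)
      \<le> (1 + norm k) ^ N * (norm (fourier f k) + (\<Sum>b\<in>Basis. norm (fourier (dderiv b f) k)))"
      by (simp only: power_Suc2 mult.assoc)
    also have "\<dots> = (1 + norm k) ^ N * norm (fourier f k) + (\<Sum>b\<in>Basis. (1 + norm k) ^ N * norm (fourier (dderiv b f) k))"
      by (simp add: distrib_left sum_distrib_left)
    also have "\<dots> \<le> C * ?S + (\<Sum>b\<in>(Basis::'a set). C * ?S)"
    proof (intro add_mono sum_mono)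
      show "(1 + norm k) ^ N * norm (fourier f k) \<le> C * ?S"
        by (rule order_trans[OF C[OF f, of k] mult_left_mono[OF mono C0]])
      fix b :: 'a assume b: "b \<in> Basis"
      show "(1 + norm k) ^ N * norm (fourier (dderiv b f) k) \<le> C * ?S"
        by (rule order_trans[OF C[OF schwartz_dderiv[OF f b], of k]], rule mult_left_mono[OF _ C0])
          (use schwartz_seminorm_dderiv[OF f b, of "decay_order TYPE('a) + N"] in simp)
    qed
    also have "\<dots> = (C * (1 + DIM('a))) * ?S" by (simp add: algebra_simps)
    finally show ?thesis .
  qed
  then show ?case using C0 by (intro exI[of _ "C * (1 + DIM('a))"] conjI allI impI) simp_all
qed

text \<open>Transforms of Schwartz functions form a family closed under derivatives.\<close>

lemma schwartz_fourier:
  assumes "schwartz f" shows "schwartz (fourier f)"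
proof -
  let ?S = "fourier ` Collect schwartz"
  show ?thesis
    unfolding schwartz_iff_tame
  proof (intro allI tame_coinduct[of ?S] conjI ballI)
    show "fourier f \<in> ?S" using assms by auto
    fix F assume "F \<in> ?S"
    then obtain f where F: "F = fourier f" and f: "schwartz f" by auto
    show "rapid F" unfolding rapid_def F using fourier_decay f by meson
    show "F differentiable at x" for x
      using fourier_has_derivative[OF f] F differentiable_def by blast
    show "dderiv b F \<in> ?S" if "b \<in> Basis" for b
      unfolding F fourier_dderiv[OF f that] using schwartz_times_inner[OF f] by auto
  qed
qed

section \<open>Fourier inversion\<close>

lemma lborel_integral_affine:
  fixes f :: "'a::euclidean_space \<Rightarrow> complex"
  assumes c: "c \<noteq> 0" and [measurable]: "f \<in> borel_measurable borel"
  shows "(LINT x|lborel. f x) = \<bar>c\<bar> ^ DIM('a) *\<^sub>R (LINT x|lborel. f (t + c *\<^sub>R x))"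
proof -
  have "(LINT x|lborel. f x) = (LINT x|density (distr lborel borel (\<lambda>x::'a. t + c *\<^sub>R x)) (\<lambda>_. ennreal (\<bar>c\<bar> ^ DIM('a))). f x)"
    using lborel_affine[OF c, of t] by simp
  also have "\<dots> = (LINT x|distr lborel borel (\<lambda>x::'a. t + c *\<^sub>R x). \<bar>c\<bar> ^ DIM('a) *\<^sub>R f x)"
    by (subst integral_density) auto
  also have "\<dots> = (LINT x|lborel. \<bar>c\<bar> ^ DIM('a) *\<^sub>R f (t + c *\<^sub>R x))"
    by (subst integral_distr) auto
  finally show ?thesis by simp
qed

lemma integrable_tensor:
  fixes f :: "'a \<Rightarrow> complex" and g :: "'b \<Rightarrow> complex"
  assumes "sigma_finite_measure M" "sigma_finite_measure N" "integrable M f" "integrable N g"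
  shows "integrable (M \<Otimes>\<^sub>M N) (\<lambda>(x, y). f x * g y)"
proof -
  interpret M: sigma_finite_measure M by fact
  interpret N: sigma_finite_measure N by fact
  interpret pair_sigma_finite M N ..
  have [measurable]: "f \<in> borel_measurable M" "g \<in> borel_measurable N" using assms by auto
  show ?thesis
  proof (rule Fubini_integrable)
    show "(\<lambda>(x, y). f x * g y) \<in> borel_measurable (M \<Otimes>\<^sub>M N)" by measurable
    show "integrable M (\<lambda>x. LINT y|N. norm (case (x, y) of (x, y) \<Rightarrow> f x * g y))"
      using assms by (simp add: norm_mult)
    show "AE x in M. integrable N (\<lambda>y. case (x, y) of (x, y) \<Rightarrow> f x * g y)"
      using assms by simp
  qed
qed

lemma fourier_measurable [measurable]:
  assumes [measurable]: "f \<in> borel_measurable borel"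
  shows "fourier f \<in> borel_measurable borel"
proof -
  have [measurable]: "cis \<in> borel_measurable borel"
    by (intro borel_measurable_continuous_onI continuous_intros)
  have "(\<lambda>k. LINT x|lborel. cis (- (k \<bullet> x)) * f x) \<in> borel_measurable lborel"
    by (rule lborel.borel_measurable_lebesgue_integral) (measurable; simp)
  then show ?thesis unfolding fourier_def by simp
qed

text \<open>The kernel \<open>cis (- (k \<bullet> x))\<close> is symmetric; the identity is Fubini's theorem.\<close>

lemma fourier_multiplication:
  fixes f g :: "'a::euclidean_space \<Rightarrow> complex"
  assumes f: "integrable lborel f" and g: "integrable lborel g"
  shows "(LINT k|lborel. fourier f k * g k) = (LINT x|lborel. f x * fourier g x)"
proof -
  have [measurable]: "f \<in> borel_measurable borel" "g \<in> borel_measurable borel" using f g by auto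
  have "integrable (lborel \<Otimes>\<^sub>M lborel) (\<lambda>p. cis (- (snd p \<bullet> fst p)) * (case p of (x, k) \<Rightarrow> f x * g k))"
    by (rule integrable_cis_mult[OF integrable_tensor]) (use f g lborel.sigma_finite_measure_axioms in auto)
  then have i: "integrable (lborel \<Otimes>\<^sub>M lborel) (\<lambda>(x, k). cis (- (k \<bullet> x)) * (f x * g k))"
    by (simp add: case_prod_unfold)
  have "(LINT k|lborel. fourier f k * g k) = (LINT k|lborel. (LINT x|lborel. cis (- (k \<bullet> x)) * (f x * g k)))"
    unfolding fourier_def by (simp add: mult.assoc[symmetric])
  also have "\<dots> = (LINT x|lborel. (LINT k|lborel. cis (- (k \<bullet> x)) * (f x * g k)))"
    using lborel_pair.Fubini_integral[OF i] .
  also have "\<dots> = (LINT x|lborel. f x * fourier g x)"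
    unfolding fourier_def by (simp add: mult.left_commute inner_commute)
  finally show ?thesis .
qed

lemma integral_lborel_prod:
  fixes f :: "'a::euclidean_space \<Rightarrow> real \<Rightarrow> complex"
  assumes f: "\<And>b. b \<in> Basis \<Longrightarrow> integrable lborel (f b)"
  shows "integrable lborel (\<lambda>x. \<Prod>b\<in>Basis. f b (x \<bullet> b))" (is ?I)
    and "(LINT x|lborel. (\<Prod>b\<in>Basis. f b (x \<bullet> b))) = (\<Prod>b\<in>Basis. LINT y|lborel. f b y)" (is ?E)
proof -
  let ?P = "\<Pi>\<^sub>M b\<in>(Basis::'a set). (lborel :: real measure)"
  interpret product_sigma_finite "\<lambda>_::'a. lborel :: real measure" ..
  have [measurable]: "f b \<in> borel_measurable borel" if "b \<in> Basis" for b using f[OF that] by auto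
  have l: "(lborel :: 'a measure) = distr ?P borel (\<lambda>f. \<Sum>b\<in>Basis. f b *\<^sub>R b)"
    unfolding lborel_def[where 'a='a] lborel_eq_real ..
  have m: "(\<lambda>f. \<Sum>b\<in>Basis. f b *\<^sub>R b) \<in> measurable ?P (borel :: 'a measure)"
    by measurable
  have pm: "(\<lambda>x::'a. \<Prod>b\<in>Basis. f b (x \<bullet> b)) \<in> borel_measurable borel"
    by (rule borel_measurable_prod) measurable
  have e: "(\<Prod>b\<in>Basis. f b ((\<Sum>c\<in>Basis. g c *\<^sub>R c) \<bullet> b)) = (\<Prod>b\<in>Basis. f b (g b))" for g
    by (intro prod.cong) auto
  show ?I unfolding l
    by (subst integrable_distr_eq[OF m pm]) (use product_integrable_prod[OF finite_Basis f] in \<open>simp add: e\<close>)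
  show ?E unfolding l[THEN arg_cong[where f="\<lambda>M. integral\<^sup>L M (\<lambda>x. \<Prod>b\<in>Basis. f b (x \<bullet> b))"]]
    by (subst integral_distr[OF m pm]) (use product_integral_prod[OF finite_Basis f] in \<open>simp add: e\<close>)
qed

text \<open>The characteristic function of the standard normal distribution, up to the factor that
  normalizes its density.\<close>

lemma gauss_transform_real:
  "integrable lborel (\<lambda>y::real. cis (- (t * y)) * complex_of_real (exp (- y\<^sup>2 / 2)))"
  "(LINT y|lborel. cis (- (t * y)) * complex_of_real (exp (- y\<^sup>2 / 2))) = complex_of_real (sqrt (2 * pi) * exp (- t\<^sup>2 / 2))"
proof -
  have "integrable lborel (\<lambda>y. sqrt (2 * pi) * std_normal_density y)"
    by (intro integrable_mult_right) simp
  then have "integrable lborel (\<lambda>y::real. exp (- y\<^sup>2 / 2))"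
    unfolding std_normal_density_def by simp
  then have "integrable lborel (\<lambda>y::real. complex_of_real (exp (- y\<^sup>2 / 2)))" by (rule integrable_of_real)
  then show "integrable lborel (\<lambda>y::real. cis (- (t * y)) * complex_of_real (exp (- y\<^sup>2 / 2)))"
    by (rule integrable_cis_mult) auto
  have "complex_of_real (exp (- t\<^sup>2 / 2)) = char std_normal_distribution (- t)"
    by (simp add: char_std_normal_distribution)
  also have "\<dots> = (LINT y|lborel. std_normal_density y *\<^sub>R iexp (- t * y))"
    unfolding char_def by (subst integral_density) auto
  also have "\<dots> = (LINT y|lborel. (1 / sqrt (2 * pi)) *\<^sub>R (cis (- (t * y)) * complex_of_real (exp (- y\<^sup>2 / 2))))"
    unfolding std_normal_density_def
    by (intro Bochner_Integration.integral_cong) (auto simp: cis_conv_exp scaleR_conv_of_real)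
  also have "\<dots> = (1 / sqrt (2 * pi)) *\<^sub>R (LINT y|lborel. cis (- (t * y)) * complex_of_real (exp (- y\<^sup>2 / 2)))"
    by simp
  finally show "(LINT y|lborel. cis (- (t * y)) * complex_of_real (exp (- y\<^sup>2 / 2))) = complex_of_real (sqrt (2 * pi) * exp (- t\<^sup>2 / 2))"
    by (simp add: scaleR_conv_of_real field_simps)
qed

definition gauss :: "'a::euclidean_space \<Rightarrow> complex" where
  "gauss x = complex_of_real (exp (- ((norm x)\<^sup>2 / 2)))"

lemma schwartz_gauss_fun: "schwartz gauss"
  using schwartz_gauss[of "1/2"] unfolding gauss_def[abs_def] by simp

lemma norm_sq_Basis: "(norm x)\<^sup>2 = (\<Sum>b\<in>Basis. (x \<bullet> b)\<^sup>2)"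
  unfolding power2_norm_eq_inner by (subst euclidean_inner) (simp add: power2_eq_square)

lemma fourier_gauss: "fourier (gauss :: 'a::euclidean_space \<Rightarrow> complex) k = of_real (sqrt (2 * pi) ^ DIM('a)) * gauss k"
proof -
  have g: "gauss x = (\<Prod>b\<in>Basis. complex_of_real (exp (- (x \<bullet> b)\<^sup>2 / 2)))" for x :: 'a
    unfolding gauss_def norm_sq_Basis
    by (simp add: exp_sum[symmetric] sum_negf sum_divide_distrib flip: of_real_prod)
  have c: "cis (- (k \<bullet> x)) = (\<Prod>b\<in>Basis. cis (- ((k \<bullet> b) * (x \<bullet> b))))" for x :: 'a
    unfolding cis_conv_exp euclidean_inner[of k x]
    by (simp add: exp_sum[symmetric] sum_negf sum_distrib_left)
  have "fourier gauss k = (LINT x|lborel. (\<Prod>b\<in>Basis. cis (- ((k \<bullet> b) * (x \<bullet> b))) * complex_of_real (exp (- (x \<bullet> b)\<^sup>2 / 2))))"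
    unfolding fourier_def c g by (simp add: prod.distrib)
  also have "\<dots> = (\<Prod>b\<in>Basis. LINT y|lborel. cis (- ((k \<bullet> b) * y)) * complex_of_real (exp (- y\<^sup>2 / 2)))"
    by (rule integral_lborel_prod(2)) (rule gauss_transform_real)
  also have "\<dots> = (\<Prod>b\<in>(Basis::'a set). complex_of_real (sqrt (2 * pi)) * complex_of_real (exp (- (k \<bullet> b)\<^sup>2 / 2)))"
    unfolding gauss_transform_real by simp
  also have "\<dots> = of_real (sqrt (2 * pi) ^ DIM('a)) * gauss k"
    unfolding g prod.distrib by simp
  finally show ?thesis .
qed

lemma gauss_integrable: "integrable lborel gauss"
  by (rule schwartz_integrable[OF schwartz_gauss_fun])

lemma integral_gauss: "(LINT x::'a::euclidean_space|lborel. gauss x) = of_real (sqrt (2 * pi) ^ DIM('a))"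
  using fourier_gauss[of "0::'a"] by (simp add: fourier_def gauss_def)

lemma norm_gauss_le_1: "norm (gauss x) \<le> 1"
  by (simp add: gauss_def)

lemma gauss_continuous [continuous_intros]: "continuous_on S gauss"
  by (rule schwartz_continuous[OF schwartz_gauss_fun])

lemma gauss_measurable [measurable]: "gauss \<in> borel_measurable borel"
  by (rule schwartz_measurable[OF schwartz_gauss_fun])

text \<open>The integral is regularized by the Gaussian factors \<open>gauss (e n *\<^sub>R k)\<close>.  Moved to the other side by
  \<open>fourier_multiplication\<close> and rescaled, they average \<open>f\<close> against Gaussians that concentrate at \<open>x\<close>; both sides
  converge under dominated convergence.\<close>

theorem fourier_inversion:
  fixes f :: "'a::euclidean_space \<Rightarrow> complex"
  assumes f: "schwartz f"
  shows "(LINT k|lborel. cis (k \<bullet> x) * fourier f k) = of_real ((2 * pi) ^ DIM('a)) * f x"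
proof -
  define c where "c = complex_of_real (sqrt (2 * pi) ^ DIM('a))"
  define e where "e n = 1 / real (Suc n)" for n
  have ep: "e n > 0" for n unfolding e_def by simp
  then have ep0 [simp]: "e n \<noteq> 0" for n by (metis less_irrefl)
  have [measurable]: "cis \<in> borel_measurable borel"
    by (intro borel_measurable_continuous_onI continuous_intros)
  note [measurable] = schwartz_measurable[OF f] schwartz_measurable[OF schwartz_fourier[OF f]]
  have fi: "integrable lborel f" "integrable lborel (fourier f)"
    by (intro schwartz_integrable schwartz_fourier f)+
  have e0: "e \<longlonglongrightarrow> 0" unfolding e_def using LIMSEQ_Suc[OF lim_1_over_n] by simp
  have A: "(LINT k|lborel. fourier f k * (cis (k \<bullet> x) * gauss (e n *\<^sub>R k)))
      = (LINT z|lborel. c * (gauss z * f (x + e n *\<^sub>R z)))" for n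
  proof -
    let ?g = "\<lambda>k. cis (k \<bullet> x) * gauss (e n *\<^sub>R k)"
    have gi: "integrable lborel ?g"
    proof (rule integrable_cis_mult)
      have "schwartz (\<lambda>x::'a. complex_of_real (exp (- ((e n)\<^sup>2 / 2 * (norm x)\<^sup>2))))"
        by (rule schwartz_gauss) (use ep[of n] in simp)
      moreover have "(\<lambda>x::'a. complex_of_real (exp (- ((e n)\<^sup>2 / 2 * (norm x)\<^sup>2)))) = (\<lambda>k. gauss (e n *\<^sub>R k))"
        by (auto simp: gauss_def power_mult_distrib power_divide)
      ultimately show "integrable lborel (\<lambda>k::'a. gauss (e n *\<^sub>R k))" using schwartz_integrable(1) by simp
    qed auto
    have F: "e n ^ DIM('a) *\<^sub>R fourier ?g y = c * gauss ((y - x) /\<^sub>R e n)" for y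
    proof -
      let ?F = "\<lambda>l. cis (- (((y - x) /\<^sub>R e n) \<bullet> l)) * gauss l"
      have "fourier ?g y = (LINT k|lborel. ?F (0 + e n *\<^sub>R k))"
        unfolding fourier_def
      proof (intro Bochner_Integration.integral_cong refl)
        fix k :: 'a
        have "((y - x) /\<^sub>R e n) \<bullet> (0 + e n *\<^sub>R k) = y \<bullet> k - k \<bullet> x"
          using ep[of n] by (simp add: inner_diff_left inner_diff_right inner_commute field_simps)
        then show "cis (- (y \<bullet> k)) * (cis (k \<bullet> x) * gauss (e n *\<^sub>R k)) = ?F (0 + e n *\<^sub>R k)"
          by (simp add: mult.assoc[symmetric] cis_mult)
      qed
      moreover have "fourier gauss ((y - x) /\<^sub>R e n) = \<bar>e n\<bar> ^ DIM('a) *\<^sub>R (LINT k|lborel. ?F (0 + e n *\<^sub>R k))"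
        unfolding fourier_def by (rule lborel_integral_affine) auto
      ultimately show ?thesis using ep[of n] by (simp add: fourier_gauss c_def)
    qed
    have "(LINT k|lborel. fourier f k * ?g k) = (LINT y|lborel. f y * fourier ?g y)"
      by (rule fourier_multiplication[OF fi(1) gi])
    also have "\<dots> = \<bar>e n\<bar> ^ DIM('a) *\<^sub>R (LINT z|lborel. f (x + e n *\<^sub>R z) * fourier ?g (x + e n *\<^sub>R z))"
      by (rule lborel_integral_affine) auto
    also have "\<dots> = (LINT z|lborel. f (x + e n *\<^sub>R z) * (e n ^ DIM('a) *\<^sub>R fourier ?g (x + e n *\<^sub>R z)))"
      using ep[of n] by (simp flip: integral_scaleR_right)
    also have "\<dots> = (LINT z|lborel. c * (gauss z * f (x + e n *\<^sub>R z)))"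
      unfolding F by (intro Bochner_Integration.integral_cong) auto
    finally show ?thesis .
  qed
  have "(\<lambda>n. LINT k|lborel. fourier f k * (cis (k \<bullet> x) * gauss (e n *\<^sub>R k))) \<longlonglongrightarrow> (LINT k|lborel. fourier f k * (cis (k \<bullet> x) * gauss (0::'a)))"
  proof (rule integral_dominated_convergence[where w="\<lambda>k. norm (fourier f k)"])
    show "AE k in lborel. (\<lambda>n. fourier f k * (cis (k \<bullet> x) * gauss (e n *\<^sub>R k))) \<longlonglongrightarrow> fourier f k * (cis (k \<bullet> x) * gauss (0::'a))"
    proof (intro AE_I2 tendsto_intros)
      fix k :: 'a
      have "(\<lambda>n. e n *\<^sub>R k) \<longlonglongrightarrow> 0 *\<^sub>R k" by (intro tendsto_intros e0)
      then show "(\<lambda>n. gauss (e n *\<^sub>R k)) \<longlonglongrightarrow> gauss (0::'a)"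
        using isCont_tendsto_compose[of "0::'a" gauss "\<lambda>n. e n *\<^sub>R k" sequentially] gauss_continuous[of UNIV]
        by (auto simp: continuous_on_eq_continuous_at)
    qed
    show "AE k in lborel. norm (fourier f k * (cis (k \<bullet> x) * gauss (e n *\<^sub>R k))) \<le> norm (fourier f k)" for n
      unfolding norm_mult by (intro AE_I2 mult_left_le) (use norm_gauss_le_1 in auto)
  qed (use fi in auto)
  moreover have "(\<lambda>n. LINT z|lborel. c * (gauss z * f (x + e n *\<^sub>R z))) \<longlonglongrightarrow> (LINT z::'a|lborel. c * (gauss z * f x))"
  proof (rule integral_dominated_convergence[where w="\<lambda>z::'a. norm c * (norm (gauss z) * schwartz_seminorm 0 f)"])
    show "AE z in lborel. (\<lambda>n. c * (gauss z * f (x + e n *\<^sub>R z))) \<longlonglongrightarrow> c * (gauss z * f x)"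
    proof (intro AE_I2 tendsto_intros)
      fix z :: 'a
      have "(\<lambda>n. x + e n *\<^sub>R z) \<longlonglongrightarrow> x + 0 *\<^sub>R z" by (intro tendsto_intros e0)
      then show "(\<lambda>n. f (x + e n *\<^sub>R z)) \<longlonglongrightarrow> f x"
        using isCont_tendsto_compose[of x f "\<lambda>n. x + e n *\<^sub>R z" sequentially] schwartz_continuous[OF f, of UNIV]
        by (simp add: continuous_on_eq_continuous_at)
    qed
    show "AE z in lborel. norm (c * (gauss z * f (x + e n *\<^sub>R z))) \<le> norm c * (norm (gauss z) * schwartz_seminorm 0 f)" for n
      unfolding norm_mult by (intro AE_I2 mult_left_mono) (use schwartz_seminorm_bound[OF f, of _ 0] in auto)
    show "integrable lborel (\<lambda>z::'a. norm c * (norm (gauss z) * schwartz_seminorm 0 f))"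
      by (intro integrable_mult_right integrable_mult_left integrable_norm gauss_integrable)
  qed auto
  ultimately have "(LINT k|lborel. fourier f k * (cis (k \<bullet> x) * gauss (0::'a))) = (LINT z::'a|lborel. c * (gauss z * f x))"
    unfolding A by (rule LIMSEQ_unique)
  also have "\<dots> = c * (c * f x)"
    by (simp add: integral_gauss c_def)
  also have "\<dots> = of_real ((2 * pi) ^ DIM('a)) * f x"
  proof -
    have "c * c = of_real ((2 * pi) ^ DIM('a))"
      unfolding c_def of_real_mult[symmetric] power_mult_distrib[symmetric] by simp
    then show ?thesis by (simp only: mult.assoc[symmetric])
  qed
  finally show ?thesis by (simp add: gauss_def mult.commute)
qed

lemma two_pi_pow_nz: "complex_of_real ((2 * pi) ^ n) \<noteq> 0"
  by simp

lemma fourier_fourier: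
  assumes "schwartz (f :: 'a::euclidean_space \<Rightarrow> complex)"
  shows "fourier (fourier f) x = of_real ((2 * pi) ^ DIM('a)) * f (- x)"
  using fourier_inversion[OF assms, of "- x"] by (simp add: fourier_def[of "fourier f"] inner_commute)

text \<open>Reflection is, up to a constant, the square of the Fourier transform.\<close>

lemma schwartz_reflect:
  assumes "schwartz (f :: 'a::euclidean_space \<Rightarrow> complex)"
  shows "schwartz (\<lambda>x. f (- x))"
proof -
  have "schwartz (\<lambda>x. inverse (of_real ((2 * pi) ^ DIM('a))) * fourier (fourier f) x)"
    by (intro schwartz_cmult schwartz_fourier assms)
  moreover have "inverse (of_real ((2 * pi) ^ DIM('a))) * (of_real ((2 * pi) ^ DIM('a)) * f (- x)) = f (- x)" for x
    by (simp only: mult.assoc[symmetric] left_inverse[OF two_pi_pow_nz] mult_1)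
  ultimately show ?thesis unfolding fourier_fourier[OF assms] by (simp only:)
qed

lemma schwartz_is_fourier:
  assumes "schwartz (f :: 'a::euclidean_space \<Rightarrow> complex)"
  shows "fourier (\<lambda>k. inverse (of_real ((2 * pi) ^ DIM('a))) * fourier f (- k)) x = f x"
proof -
  note [measurable] = schwartz_measurable[OF schwartz_fourier[OF assms]]
  have [measurable]: "cis \<in> borel_measurable borel"
    by (intro borel_measurable_continuous_onI continuous_intros)
  have "(LINT k|lborel. cis (k \<bullet> x) * fourier f k) = \<bar>-1\<bar> ^ DIM('a) *\<^sub>R (LINT k|lborel. cis ((0 + (-1) *\<^sub>R k) \<bullet> x) * fourier f (0 + (-1) *\<^sub>R k))"
    by (rule lborel_integral_affine) auto
  then have "(LINT k|lborel. cis (- (x \<bullet> k)) * fourier f (- k)) = of_real ((2 * pi) ^ DIM('a)) * f x"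
    using fourier_inversion[OF assms, of x] by (simp add: inner_commute)
  then have "inverse (of_real ((2 * pi) ^ DIM('a))) * (LINT k|lborel. cis (- (x \<bullet> k)) * fourier f (- k)) = f x"
    by (simp only: mult.assoc[symmetric] left_inverse[OF two_pi_pow_nz] mult_1)
  then show ?thesis unfolding fourier_def[of "\<lambda>k. inverse (of_real ((2 * pi) ^ DIM('a))) * fourier f (- k)"]
    by (simp only: mult.left_commute[of "cis _"] integral_mult_right_zero)
qed

section \<open>Uniqueness of Fourier transforms\<close>

lemma multiplier_prod:
  "finite I \<Longrightarrow> (\<And>i. i \<in> I \<Longrightarrow> multiplier (f i)) \<Longrightarrow> multiplier (\<lambda>x. \<Prod>i\<in>I. f i x)"
  by (induction I rule: finite_induct) (auto intro!: multiplier_mult)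

lemma flat_exp_1_bounds: "0 \<le> flat_exp 1 u" "flat_exp 1 u \<le> 1"
  by (auto simp: flat_exp_def)

lemma flat_exp_1_tendsto: "(\<lambda>n. flat_exp 1 (real (Suc n) * u)) \<longlonglongrightarrow> (if u > 0 then 1 else 0)"
proof (cases "u > 0")
  case True
  have "(\<lambda>n. exp (- ((1 / real (Suc n)) * (1 / u)))) \<longlonglongrightarrow> exp (- (0 * (1 / u)))"
    by (intro tendsto_intros LIMSEQ_Suc[OF lim_1_over_n])
  moreover have "flat_exp 1 (real (Suc n) * u) = exp (- ((1 / real (Suc n)) * (1 / u)))" for n
    using True by (simp add: flat_exp_def del: of_nat_Suc)
  ultimately show ?thesis using True by simp
next
  case False
  then have "flat_exp 1 (real (Suc n) * u) = 0" for n
    by (simp add: flat_exp_def mult_le_0_iff not_less zero_less_mult_iff del: of_nat_Suc)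
  then show ?thesis using False by simp
qed

text \<open>Multiplied by a Gaussian, \<open>w\<close> becomes integrable while remaining orthogonal to all bounded multipliers.
  Products of functions \<open>flat_exp\<close> of the coordinates converge boundedly to indicators of boxes, so the
  integral over each box vanishes, and then over each Borel set.\<close>

lemma AE_zero_if_schwartz_orthogonal:
  fixes w :: "'a::euclidean_space \<Rightarrow> complex"
  assumes m: "w \<in> borel_measurable lborel"
    and i: "\<And>\<phi>. schwartz \<phi> \<Longrightarrow> integrable lborel (\<lambda>k. w k * \<phi> k)"
    and z: "\<And>\<phi>. schwartz \<phi> \<Longrightarrow> (LINT k|lborel. w k * \<phi> k) = 0"
  shows "AE k in lborel. w k = 0"
proof -
  let ?w = "\<lambda>k. w k * gauss k"
  have wi: "integrable lborel ?w" by (rule i[OF schwartz_gauss_fun])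
  have [measurable]: "w \<in> borel_measurable borel" using m by simp
  \<comment> \<open>a multiplier close to the indicator of \<open>box a b\<close>: it vanishes outside, and tends to 1 inside\<close>
  define smooth_box where "smooth_box a b n x = (\<Prod>c\<in>Basis. complex_of_real (flat_exp 1 (real (Suc n) * (x \<bullet> c) + (- real (Suc n) * (a \<bullet> c))))
      * complex_of_real (flat_exp 1 (- real (Suc n) * (x \<bullet> c) + real (Suc n) * (b \<bullet> c))))" for a b n and x :: 'a
  have smooth_boxm: "multiplier (smooth_box a b n)" for a b n
    unfolding smooth_box_def by (intro multiplier_prod multiplier_mult multiplier_flat) auto
  have [measurable]: "smooth_box a b n \<in> borel_measurable borel" for a b n
    by (intro borel_measurable_continuous_onI continuous_at_imp_continuous_on ballI
      differentiable_imp_continuous_within multiplier_differentiable smooth_boxm)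
  have box: "set_lebesgue_integral lborel (box a b) ?w = 0" for a b
  proof -
    have "(\<lambda>n. LINT k|lborel. smooth_box a b n k * ?w k) \<longlonglongrightarrow> (LINT k|lborel. indicator (box a b) k *\<^sub>R ?w k)"
    proof (rule integral_dominated_convergence[where w="\<lambda>k. norm (?w k)"])
      show "AE k in lborel. (\<lambda>n. smooth_box a b n k * ?w k) \<longlonglongrightarrow> indicator (box a b) k *\<^sub>R ?w k"
      proof (rule AE_I2)
        fix k :: 'a
        have "(\<lambda>n. smooth_box a b n k) \<longlonglongrightarrow> (\<Prod>c\<in>Basis. complex_of_real (if k \<bullet> c - a \<bullet> c > 0 then 1 else 0) * complex_of_real (if b \<bullet> c - k \<bullet> c > 0 then 1 else 0))"
          unfolding smooth_box_def
        proof (intro tendsto_prod tendsto_mult tendsto_of_real)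
          fix c :: 'a
          show "(\<lambda>n. flat_exp 1 (real (Suc n) * (k \<bullet> c) + (- real (Suc n) * (a \<bullet> c)))) \<longlonglongrightarrow> (if k \<bullet> c - a \<bullet> c > 0 then 1 else 0)"
            using flat_exp_1_tendsto[of "k \<bullet> c - a \<bullet> c"] by (simp add: right_diff_distrib del: of_nat_Suc)
          show "(\<lambda>n. flat_exp 1 (- real (Suc n) * (k \<bullet> c) + real (Suc n) * (b \<bullet> c))) \<longlonglongrightarrow> (if b \<bullet> c - k \<bullet> c > 0 then 1 else 0)"
            using flat_exp_1_tendsto[of "b \<bullet> c - k \<bullet> c"] by (simp add: right_diff_distrib del: of_nat_Suc)
        qed
        also have "(\<Prod>c\<in>Basis. complex_of_real (if k \<bullet> c - a \<bullet> c > 0 then 1 else 0) * complex_of_real (if b \<bullet> c - k \<bullet> c > 0 then 1 else 0)) = indicator (box a b) k"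
        proof (cases "k \<in> box a b")
          case True
          then show ?thesis by (auto simp: mem_box intro!: prod.neutral)
        next
          case False
          then obtain c where "c \<in> Basis" "\<not> (a \<bullet> c < k \<bullet> c \<and> k \<bullet> c < b \<bullet> c)" by (auto simp: mem_box)
          then show ?thesis using False by (auto intro!: prod_zero bexI[of _ c])
        qed
        finally have "(\<lambda>n. smooth_box a b n k * ?w k) \<longlonglongrightarrow> indicator (box a b) k * ?w k"
          by (rule tendsto_mult[OF _ tendsto_const])
        moreover have "indicator (box a b) k * ?w k = indicator (box a b) k *\<^sub>R ?w k"
          by (simp add: indicator_def)
        ultimately show "(\<lambda>n. smooth_box a b n k * ?w k) \<longlonglongrightarrow> indicator (box a b) k *\<^sub>R ?w k" by (simp only:)
      qed
      have "norm (smooth_box a b n k) \<le> 1" for n k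
        unfolding smooth_box_def prod_norm[symmetric] norm_mult
      proof (rule prod_le_1, intro conjI mult_nonneg_nonneg mult_le_one norm_ge_zero)
        show "norm (complex_of_real (flat_exp 1 u)) \<le> 1" for u
          using flat_exp_1_bounds[of u] by simp
        then show "norm (complex_of_real (flat_exp 1 u)) \<le> 1" for u .
      qed
      then show "AE k in lborel. norm (smooth_box a b n k * ?w k) \<le> norm (?w k)" for n
        by (subst norm_mult) (auto intro!: mult_left_le_one_le)
    qed (use wi in auto)
    moreover have "(LINT k|lborel. smooth_box a b n k * ?w k) = 0" for n
      using z[OF multiplier_times_schwartz[OF smooth_boxm schwartz_gauss_fun], of a b n] by (simp add: mult.left_commute)
    ultimately show ?thesis unfolding set_lebesgue_integral_def by (simp add: LIMSEQ_const_iff)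
  qed
  have all: "set_lebesgue_integral lborel A ?w = 0" if "A \<in> sets lborel" for A
  proof -
    let ?E = "range (\<lambda>(a, b). box a b::'a set)"
    have "A \<in> sigma_sets UNIV ?E" using that by (simp add: borel_eq_box)
    then show ?thesis
    proof (induction rule: sigma_sets_induct_disjoint[rotated 2, consumes 1, case_names basic empty compl union])
      case (basic A)
      then show ?case using box by auto
    next
      case empty
      then show ?case by (simp add: set_lebesgue_integral_def)
    next
      case (compl A)
      then have A: "A \<in> sets lborel" by (simp add: borel_eq_box)
      have "set_lebesgue_integral lborel (UNIV - A) ?w = (LINT k|lborel. ?w k - indicator A k *\<^sub>R ?w k)"
        unfolding set_lebesgue_integral_def
        by (intro Bochner_Integration.integral_cong refl) (simp add: indicator_def)
      also have "\<dots> = (LINT k|lborel. ?w k) - (LINT k|lborel. indicator A k *\<^sub>R ?w k)"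
        by (intro Bochner_Integration.integral_diff wi integrable_mult_indicator A)
      finally show ?case using compl.IH z[OF schwartz_gauss_fun] by (simp add: set_lebesgue_integral_def)
    next
      case (union A)
      then have A: "A i \<in> sets lborel" for i by (auto simp: borel_eq_box)
      have "set_lebesgue_integral lborel (\<Union>i. A i) ?w = (\<Sum>i. set_lebesgue_integral lborel (A i) ?w)"
        by (rule lebesgue_integral_countable_add[OF A])
          (use union.hyps A in \<open>auto simp: disjoint_family_on_def set_integrable_def intro!: integrable_mult_indicator wi\<close>)
      then show ?case using union by simp
    qed (auto simp: Int_stable_def box_Int_box)
  qed
  have "AE k in lborel. ?w k = 0" by (rule sigma_finite_measure.density_zero[OF lborel.sigma_finite_measure_axioms wi all])
  then show ?thesis by (simp add: gauss_def)
qed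

lemma has_fourier_unique:
  assumes "has_fourier u v" "has_fourier u v'"
  shows "AE k in lborel. v k = v' k"
proof -
  have "AE k in lborel. v k - v' k = 0"
  proof (rule AE_zero_if_schwartz_orthogonal)
    fix \<phi> :: "'a \<Rightarrow> complex" assume "schwartz \<phi>"
    then have a: "integrable lborel (\<lambda>k. v k * \<phi> k)" "u (fourier \<phi>) = (LINT k|lborel. v k * \<phi> k)"
        "integrable lborel (\<lambda>k. v' k * \<phi> k)" "u (fourier \<phi>) = (LINT k|lborel. v' k * \<phi> k)"
      using assms unfolding has_fourier_def by blast+
    then show "integrable lborel (\<lambda>k. (v k - v' k) * \<phi> k)" by (simp add: left_diff_distrib)
    show "(LINT k|lborel. (v k - v' k) * \<phi> k) = 0"
      using a by (simp add: left_diff_distrib Bochner_Integration.integral_diff)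
  qed (use assms in \<open>auto simp: has_fourier_def\<close>)
  then show ?thesis by simp
qed

lemma has_fourier_fourier_fun: "has_fourier u v \<Longrightarrow> has_fourier u (fourier_fun u)"
  unfolding fourier_fun_def using someI[of "has_fourier u"] .

lemma fourier_fun_AE: "has_fourier u v \<Longrightarrow> AE k in lborel. fourier_fun u k = v k"
  using has_fourier_unique has_fourier_fourier_fun by blast

lemma sobolev_norm_eq:
  assumes "tempered u" "has_fourier u v"
  shows "sobolev_norm s u = ennreal_sqrt (\<integral>\<^sup>+k. ennreal ((1 + (norm k)\<^sup>2) powr s * (norm (v k))\<^sup>2) \<partial>lborel)"
proof -
  have "(\<integral>\<^sup>+k. ennreal ((1 + (norm k)\<^sup>2) powr s * (norm (fourier_fun u k))\<^sup>2) \<partial>lborel)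
     = (\<integral>\<^sup>+k. ennreal ((1 + (norm k)\<^sup>2) powr s * (norm (v k))\<^sup>2) \<partial>lborel)"
    using fourier_fun_AE[OF assms(2)] by (intro nn_integral_cong_AE) auto
  then show ?thesis using assms by (auto simp: sobolev_norm_def)
qed

section \<open>Functions of moderate growth as distributions\<close>

text \<open>Integrable against some power of \<open>1 + norm x\<close>; it covers the \<open>L\<^sup>2\<close> spaces with weight
  \<open>(1 + (norm k)\<^sup>2) powr s\<close> for every real \<open>s\<close>, and it makes a function a tempered distribution.\<close>

definition moderate :: "('a::euclidean_space \<Rightarrow> complex) \<Rightarrow> bool" where
  "moderate v \<longleftrightarrow> v \<in> borel_measurable borel \<and> (\<exists>M. integrable lborel (\<lambda>x. norm (v x) / (1 + norm x) ^ M))"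

lemma moderate_pairing:
  assumes "moderate v"
  shows "\<exists>M K. 0 \<le> K \<and> (\<forall>\<phi> B. \<phi> \<in> borel_measurable borel \<and> (\<forall>x. (1 + norm x) ^ M * norm (\<phi> x) \<le> B) \<longrightarrow>
    integrable lborel (\<lambda>x. v x * \<phi> x) \<and> norm (LINT x|lborel. v x * \<phi> x) \<le> K * B)"
proof -
  obtain M where M: "integrable lborel (\<lambda>x. norm (v x) / (1 + norm x) ^ M)" and [measurable]: "v \<in> borel_measurable borel"
    using assms unfolding moderate_def by blast
  let ?K = "LINT x|lborel. norm (v x) / (1 + norm x) ^ M"
  have "integrable lborel (\<lambda>x. v x * \<phi> x) \<and> norm (LINT x|lborel. v x * \<phi> x) \<le> ?K * B"
    if [measurable]: "\<phi> \<in> borel_measurable borel" and B: "\<And>x. (1 + norm x) ^ M * norm (\<phi> x) \<le> B" for \<phi> B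
  proof -
    have i: "integrable lborel (\<lambda>x. norm (v x) / (1 + norm x) ^ M * B)"
      by (intro integrable_mult_left M)
    have b: "norm (v x * \<phi> x) \<le> norm (v x) / (1 + norm x) ^ M * B" for x
    proof -
      have "norm (\<phi> x) \<le> B / (1 + norm x) ^ M"
        using B[of x] by (subst pos_le_divide_eq) (auto simp: add_pos_nonneg mult.commute)
      from mult_left_mono[OF this norm_ge_zero[of "v x"]] show ?thesis by (simp add: norm_mult)
    qed
    have vi: "integrable lborel (\<lambda>x. v x * \<phi> x)"
      by (rule Bochner_Integration.integrable_bound[OF i]) (measurable, simp only: real_norm_def, intro AE_I2, rule order_trans[OF b abs_ge_self])
    have "norm (LINT x|lborel. v x * \<phi> x) \<le> (LINT x|lborel. norm (v x * \<phi> x))"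
      by (rule integral_norm_bound)
    also have "\<dots> \<le> (LINT x|lborel. norm (v x) / (1 + norm x) ^ M * B)"
      by (intro integral_mono integrable_norm vi i b)
    also have "\<dots> = ?K * B" by (simp only: integral_mult_left_zero)
    finally show ?thesis using vi by blast
  qed
  moreover have "0 \<le> ?K" by (intro integral_nonneg_AE) auto
  ultimately show ?thesis by blast
qed

lemma moderate_times_schwartz:
  assumes "moderate v" "schwartz \<phi>"
  shows "integrable lborel (\<lambda>x. v x * \<phi> x)"
proof -
  obtain M K where K: "\<forall>\<phi> B. \<phi> \<in> borel_measurable borel \<and> (\<forall>x. (1 + norm x) ^ M * norm (\<phi> x) \<le> B) \<longrightarrow>
    integrable lborel (\<lambda>x. v x * \<phi> x) \<and> norm (LINT x|lborel. v x * \<phi> x) \<le> K * B"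
    using moderate_pairing[OF assms(1)] by blast
  show ?thesis
    using K[rule_format, of \<phi> "schwartz_seminorm M \<phi>"] schwartz_seminorm_bound[OF assms(2)] schwartz_measurable[OF assms(2)] by blast
qed

text \<open>\<open>L\<close> stands for the identity, or for the Fourier transform followed by the evolution factor.\<close>

lemma tempered_pairing:
  assumes v: "moderate v" and L: "\<And>\<phi> \<psi> a x. schwartz \<phi> \<Longrightarrow> schwartz \<psi> \<Longrightarrow> L (\<lambda>x. \<phi> x + a * \<psi> x) x = L \<phi> x + a * L \<psi> x"
    and m: "\<And>\<phi>. schwartz \<phi> \<Longrightarrow> L \<phi> \<in> borel_measurable borel"
    and b: "\<And>M. \<exists>N C. \<forall>\<phi>. schwartz \<phi> \<longrightarrow> (\<forall>x. (1 + norm x) ^ M * norm (L \<phi> x) \<le> C * schwartz_seminorm N \<phi>)"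
  shows "tempered (\<lambda>\<phi>. LINT x|lborel. v x * L \<phi> x)"
proof -
  obtain M K where K0: "0 \<le> K" and K: "\<forall>\<phi> B. \<phi> \<in> borel_measurable borel \<and> (\<forall>x. (1 + norm x) ^ M * norm (\<phi> x) \<le> B) \<longrightarrow>
    integrable lborel (\<lambda>x. v x * \<phi> x) \<and> norm (LINT x|lborel. v x * \<phi> x) \<le> K * B"
    using moderate_pairing[OF v] by blast
  obtain N C where C: "\<forall>\<phi>. schwartz \<phi> \<longrightarrow> (\<forall>x. (1 + norm x) ^ M * norm (L \<phi> x) \<le> C * schwartz_seminorm N \<phi>)"
    using b[of M] by blast
  have est: "integrable lborel (\<lambda>x. v x * L \<phi> x)" "norm (LINT x|lborel. v x * L \<phi> x) \<le> (K * C) * schwartz_seminorm N \<phi>"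
    if "schwartz \<phi>" for \<phi>
    using K[rule_format, of "L \<phi>" "C * schwartz_seminorm N \<phi>"] C that m by (auto simp: mult.assoc)
  show ?thesis
    unfolding tempered_def
  proof (intro conjI allI impI)
    fix \<phi> \<psi> :: "'b \<Rightarrow> complex" and a assume s: "schwartz \<phi> \<and> schwartz \<psi>"
    then show "(LINT x|lborel. v x * L (\<lambda>x. \<phi> x + a * \<psi> x) x) = (LINT x|lborel. v x * L \<phi> x) + a * (LINT x|lborel. v x * L \<psi> x)"
      using est(1)[of \<phi>] est(1)[of \<psi>] Bochner_Integration.integral_add[of lborel "\<lambda>x. v x * L \<phi> x" "\<lambda>x. a * (v x * L \<psi> x)"]
      by (simp add: L distrib_left mult.left_commute)
  qed (use est(2) in blast)
qed

lemma moderate_tempered: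
  assumes "moderate v" shows "tempered (distr_of v)"
  unfolding distr_of_def
proof (rule tempered_pairing[where L="\<lambda>\<phi>. \<phi>", OF assms])
  fix M
  show "\<exists>N C. \<forall>\<phi>. schwartz \<phi> \<longrightarrow> (\<forall>x. (1 + norm x) ^ M * norm (\<phi> x) \<le> C * schwartz_seminorm N \<phi>)"
    by (rule exI[of _ M], rule exI[of _ 1]) (simp add: schwartz_seminorm_bound)
qed (auto intro: schwartz_measurable)

text \<open>By \<open>a b \<le> a\<^sup>2 + b\<^sup>2\<close>: the weight \<open>(1 + (norm k)\<^sup>2) powr s\<close> is split evenly, its inverse grows at most like a
  power of \<open>1 + norm k\<close>, and the remaining decay is integrable.\<close>

lemma moderate_weighted_L2:
  fixes v :: "'a::euclidean_space \<Rightarrow> complex"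
  assumes [measurable]: "v \<in> borel_measurable borel"
    and fin: "(\<integral>\<^sup>+k. ennreal ((1 + (norm k)\<^sup>2) powr s * (norm (v k))\<^sup>2) \<partial>lborel) < \<infinity>"
  shows "moderate v"
proof -
  \<comment> \<open>\<open>n\<close> powers absorb the inverse weight, the other \<open>decay_order\<close> ones give integrability\<close>
  define n where "n = nat \<lceil>\<bar>s\<bar>\<rceil>"
  let ?d = "decay_order TYPE('a)"
  let ?M = "n + ?d"
  have n: "\<bar>s\<bar> \<le> real n" unfolding n_def by linarith
  have "integrable lborel (\<lambda>k. norm (v k) / (1 + norm k) ^ ?M)"
  proof (rule Bochner_Integration.integrable_bound)
    have "integrable lborel (\<lambda>k. (1 + (norm k)\<^sup>2) powr s * (norm (v k))\<^sup>2)"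
      by (rule integrableI_bounded) (use fin in auto)
    then show "integrable lborel (\<lambda>k. (1 + (norm k)\<^sup>2) powr s * (norm (v k))\<^sup>2 + 1 / (1 + norm k) ^ ?d)"
      by (intro Bochner_Integration.integrable_add integrable_decay)
    show "AE k in lborel. norm (norm (v k) / (1 + norm k) ^ ?M) \<le> norm ((1 + (norm k)\<^sup>2) powr s * (norm (v k))\<^sup>2 + 1 / (1 + norm k) ^ ?d)"
    proof (rule AE_I2)
      fix k :: 'a
      define p where "p = (1 + (norm k)\<^sup>2) powr (s / 2)"
      define y where "y = 1 + norm k"
      have y: "1 \<le> y" unfolding y_def by simp
      have nz [simp]: "1 + (norm k)\<^sup>2 \<noteq> 0"
        using add_pos_nonneg[OF zero_less_one zero_le_power2[of "norm k"]] by (rule less_imp_neq[THEN not_sym])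
      have p0: "p > 0" unfolding p_def by simp
      have p2: "p\<^sup>2 = (1 + (norm k)\<^sup>2) powr s"
        unfolding p_def power2_eq_square[of "_ powr _"] powr_add[symmetric] using nz by simp
      have "(1 + (norm k)\<^sup>2) powr (- s) \<le> (1 + (norm k)\<^sup>2) powr (real n)"
        using n by (intro powr_mono) auto
      also have "\<dots> = (1 + (norm k)\<^sup>2) ^ n" by (simp add: powr_realpow add_pos_nonneg)
      also have "\<dots> \<le> (y\<^sup>2) ^ n" unfolding y_def by (intro power_mono) (auto simp: power2_sum)
      finally have q: "inverse (p\<^sup>2) \<le> y ^ (2 * n)" unfolding p2 by (simp add: powr_minus power_mult)
      define a where "a = p * norm (v k)"
      define b where "b = inverse p / y ^ ?M"
      have "norm (v k) / y ^ ?M = a * b" unfolding a_def b_def using p0 by simp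
      also have "\<dots> \<le> a\<^sup>2 + b\<^sup>2"
      proof -
        have "2 * a * b \<le> a\<^sup>2 + b\<^sup>2" by (rule sum_squares_bound)
        moreover have "0 \<le> a * b" unfolding a_def b_def using p0 y by simp
        ultimately show ?thesis by linarith
      qed
      also have "b\<^sup>2 \<le> 1 / y ^ ?d"
      proof -
        have "b\<^sup>2 = inverse (p\<^sup>2) / y ^ (2 * ?M)" unfolding b_def by (simp add: power_divide power_inverse power_mult[symmetric] mult.commute)
        also have "\<dots> \<le> y ^ (2 * n) / y ^ (2 * ?M)" using q y by (intro divide_right_mono) auto
        also have "\<dots> = 1 / y ^ (2 * ?d)" using y by (simp add: distrib_left power_add)
        also have "\<dots> \<le> 1 / y ^ ?d" using y by (intro divide_left_mono power_increasing) auto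
        finally show ?thesis .
      qed
      also have "a\<^sup>2 = (1 + (norm k)\<^sup>2) powr s * (norm (v k))\<^sup>2" unfolding a_def power_mult_distrib p2 ..
      finally show "norm (norm (v k) / (1 + norm k) ^ ?M) \<le> norm ((1 + (norm k)\<^sup>2) powr s * (norm (v k))\<^sup>2 + 1 / (1 + norm k) ^ ?d)"
        unfolding y_def by simp
    qed
  qed measurable
  then show ?thesis unfolding moderate_def by auto
qed

section \<open>The evolution in time\<close>

lemma cis_measurable [measurable]: "cis \<in> borel_measurable borel"
  by (intro borel_measurable_continuous_onI continuous_intros)

text \<open>Second order remainders are bounded by \<open>h\<^sup>2\<close> times the fourth moment of the integrand, which is
  finite because \<open>\<Phi>\<close> is a Schwartz function.\<close>

lemma oscillatory_has_vector_derivative: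
  assumes v: "moderate v" and \<Phi>: "schwartz \<Phi>"
  shows "((\<lambda>t. LINT k|lborel. v k * (cis (- ((norm k)\<^sup>2 * t)) * \<Phi> k)) has_vector_derivative
     (LINT k|lborel. v k * (cis (- ((norm k)\<^sup>2 * t)) * (- \<i> * of_real ((norm k)\<^sup>2) * \<Phi> k)))) (at t)"
    (is "(?I has_vector_derivative ?D) _")
proof -
  have [measurable]: "v \<in> borel_measurable borel" using v unfolding moderate_def by blast
  have S1: "schwartz (\<lambda>k. - \<i> * of_real ((norm k)\<^sup>2) * \<Phi> k)"
    by (intro multiplier_times_schwartz multiplier_mult multiplier_norm2 multiplier_const \<Phi>)
  have S2: "schwartz (\<lambda>k. of_real ((norm k)\<^sup>2) * (of_real ((norm k)\<^sup>2) * \<Phi> k))"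
    by (intro multiplier_times_schwartz multiplier_mult multiplier_norm2 \<Phi>)
  have osc: "integrable lborel (\<lambda>k. v k * (cis (- ((norm k)\<^sup>2 * t)) * \<Psi> k))" if "schwartz \<Psi>" for \<Psi> t
  proof -
    have "integrable lborel (\<lambda>k. cis (- ((norm k)\<^sup>2 * t)) * (v k * \<Psi> k))"
      by (intro integrable_cis_mult moderate_times_schwartz v that) auto
    then show ?thesis by (simp add: mult.left_commute)
  qed
  let ?w = "\<lambda>k. norm (v k * (of_real ((norm k)\<^sup>2) * (of_real ((norm k)\<^sup>2) * \<Phi> k)))"
  have wi: "integrable lborel ?w" by (intro integrable_norm moderate_times_schwartz v S2)
  define K where "K = (LINT k|lborel. ?w k)"
  have key: "norm (?I (t + h) - ?I t - h *\<^sub>R ?D) \<le> K * h\<^sup>2" for h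
  proof -
    let ?f = "\<lambda>k. v k * (cis (- ((norm k)\<^sup>2 * (t + h))) * \<Phi> k) - v k * (cis (- ((norm k)\<^sup>2 * t)) * \<Phi> k)
      - h *\<^sub>R (v k * (cis (- ((norm k)\<^sup>2 * t)) * (- \<i> * of_real ((norm k)\<^sup>2) * \<Phi> k)))"
    have i3: "integrable lborel (\<lambda>k. h *\<^sub>R (v k * (cis (- ((norm k)\<^sup>2 * t)) * (- \<i> * of_real ((norm k)\<^sup>2) * \<Phi> k))))"
      by (intro integrable_scaleR_right osc S1)
    have i12: "integrable lborel (\<lambda>k. v k * (cis (- ((norm k)\<^sup>2 * (t + h))) * \<Phi> k) - v k * (cis (- ((norm k)\<^sup>2 * t)) * \<Phi> k))"
      by (intro Bochner_Integration.integrable_diff osc \<Phi>)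
    have "?I (t + h) - ?I t - h *\<^sub>R ?D = (LINT k|lborel. ?f k)"
      using Bochner_Integration.integral_diff[OF i12 i3] Bochner_Integration.integral_diff[OF osc[OF \<Phi>, of "t + h"] osc[OF \<Phi>, of t]]
      by (simp only: integral_scaleR_right)
    then have "norm (?I (t + h) - ?I t - h *\<^sub>R ?D) \<le> (LINT k|lborel. norm (?f k))"
      using integral_norm_bound[of lborel ?f] by (simp only:)
    also have "\<dots> \<le> (LINT k|lborel. ?w k * h\<^sup>2)"
    proof (rule integral_mono[OF integrable_norm[OF Bochner_Integration.integrable_diff[OF i12 i3]]])
      show "integrable lborel (\<lambda>k. ?w k * h\<^sup>2)" by (rule integrable_mult_left[OF wi])
      fix k :: 'a
      let ?x = "(norm k)\<^sup>2"
      have "?f k = (cis (- (?x * t) + - (?x * h)) - cis (- (?x * t)) - \<i> * of_real (- (?x * h)) * cis (- (?x * t))) * (v k * \<Phi> k)"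
        by (simp add: scaleR_conv_of_real algebra_simps)
      then have "norm (?f k) = norm (cis (- (?x * t) + - (?x * h)) - cis (- (?x * t)) - \<i> * of_real (- (?x * h)) * cis (- (?x * t))) * norm (v k * \<Phi> k)"
        by (simp only: norm_mult)
      also have "\<dots> \<le> (- (?x * h))\<^sup>2 * norm (v k * \<Phi> k)"
        by (intro mult_right_mono cis_quadratic_bound norm_ge_zero)
      also have "\<dots> = ?w k * h\<^sup>2"
        by (simp add: norm_mult power_mult_distrib power2_eq_square)
      finally show "norm (?f k) \<le> ?w k * h\<^sup>2" .
    qed
    also have "\<dots> = K * h\<^sup>2" unfolding K_def by (simp only: integral_mult_left_zero)
    finally show ?thesis .
  qed
  show ?thesis
    unfolding has_vector_derivative_def
  proof (rule has_derivativeI)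
    show "bounded_linear (\<lambda>h. h *\<^sub>R ?D)" by (rule bounded_linear_scaleR_left)
    show "((\<lambda>s. ((?I s - ?I t) - (s - t) *\<^sub>R ?D) /\<^sub>R norm (s - t)) \<longlongrightarrow> 0) (at t)"
    proof (rule Lim_null_comparison)
      show "\<forall>\<^sub>F s in at t. norm (((?I s - ?I t) - (s - t) *\<^sub>R ?D) /\<^sub>R norm (s - t)) \<le> K * norm (s - t)"
      proof (intro eventuallyI)
        fix s
        define A where "A = norm ((?I s - ?I t) - (s - t) *\<^sub>R ?D)"
        have "A \<le> K * \<bar>s - t\<bar>\<^sup>2"
          using key[of "s - t"] by (simp add: A_def)
        then have "inverse \<bar>s - t\<bar> * A \<le> inverse \<bar>s - t\<bar> * (K * \<bar>s - t\<bar>\<^sup>2)" by (intro mult_left_mono) auto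
        also have "\<dots> = K * \<bar>s - t\<bar>" by (cases "s = t") (auto simp: power2_eq_square field_simps)
        finally show "norm (((?I s - ?I t) - (s - t) *\<^sub>R ?D) /\<^sub>R norm (s - t)) \<le> K * norm (s - t)"
          unfolding norm_scaleR A_def[symmetric] by simp
      qed
      show "((\<lambda>s. K * norm (s - t)) \<longlongrightarrow> 0) (at t)"
        by (auto intro!: tendsto_eq_intros)
    qed
  qed
qed

text \<open>Integrating the kernel against the test function gives its Fourier transform at \<open>- k\<close>.\<close>

lemma solution_at_time_eq:
  "solution_at_time U0 t \<phi> = (LINT k|lborel. fourier_fun U0 k *
     (cis (- ((norm k)\<^sup>2 * t)) * (inverse (of_real ((2 * pi) ^ 2)) * fourier \<phi> (- k))))"
proof -
  have "(LINT (x1, x2)|lborel. schroedinger_kernel k x1 x2 t * \<phi> (x1, x2)) = cis (- ((norm k)\<^sup>2 * t)) * fourier \<phi> (- k)" for k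
  proof -
    obtain k1 k2 where k: "k = (k1, k2)" by force
    have "schroedinger_kernel k x1 x2 t = cis (- ((norm k)\<^sup>2 * t)) * cis (k \<bullet> (x1, x2))" for x1 x2
      unfolding schroedinger_kernel_def k by (simp add: cis_mult norm_Pair algebra_simps)
    then show ?thesis unfolding fourier_def by (simp add: mult.assoc case_prod_unfold)
  qed
  then show ?thesis unfolding solution_at_time_def
    by (simp add: field_simps flip: integral_mult_right_zero)
qed

lemma solution_at_time_fourier:
  assumes "schwartz \<phi>"
  shows "solution_at_time U0 t (fourier \<phi>) = (LINT k|lborel. (cis (- ((norm k)\<^sup>2 * t)) * fourier_fun U0 k) * \<phi> k)"
proof -
  have "inverse (of_real ((2 * pi) ^ 2)) * fourier (fourier \<phi>) (- k) = \<phi> k" for k :: "real \<times> real"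
    unfolding fourier_fourier[OF assms]
    by (simp only: mult.assoc[symmetric] DIM_prod DIM_real one_add_one left_inverse[OF two_pi_pow_nz] mult_1 minus_minus)
  then show ?thesis unfolding solution_at_time_eq by (simp add: mult.left_commute mult.assoc)
qed

lemma schwartz_fourier_reflect:
  "schwartz \<phi> \<Longrightarrow> schwartz (\<lambda>k. inverse (of_real ((2 * pi) ^ 2)) * fourier \<phi> (- k))"
  by (intro schwartz_cmult schwartz_reflect schwartz_fourier)

lemma fourier_linear:
  assumes "schwartz \<phi>" "schwartz \<psi>"
  shows "fourier (\<lambda>x. \<phi> x + a * \<psi> x) k = fourier \<phi> k + a * fourier \<psi> k"
proof -
  have "integrable lborel (\<lambda>x. cis (- (k \<bullet> x)) * \<phi> x)" "integrable lborel (\<lambda>x. a * (cis (- (k \<bullet> x)) * \<psi> x))"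
    by (intro integrable_cis_mult integrable_mult_right schwartz_integrable assms; simp)+
  from Bochner_Integration.integral_add[OF this] show ?thesis
    unfolding fourier_def by (simp add: distrib_left mult.left_commute)
qed

lemma solution_at_time_tempered:
  assumes "moderate (fourier_fun U0)"
  shows "tempered (solution_at_time U0 t)"
proof -
  have "tempered (\<lambda>\<phi>. LINT k|lborel. fourier_fun U0 k * (cis (- ((norm k)\<^sup>2 * t)) * (inverse (of_real ((2 * pi) ^ 2)) * fourier \<phi> (- k))))"
  proof (rule tempered_pairing[OF assms])
    fix \<phi> :: "real \<times> real \<Rightarrow> complex" assume \<phi>: "schwartz \<phi>"
    have [measurable]: "(\<lambda>k. inverse (of_real ((2 * pi) ^ 2)) * fourier \<phi> (- k)) \<in> borel_measurable borel"
      by (rule schwartz_measurable[OF schwartz_fourier_reflect[OF \<phi>]])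
    show "(\<lambda>k. cis (- ((norm k)\<^sup>2 * t)) * (inverse (of_real ((2 * pi) ^ 2)) * fourier \<phi> (- k))) \<in> borel_measurable borel"
      by measurable
  next
    fix M
    obtain C where C: "\<And>f k. schwartz f \<Longrightarrow>
     (1 + norm (k::real \<times> real)) ^ M * norm (fourier f k) \<le> C * schwartz_seminorm (decay_order TYPE(real \<times> real) + M) f"
      using fourier_decay[where 'a="real \<times> real"] by metis
    let ?c = "inverse ((2 * pi) ^ 2)"
    have "(1 + norm k) ^ M * norm (cis (- ((norm k)\<^sup>2 * t)) * (inverse (of_real ((2 * pi) ^ 2)) * fourier \<phi> (- k)))
       \<le> (?c * C) * schwartz_seminorm (decay_order TYPE(real \<times> real) + M) \<phi>" if "schwartz \<phi>" for \<phi> and k :: "real \<times> real"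
    proof -
      have "norm (inverse (complex_of_real ((2 * pi) ^ 2))) = ?c"
        by (simp add: norm_inverse norm_power norm_mult)
      then have "(1 + norm k) ^ M * norm (cis (- ((norm k)\<^sup>2 * t)) * (inverse (of_real ((2 * pi) ^ 2)) * fourier \<phi> (- k)))
        = ?c * ((1 + norm (- k)) ^ M * norm (fourier \<phi> (- k)))"
        unfolding norm_mult by (simp only: norm_cis norm_minus_cancel mult_1 mult.left_commute)
      also have "\<dots> \<le> ?c * (C * schwartz_seminorm (decay_order TYPE(real \<times> real) + M) \<phi>)"
        by (intro mult_left_mono C that) simp
      finally show ?thesis by (simp only: mult.assoc)
    qed
    then show "\<exists>N C. \<forall>\<phi>. schwartz \<phi> \<longrightarrow> (\<forall>k::real \<times> real. (1 + norm k) ^ M * norm (cis (- ((norm k)\<^sup>2 * t)) * (inverse (of_real ((2 * pi) ^ 2)) * fourier \<phi> (- k))) \<le> C * schwartz_seminorm N \<phi>)"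
      by blast
  qed (simp add: fourier_linear distrib_left mult.left_commute)
  then show ?thesis unfolding solution_at_time_eq[abs_def] .
qed

lemma has_fourier_solution_at_time:
  assumes v: "moderate (fourier_fun U0)"
  shows "has_fourier (solution_at_time U0 t) (\<lambda>k. cis (- ((norm k)\<^sup>2 * t)) * fourier_fun U0 k)"
  unfolding has_fourier_def
proof (intro conjI allI impI)
  have [measurable]: "fourier_fun U0 \<in> borel_measurable borel" using v unfolding moderate_def by blast
  show "(\<lambda>k. cis (- ((norm k)\<^sup>2 * t)) * fourier_fun U0 k) \<in> borel_measurable lborel" by measurable
  fix \<phi> :: "real \<times> real \<Rightarrow> complex" assume \<phi>: "schwartz \<phi>"
  have "integrable lborel (\<lambda>k. cis (- ((norm k)\<^sup>2 * t)) * (fourier_fun U0 k * \<phi> k))"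
    by (intro integrable_cis_mult moderate_times_schwartz v \<phi>) auto
  then show "integrable lborel (\<lambda>k. cis (- ((norm k)\<^sup>2 * t)) * fourier_fun U0 k * \<phi> k)" by (simp add: mult.assoc)
qed (rule solution_at_time_fourier)

text \<open>With \<open>\<i> D\<close> the time derivative contributes the factor \<open>(norm k)\<^sup>2\<close>, and the two second derivatives of the test
  function contribute minus the squares of the coordinates of \<open>k\<close>.\<close>

lemma solution_at_time_solves:
  assumes v: "moderate (fourier_fun U0)" and hf: "has_fourier U0 (fourier_fun U0)"
  shows "solves_schroedinger_ivp T U0 (solution_at_time U0)"
  unfolding solves_schroedinger_ivp_def
proof (intro conjI ballI allI impI)
  fix t show "tempered (solution_at_time U0 t)" by (rule solution_at_time_tempered[OF v])
next
  fix \<phi> :: "real \<times> real \<Rightarrow> complex" assume \<phi>: "schwartz \<phi>"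
  let ?\<Phi> = "\<lambda>k. inverse (of_real ((2 * pi) ^ 2)) * fourier \<phi> (- k)"
  have \<Phi>: "schwartz ?\<Phi>" by (rule schwartz_fourier_reflect[OF \<phi>])
  have "fourier ?\<Phi> = \<phi>" using schwartz_is_fourier[OF \<phi>] by (intro ext) (simp only: DIM_prod DIM_real one_add_one)
  moreover have "U0 (fourier ?\<Phi>) = (LINT k|lborel. fourier_fun U0 k * ?\<Phi> k)"
    using hf \<Phi> unfolding has_fourier_def by blast
  ultimately show "solution_at_time U0 0 \<phi> = U0 \<phi>" unfolding solution_at_time_eq by simp
  note D = oscillatory_has_vector_derivative[OF v \<Phi>, folded solution_at_time_eq]
  show "continuous_on {0..T} (\<lambda>t. solution_at_time U0 t \<phi>)"
    using D has_vector_derivative_continuous by (intro continuous_at_imp_continuous_on ballI) blast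
  fix t
  let ?D = "LINT k|lborel. fourier_fun U0 k * (cis (- ((norm k)\<^sup>2 * t)) * (- \<i> * of_real ((norm k)\<^sup>2) * ?\<Phi> k))"
  have osc: "integrable lborel (\<lambda>k. fourier_fun U0 k * (cis (- ((norm k)\<^sup>2 * t)) * \<Psi> k))" if "schwartz \<Psi>" for \<Psi>
  proof -
    have "integrable lborel (\<lambda>k. cis (- ((norm k)\<^sup>2 * t)) * (fourier_fun U0 k * \<Psi> k))"
      by (intro integrable_cis_mult moderate_times_schwartz v that) (use v in \<open>auto simp: moderate_def\<close>)
    then show ?thesis by (simp add: mult.left_commute)
  qed
  have S1: "schwartz (\<lambda>k. - \<i> * of_real ((norm k)\<^sup>2) * ?\<Phi> k)"
    by (intro multiplier_times_schwartz multiplier_mult multiplier_norm2 multiplier_const \<Phi>)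
  have B: "(1, 0) \<in> (Basis :: (real \<times> real) set)" "(0, 1) \<in> (Basis :: (real \<times> real) set)"
    by (auto simp: Basis_prod_def)
  have dd: "fourier (iter_deriv [b, b] \<phi>) (- k) = - of_real ((k \<bullet> b)\<^sup>2) * fourier \<phi> (- k)" if b: "b \<in> Basis" for b k
    by (simp add: fourier_of_dderiv schwartz_dderiv \<phi> b power2_eq_square algebra_simps)
  have S2: "schwartz (\<lambda>k. - of_real ((k \<bullet> b)\<^sup>2) * ?\<Phi> k)" for b :: "real \<times> real"
    using multiplier_times_schwartz[OF multiplier_mult[OF multiplier_const[of "-1"] multiplier_mult[OF multiplier_inner[of b] multiplier_inner[of b]]] \<Phi>]
    by (simp add: power2_eq_square)
  have U2: "solution_at_time U0 t (iter_deriv [b, b] \<phi>) = (LINT k|lborel. fourier_fun U0 k * (cis (- ((norm k)\<^sup>2 * t)) * (- of_real ((k \<bullet> b)\<^sup>2) * ?\<Phi> k)))"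
    if "b \<in> Basis" for b
    unfolding solution_at_time_eq dd[OF that] by (simp only: mult.left_commute)
  have "\<i> * ?D + solution_at_time U0 t (iter_deriv [(1, 0), (1, 0)] \<phi>) + solution_at_time U0 t (iter_deriv [(0, 1), (0, 1)] \<phi>)
    = (LINT k|lborel. \<i> * (fourier_fun U0 k * (cis (- ((norm k)\<^sup>2 * t)) * (- \<i> * of_real ((norm k)\<^sup>2) * ?\<Phi> k)))
        + fourier_fun U0 k * (cis (- ((norm k)\<^sup>2 * t)) * (- of_real ((k \<bullet> (1,0))\<^sup>2) * ?\<Phi> k))
        + fourier_fun U0 k * (cis (- ((norm k)\<^sup>2 * t)) * (- of_real ((k \<bullet> (0,1))\<^sup>2) * ?\<Phi> k)))"
    unfolding U2[OF B(1)] U2[OF B(2)]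
    unfolding Bochner_Integration.integral_add[OF Bochner_Integration.integrable_add[OF integrable_mult_right[OF osc[OF S1]] osc[OF S2]] osc[OF S2]]
      Bochner_Integration.integral_add[OF integrable_mult_right[OF osc[OF S1]] osc[OF S2]]
    by (simp only: integral_mult_right_zero)
  also have "\<dots> = (LINT k::real \<times> real|lborel. 0)"
  proof (intro Bochner_Integration.integral_cong refl)
    fix k :: "real \<times> real"
    have n: "(norm k)\<^sup>2 = (k \<bullet> (1,0))\<^sup>2 + (k \<bullet> (0,1))\<^sup>2"
      by (cases k) (simp add: norm_Pair)
    have "\<i> * (u * (e * (- \<i> * of_real (x + y) * F))) + u * (e * (- of_real x * F)) + u * (e * (- of_real y * F)) = (0::complex)"
      for u e F and x y :: real
      by (simp add: algebra_simps)
    then show "\<i> * (fourier_fun U0 k * (cis (- ((norm k)\<^sup>2 * t)) * (- \<i> * of_real ((norm k)\<^sup>2) * ?\<Phi> k)))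
        + fourier_fun U0 k * (cis (- ((norm k)\<^sup>2 * t)) * (- of_real ((k \<bullet> (1,0))\<^sup>2) * ?\<Phi> k))
        + fourier_fun U0 k * (cis (- ((norm k)\<^sup>2 * t)) * (- of_real ((k \<bullet> (0,1))\<^sup>2) * ?\<Phi> k)) = 0"
      unfolding n by blast
  qed
  finally show "\<exists>D. ((\<lambda>\<tau>. solution_at_time U0 \<tau> \<phi>) has_vector_derivative D) (at t) \<and>
       \<i> * D + solution_at_time U0 t (iter_deriv [(1, 0), (1, 0)] \<phi>) + solution_at_time U0 t (iter_deriv [(0, 1), (0, 1)] \<phi>) = 0"
    using D[of t] by (intro exI[of _ ?D]) simp
qed

lemma sobolev_space_D:
  assumes "U0 \<in> sobolev_space s"
  shows "has_fourier U0 (fourier_fun U0)" "moderate (fourier_fun U0)"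
    "sobolev_norm s U0 = ennreal_sqrt (\<integral>\<^sup>+k. ennreal ((1 + (norm k)\<^sup>2) powr s * (norm (fourier_fun U0 k))\<^sup>2) \<partial>lborel)"
    "(\<integral>\<^sup>+k. ennreal ((1 + (norm k)\<^sup>2) powr s * (norm (fourier_fun U0 k))\<^sup>2) \<partial>lborel) < \<infinity>"
proof -
  have U: "tempered U0" "\<exists>v. has_fourier U0 v" and fin: "sobolev_norm s U0 < \<infinity>"
    using assms unfolding sobolev_space_def sobolev_norm_def by (auto split: if_splits)
  then show hf: "has_fourier U0 (fourier_fun U0)" using has_fourier_fourier_fun by blast
  show n: "sobolev_norm s U0 = ennreal_sqrt (\<integral>\<^sup>+k. ennreal ((1 + (norm k)\<^sup>2) powr s * (norm (fourier_fun U0 k))\<^sup>2) \<partial>lborel)"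
    by (rule sobolev_norm_eq[OF U(1) hf])
  show l: "(\<integral>\<^sup>+k. ennreal ((1 + (norm k)\<^sup>2) powr s * (norm (fourier_fun U0 k))\<^sup>2) \<partial>lborel) < \<infinity>"
    using fin unfolding n ennreal_sqrt_def by (auto split: if_splits simp: less_top)
  show "moderate (fourier_fun U0)"
    by (rule moderate_weighted_L2[OF _ l]) (use hf in \<open>auto simp: has_fourier_def\<close>)
qed

theorem initial_value_problem:
  assumes "U0 \<in> sobolev_space s" "0 < T"
  shows "solves_schroedinger_ivp T U0 (solution_at_time U0)"
    and "(SUP t\<in>{0..T}. sobolev_norm s (solution_at_time U0 t)) = sobolev_norm s U0"
proof -
  note U = sobolev_space_D[OF assms(1)]
  show "solves_schroedinger_ivp T U0 (solution_at_time U0)"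
    by (rule solution_at_time_solves[OF U(2,1)])
  have "sobolev_norm s (solution_at_time U0 t) = sobolev_norm s U0" for t
    unfolding U(3) sobolev_norm_eq[OF solution_at_time_tempered[OF U(2)] has_fourier_solution_at_time[OF U(2)]]
    by (simp add: norm_mult)
  then show "(SUP t\<in>{0..T}. sobolev_norm s (solution_at_time U0 t)) = sobolev_norm s U0"
    using assms(2) by (simp add: SUP_constant)
qed

section \<open>Integral inequalities and limits in mean square\<close>

abbreviation energy :: "('a::euclidean_space \<Rightarrow> complex) \<Rightarrow> ennreal" where
  "energy f \<equiv> (\<integral>\<^sup>+x. ennreal ((norm (f x))\<^sup>2) \<partial>lborel)"

text \<open>The integrand is the derivative of \<open>arctan (\<tau> + k\<^sup>2)\<close>: this is the change of variables from \<open>k\<close> to its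
  square, and the reason why the bound is uniform in \<open>\<tau>\<close>.\<close>

lemma kernel_half_line: "(\<integral>\<^sup>+k. ennreal (2 * k / (1 + (\<tau> + k\<^sup>2)\<^sup>2)) * indicator {0..} k \<partial>lborel) \<le> ennreal pi"
proof -
  have lim: "((\<lambda>k. arctan (\<tau> + k\<^sup>2)) \<longlongrightarrow> pi / 2) at_top"
  proof (rule filterlim_compose[OF tendsto_arctan_at_top])
    show "filterlim (\<lambda>k::real. \<tau> + k\<^sup>2) at_top at_top"
      by (intro filterlim_tendsto_add_at_top[OF tendsto_const] filterlim_pow_at_top) (auto simp: filterlim_ident)
  qed
  have "(\<integral>\<^sup>+k. ennreal (2 * k / (1 + (\<tau> + k\<^sup>2)\<^sup>2)) * indicator {0..} k \<partial>lborel) = ennreal (pi / 2 - arctan (\<tau> + 0\<^sup>2))"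
  proof (rule nn_integral_FTC_atLeast[OF _ _ _ lim])
    show "((\<lambda>k. arctan (\<tau> + k\<^sup>2)) has_real_derivative 2 * k / (1 + (\<tau> + k\<^sup>2)\<^sup>2)) (at k)" for k
      by (auto intro!: derivative_eq_intros simp: field_simps)
  qed auto
  also have "\<dots> \<le> ennreal pi"
    using arctan_lbound[of \<tau>] by (intro ennreal_leI) simp
  finally show ?thesis .
qed

definition kernel_mass :: real where "kernel_mass = 4 + 2 * pi"

lemma kernel_mass_pos: "kernel_mass > 0"
  unfolding kernel_mass_def using pi_gt_zero by linarith

text \<open>For \<open>|k| \<ge> 1\<close> the factor \<open>1 + |k|\<close> is at most the Jacobian \<open>2 |k|\<close>; the interval \<open>{-1..1}\<close>, where the
  Jacobian degenerates, contributes at most 4.\<close>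

lemma kernel_integral_bound:
  "(\<integral>\<^sup>+k. ennreal ((1 + \<bar>k\<bar>) / (1 + (\<tau> + k\<^sup>2)\<^sup>2)) \<partial>lborel) \<le> ennreal kernel_mass"
proof -
  let ?q = "\<lambda>k. ennreal (2 * k / (1 + (\<tau> + k\<^sup>2)\<^sup>2)) * indicator {0..} k"
  have pt: "ennreal ((1 + \<bar>k\<bar>) / (1 + (\<tau> + k\<^sup>2)\<^sup>2)) \<le> 2 * indicator {-1..1} k + (?q k + ?q (- k))" for k
  proof -
    define D where "D = 1 + (\<tau> + k\<^sup>2)\<^sup>2"
    have D: "D \<ge> 1" unfolding D_def by simp
    show ?thesis unfolding power2_minus D_def[symmetric]
    proof (cases "\<bar>k\<bar> \<le> 1")
      case True
      have "(1 + \<bar>k\<bar>) / D \<le> 2" using True D by (simp add: divide_le_eq)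
      then have "ennreal ((1 + \<bar>k\<bar>) / D) \<le> 2 * indicator {-1..1} k"
        using True ennreal_leI[of _ 2] by (auto simp: indicator_def)
      then show "ennreal ((1 + \<bar>k\<bar>) / D) \<le> 2 * indicator {-1..1} k + (ennreal (2 * k / D) * indicator {0..} k + ennreal (2 * - k / D) * indicator {0..} (- k))"
        by (rule order_trans) simp
    next
      case False
      have "(1 + \<bar>k\<bar>) / D \<le> 2 * \<bar>k\<bar> / D" using False D by (intro divide_right_mono) auto
      then have "ennreal ((1 + \<bar>k\<bar>) / D) \<le> ennreal (2 * \<bar>k\<bar> / D)" by (rule ennreal_leI)
      also have "\<dots> = ennreal (2 * k / D) * indicator {0..} k + ennreal (2 * - k / D) * indicator {0..} (- k)"
        using False by (auto simp: indicator_def abs_if)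
      finally show "ennreal ((1 + \<bar>k\<bar>) / D) \<le> 2 * indicator {-1..1} k + (ennreal (2 * k / D) * indicator {0..} k + ennreal (2 * - k / D) * indicator {0..} (- k))"
        by (rule order_trans) simp
    qed
  qed
  have [measurable]: "?q \<in> borel_measurable borel" by measurable
  have "(\<integral>\<^sup>+k. ennreal ((1 + \<bar>k\<bar>) / (1 + (\<tau> + k\<^sup>2)\<^sup>2)) \<partial>lborel)
      \<le> (\<integral>\<^sup>+k. 2 * indicator {-1..1} k + (?q k + ?q (- k)) \<partial>lborel)"
    by (intro nn_integral_mono pt)
  also have "\<dots> = (\<integral>\<^sup>+k. 2 * indicator {-1..1} k \<partial>(lborel :: real measure)) + ((\<integral>\<^sup>+k. ?q k \<partial>lborel) + (\<integral>\<^sup>+k. ?q (- k) \<partial>lborel))"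
    by (simp add: nn_integral_add)
  also have "(\<integral>\<^sup>+k. ?q (- k) \<partial>lborel) = (\<integral>\<^sup>+k. ?q k \<partial>lborel)"
    using nn_integral_real_affine[of ?q "-1" 0] by simp
  also have "(\<integral>\<^sup>+k. 2 * indicator {-1..1} k \<partial>(lborel :: real measure)) = ennreal 4"
    by (simp add: nn_integral_cmult_indicator)
  also have "ennreal 4 + ((\<integral>\<^sup>+k. ?q k \<partial>lborel) + (\<integral>\<^sup>+k. ?q k \<partial>lborel)) \<le> ennreal 4 + (ennreal pi + ennreal pi)"
    by (intro add_mono order_refl kernel_half_line)
  also have "\<dots> = ennreal kernel_mass"
  proof -
    have "kernel_mass = 4 + (pi + pi)" unfolding kernel_mass_def by simp
    then show ?thesis by (simp only: ennreal_plus[symmetric] pi_ge_zero add_nonneg_nonneg zero_le_numeral)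
  qed
  finally show ?thesis .
qed

lemma unweighted_kernel_integral_bound:
  "(\<integral>\<^sup>+k. ennreal (1 / (1 + (\<tau> + k\<^sup>2)\<^sup>2)) \<partial>lborel) \<le> ennreal kernel_mass"
  by (rule order_trans[OF nn_integral_mono kernel_integral_bound[of \<tau>]])
    (auto intro!: ennreal_leI divide_right_mono simp: add_nonneg_nonneg)

lemma cauchy_kernel_integral: "(\<integral>\<^sup>+\<tau>. ennreal (1 / (1 + (\<tau> + a)\<^sup>2)) \<partial>lborel) \<le> ennreal (2 * pi)"
proof -
  let ?q = "\<lambda>x::real. ennreal (1 / (1 + x\<^sup>2))"
  have half: "(\<integral>\<^sup>+x. ?q x * indicator {0..} x \<partial>lborel) \<le> ennreal pi"
  proof -
    have "(\<integral>\<^sup>+x. ?q x * indicator {0..} x \<partial>lborel) = ennreal (pi / 2 - arctan 0)"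
      by (rule nn_integral_FTC_atLeast[OF _ _ _ tendsto_arctan_at_top])
        (auto intro!: derivative_eq_intros simp: field_simps)
    also have "\<dots> \<le> ennreal pi" by (intro ennreal_leI) simp
    finally show ?thesis .
  qed
  have "(\<integral>\<^sup>+\<tau>. ennreal (1 / (1 + (\<tau> + a)\<^sup>2)) \<partial>lborel) = (\<integral>\<^sup>+x. ?q x \<partial>lborel)"
    using nn_integral_real_affine[of ?q 1 a] by (simp add: add.commute)
  also have "\<dots> \<le> (\<integral>\<^sup>+x. ?q x * indicator {0..} x + ?q (- x) * indicator {0..} (- x) \<partial>lborel)"
    by (intro nn_integral_mono) (auto simp: indicator_def)
  also have "\<dots> = (\<integral>\<^sup>+x. ?q x * indicator {0..} x \<partial>lborel) + (\<integral>\<^sup>+x. ?q (- x) * indicator {0..} (- x) \<partial>lborel)"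
    by (intro nn_integral_add) auto
  also have "(\<integral>\<^sup>+x. ?q (- x) * indicator {0..} (- x) \<partial>lborel) = (\<integral>\<^sup>+x. ?q x * indicator {0..} x \<partial>lborel)"
    using nn_integral_real_affine[of "\<lambda>x. ?q x * indicator {0..} x" "-1" 0] by simp
  also have "(\<integral>\<^sup>+x. ?q x * indicator {0..} x \<partial>lborel) + (\<integral>\<^sup>+x. ?q x * indicator {0..} x \<partial>lborel) \<le> ennreal pi + ennreal pi"
    by (intro add_mono half)
  also have "\<dots> = ennreal (2 * pi)" by (simp flip: ennreal_plus)
  finally show ?thesis .
qed

text \<open>Young's inequality with a free parameter \<open>l\<close>, which is then optimized.\<close>

lemma nn_integral_cauchy_schwarz:
  fixes f g :: "'a \<Rightarrow> real"
  assumes [measurable]: "f \<in> borel_measurable M" "g \<in> borel_measurable M"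
    and f0: "\<And>x. 0 \<le> f x" and g0: "\<And>x. 0 \<le> g x"
    and A: "(\<integral>\<^sup>+x. ennreal ((f x)\<^sup>2) \<partial>M) \<le> ennreal A" and "A > 0"
  shows "(\<integral>\<^sup>+x. ennreal (f x * g x) \<partial>M)\<^sup>2 \<le> ennreal A * (\<integral>\<^sup>+x. ennreal ((g x)\<^sup>2) \<partial>M)"
proof (cases "(\<integral>\<^sup>+x. ennreal ((g x)\<^sup>2) \<partial>M) = \<infinity>")
  case True
  then show ?thesis using \<open>A > 0\<close> by (simp add: ennreal_mult_top)
next
  case False
  then obtain B where B0: "0 \<le> B" and B: "(\<integral>\<^sup>+x. ennreal ((g x)\<^sup>2) \<partial>M) = ennreal B"
    by (metis ennreal_cases infinity_ennreal_def)
  have key: "(\<integral>\<^sup>+x. ennreal (f x * g x) \<partial>M) \<le> ennreal ((l * A + B / l) / 2)" if l: "l > 0" for l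
  proof -
    have "ennreal (f x * g x) \<le> ennreal (l / 2) * ennreal ((f x)\<^sup>2) + ennreal (1 / (2 * l)) * ennreal ((g x)\<^sup>2)" for x
    proof -
      have "0 \<le> (l * f x - g x)\<^sup>2 / (2 * l)" using l by simp
      also have "\<dots> = l / 2 * (f x)\<^sup>2 + 1 / (2 * l) * (g x)\<^sup>2 - f x * g x"
        using l by (simp add: power2_diff power_mult_distrib field_simps power2_eq_square)
      finally have "f x * g x \<le> l / 2 * (f x)\<^sup>2 + 1 / (2 * l) * (g x)\<^sup>2" by simp
      then have "ennreal (f x * g x) \<le> ennreal (l / 2 * (f x)\<^sup>2 + 1 / (2 * l) * (g x)\<^sup>2)" by (rule ennreal_leI)
      also have "\<dots> = ennreal (l / 2) * ennreal ((f x)\<^sup>2) + ennreal (1 / (2 * l)) * ennreal ((g x)\<^sup>2)"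
      proof -
        have "ennreal (l / 2 * (f x)\<^sup>2) = ennreal (l / 2) * ennreal ((f x)\<^sup>2)"
          "ennreal (1 / (2 * l) * (g x)\<^sup>2) = ennreal (1 / (2 * l)) * ennreal ((g x)\<^sup>2)"
          using l by (intro ennreal_mult; simp)+
        moreover have "ennreal (l / 2 * (f x)\<^sup>2 + 1 / (2 * l) * (g x)\<^sup>2) = ennreal (l / 2 * (f x)\<^sup>2) + ennreal (1 / (2 * l) * (g x)\<^sup>2)"
          using l by (intro ennreal_plus) simp_all
        ultimately show ?thesis by (simp only:)
      qed
      finally show ?thesis .
    qed
    then have "(\<integral>\<^sup>+x. ennreal (f x * g x) \<partial>M) \<le> (\<integral>\<^sup>+x. ennreal (l / 2) * ennreal ((f x)\<^sup>2) + ennreal (1 / (2 * l)) * ennreal ((g x)\<^sup>2) \<partial>M)"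
      by (rule nn_integral_mono)
    also have "\<dots> = ennreal (l / 2) * (\<integral>\<^sup>+x. ennreal ((f x)\<^sup>2) \<partial>M) + ennreal (1 / (2 * l)) * ennreal B"
      unfolding B[symmetric] by (simp add: nn_integral_add nn_integral_cmult)
    also have "\<dots> \<le> ennreal (l / 2) * ennreal A + ennreal (1 / (2 * l)) * ennreal B"
      by (intro add_mono mult_left_mono A order_refl) auto
    also have "\<dots> = ennreal (l / 2 * A + 1 / (2 * l) * B)"
      using l B0 \<open>A > 0\<close> by (subst ennreal_plus) (auto simp: ennreal_mult'[symmetric])
    also have "l / 2 * A + 1 / (2 * l) * B = (l * A + B / l) / 2" by (simp add: add_divide_distrib)
    finally show ?thesis .
  qed
  obtain X where X0: "0 \<le> X" and X: "(\<integral>\<^sup>+x. ennreal (f x * g x) \<partial>M) = ennreal X"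
    using key[of 1] by (metis ennreal_cases ennreal_top_neq_zero top.extremum_uniqueI ennreal_neq_top zero_less_one)
  have le: "X \<le> (l * A + B / l) / 2" if "l > 0" for l
    using key[OF that] that \<open>A > 0\<close> B0 unfolding X by (subst (asm) ennreal_le_iff) auto
  have "X\<^sup>2 \<le> A * B"
  proof (cases "X = 0")
    case False
    then have "X > 0" using X0 by simp
    \<comment> \<open>the optimal parameter is \<open>sqrt (B / A)\<close>; the choice \<open>X / A\<close> avoids the root\<close>
    have "X \<le> ((X / A) * A + B / (X / A)) / 2" using le[of "X / A"] \<open>X > 0\<close> \<open>A > 0\<close> by simp
    then have "X \<le> A * B / X" using \<open>A > 0\<close> by (simp add: mult.commute)
    then show ?thesis using \<open>X > 0\<close> by (simp add: pos_le_divide_eq power2_eq_square)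
  qed (use B0 \<open>A > 0\<close> in simp)
  then show ?thesis unfolding X B using X0 B0 \<open>A > 0\<close>
    by (simp add: ennreal_power flip: ennreal_mult)
qed

text \<open>The sum \<open>S\<close> of \<open>4 ^ n |F (n + 1) - F n|\<^sup>2\<close> has a finite integral, and where it is finite the increments are at
  most \<open>sqrt S / 2 ^ n\<close>.  So the sequence converges there and stays below \<open>|F 0| + 2 sqrt S\<close>.\<close>

lemma fast_L2_limit:
  fixes F :: "nat \<Rightarrow> 'a \<Rightarrow> complex"
  assumes [measurable]: "\<And>n. F n \<in> borel_measurable M"
    and F0: "(\<integral>\<^sup>+x. ennreal ((norm (F 0 x))\<^sup>2) \<partial>M) < \<infinity>"
    and step: "\<And>n. (\<integral>\<^sup>+x. ennreal ((norm (F (Suc n) x - F n x))\<^sup>2) \<partial>M) \<le> ennreal (K / 8 ^ n)" and "K \<ge> 0"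
  shows "\<exists>G D. G \<in> borel_measurable M \<and> D \<in> borel_measurable M \<and> (\<forall>x. 0 \<le> D x) \<and>
     (\<integral>\<^sup>+x. ennreal ((D x)\<^sup>2) \<partial>M) < \<infinity> \<and>
     (AE x in M. (\<lambda>n. F n x) \<longlonglongrightarrow> G x \<and> (\<forall>n. norm (F n x) \<le> D x) \<and> norm (G x) \<le> (D x :: real))"
proof -
  define \<Delta> where "\<Delta> n x = F (Suc n) x - F n x" for n x
  have [measurable]: "\<Delta> n \<in> borel_measurable M" for n unfolding \<Delta>_def by measurable
  define S where "S x = (\<Sum>n. ennreal (4 ^ n * (norm (\<Delta> n x))\<^sup>2))" for x
  have [measurable]: "S \<in> borel_measurable M" unfolding S_def by measurable
  define D where "D x = norm (F 0 x) + 2 * sqrt (enn2real (S x))" for x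
  define G where "G x = lim (\<lambda>n. F n x)" for x
  have [measurable]: "D \<in> borel_measurable M" "G \<in> borel_measurable M" unfolding D_def G_def by measurable
  have sm: "summable (\<lambda>n. K * (1 / 2) ^ n)" by (intro summable_mult summable_geometric) simp
  have "(\<integral>\<^sup>+x. S x \<partial>M) = (\<Sum>n. \<integral>\<^sup>+x. ennreal (4 ^ n * (norm (\<Delta> n x))\<^sup>2) \<partial>M)"
    unfolding S_def by (rule nn_integral_suminf) measurable
  also have "\<dots> \<le> (\<Sum>n. ennreal (K * (1 / 2) ^ n))"
  proof (intro suminf_le)
    fix n
    have "(\<integral>\<^sup>+x. ennreal (4 ^ n * (norm (\<Delta> n x))\<^sup>2) \<partial>M) = ennreal (4 ^ n) * (\<integral>\<^sup>+x. ennreal ((norm (\<Delta> n x))\<^sup>2) \<partial>M)"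
      by (simp only: ennreal_mult'[of "4 ^ n", simplified]) (simp add: nn_integral_cmult)
    also have "\<dots> \<le> ennreal (4 ^ n) * ennreal (K / 8 ^ n)"
      using step[of n] unfolding \<Delta>_def by (rule mult_left_mono) simp
    also have "\<dots> = ennreal (4 ^ n * (K / 8 ^ n))" using \<open>K \<ge> 0\<close> by (subst ennreal_mult') simp_all
    also have "4 ^ n * (K / 8 ^ n) = K * (1 / 2) ^ n"
      by (simp add: power_divide[symmetric] power_mult_distrib[symmetric] field_simps)
    finally show "(\<integral>\<^sup>+x. ennreal (4 ^ n * (norm (\<Delta> n x))\<^sup>2) \<partial>M) \<le> ennreal (K * (1 / 2) ^ n)" .
  qed auto
  also have "\<dots> < \<infinity>" using sm \<open>K \<ge> 0\<close> by (subst suminf_ennreal2) auto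
  finally have Sfin: "(\<integral>\<^sup>+x. S x \<partial>M) < \<infinity>" .
  have "AE x in M. S x \<noteq> \<infinity>"
    by (rule nn_integral_PInf_AE) (use Sfin in simp_all)
  then have AES: "AE x in M. S x < \<infinity>" by eventually_elim (simp add: less_top)
  have main: "(\<lambda>n. F n x) \<longlonglongrightarrow> G x \<and> (\<forall>n. norm (F n x) \<le> D x) \<and> norm (G x) \<le> D x" if fin: "S x < \<infinity>" for x
  proof -
    define \<sigma> where "\<sigma> = sqrt (enn2real (S x))"
    have d: "norm (\<Delta> n x) \<le> \<sigma> * (1 / 2) ^ n" for n
    proof -
      have "ennreal (4 ^ n * (norm (\<Delta> n x))\<^sup>2) = (\<Sum>m\<in>{n}. ennreal (4 ^ m * (norm (\<Delta> m x))\<^sup>2))" by simp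
      also have "\<dots> \<le> S x" unfolding S_def by (rule sum_le_suminf) auto
      finally have "4 ^ n * (norm (\<Delta> n x))\<^sup>2 \<le> enn2real (S x)"
        using fin by (cases "S x") (auto simp: ennreal_le_iff)
      moreover have "((2::real) ^ n)\<^sup>2 = 4 ^ n"
        by (simp add: power2_eq_square power_mult_distrib[symmetric])
      ultimately have "(2 ^ n * norm (\<Delta> n x))\<^sup>2 \<le> enn2real (S x)"
        by (simp only: power_mult_distrib)
      then have "2 ^ n * norm (\<Delta> n x) \<le> \<sigma>" unfolding \<sigma>_def by (rule real_le_rsqrt)
      then show ?thesis by (simp add: field_simps power_divide)
    qed
    have s: "summable (\<lambda>n. \<sigma> * (1 / 2) ^ n)" by (intro summable_mult summable_geometric) simp
    have sD: "summable (\<lambda>n. \<Delta> n x)" by (rule summable_comparison_test'[OF s, of 0]) (use d in auto)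
    have tel: "F n x = F 0 x + (\<Sum>m<n. \<Delta> m x)" for n
      by (induction n) (auto simp: \<Delta>_def)
    have "(\<lambda>n. F 0 x + (\<Sum>m<n. \<Delta> m x)) \<longlonglongrightarrow> F 0 x + (\<Sum>m. \<Delta> m x)"
      by (intro tendsto_intros summable_LIMSEQ sD)
    moreover have "(\<lambda>n. F n x) = (\<lambda>n. F 0 x + (\<Sum>m<n. \<Delta> m x))" by (rule ext) (rule tel)
    ultimately have l: "(\<lambda>n. F n x) \<longlonglongrightarrow> F 0 x + (\<Sum>m. \<Delta> m x)" by (rule ssubst[rotated])
    have "G x = F 0 x + (\<Sum>m. \<Delta> m x)" unfolding G_def by (rule limI[OF l])
    then have conv: "(\<lambda>n. F n x) \<longlonglongrightarrow> G x" using l by (rule ssubst)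
    have bd: "norm (F n x) \<le> D x" for n
    proof -
      have "norm (\<Sum>m<n. \<Delta> m x) \<le> (\<Sum>m<n. \<sigma> * (1 / 2) ^ m)" by (rule sum_norm_le) (use d in auto)
      also have "\<dots> \<le> (\<Sum>m. \<sigma> * (1 / 2) ^ m)" by (rule sum_le_suminf[OF s]) (auto simp: \<sigma>_def)
      also have "\<dots> = \<sigma> * 2" by (subst suminf_mult) (auto simp: suminf_geometric)
      finally show ?thesis unfolding tel[of n] D_def \<sigma>_def[symmetric] using norm_triangle_ineq[of "F 0 x" "\<Sum>m<n. \<Delta> m x"] by argo
    qed
    have "norm (G x) \<le> D x" by (rule Lim_bounded[OF tendsto_norm[OF conv]]) (use bd in auto)
    then show ?thesis using conv bd by blast
  qed
  have "(\<integral>\<^sup>+x. ennreal ((D x)\<^sup>2) \<partial>M) \<le> (\<integral>\<^sup>+x. 2 * ennreal ((norm (F 0 x))\<^sup>2) + 8 * S x \<partial>M)"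
  proof (rule nn_integral_mono_AE, use AES in eventually_elim)
    case (elim x)
    define \<sigma> where "\<sigma> = enn2real (S x)"
    have S: "S x = ennreal \<sigma>" and \<sigma>0: "0 \<le> \<sigma>" using elim unfolding \<sigma>_def by auto
    have "(D x)\<^sup>2 \<le> 2 * (norm (F 0 x))\<^sup>2 + 2 * (2 * sqrt \<sigma>)\<^sup>2"
      unfolding D_def \<sigma>_def[symmetric] using sum_squares_bound[of "norm (F 0 x)" "2 * sqrt \<sigma>"] by (simp add: power2_sum)
    also have "\<dots> = 2 * (norm (F 0 x))\<^sup>2 + 8 * \<sigma>" using \<sigma>0 by (simp add: power_mult_distrib)
    finally have "ennreal ((D x)\<^sup>2) \<le> ennreal (2 * (norm (F 0 x))\<^sup>2 + 8 * \<sigma>)" by (rule ennreal_leI)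
    also have "\<dots> = 2 * ennreal ((norm (F 0 x))\<^sup>2) + 8 * S x"
      unfolding S using \<sigma>0 by (subst ennreal_plus) (auto simp: ennreal_mult)
    finally show ?case .
  qed
  also have "\<dots> = 2 * (\<integral>\<^sup>+x. ennreal ((norm (F 0 x))\<^sup>2) \<partial>M) + 8 * (\<integral>\<^sup>+x. S x \<partial>M)"
    by (simp add: nn_integral_add nn_integral_cmult)
  also have "\<dots> < \<infinity>" using F0 Sfin by (simp add: ennreal_mult_less_top)
  finally have Dfin: "(\<integral>\<^sup>+x. ennreal ((D x)\<^sup>2) \<partial>M) < \<infinity>" .
  have "AE x in M. (\<lambda>n. F n x) \<longlonglongrightarrow> G x \<and> (\<forall>n. norm (F n x) \<le> D x) \<and> norm (G x) \<le> D x"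
    using AES by eventually_elim (rule main)
  moreover have "\<forall>x. 0 \<le> D x" unfolding D_def by simp
  ultimately show ?thesis using Dfin by (intro exI[of _ G] exI[of _ D]) simp
qed

section \<open>A Schur test and an inequality of Plancherel\<close>

text \<open>Bounded functions with bounded support.  On them all transforms are absolutely convergent
  integrals, and every slice is again such a function.\<close>

definition truncated :: "('a::euclidean_space \<Rightarrow> complex) \<Rightarrow> bool" where
  "truncated w \<longleftrightarrow> w \<in> borel_measurable borel \<and> (\<exists>R. \<forall>k. norm (w k) \<le> R \<and> (norm k > R \<longrightarrow> w k = 0))"

lemma truncated_measurable [measurable_dest]: "truncated w \<Longrightarrow> w \<in> borel_measurable borel"
  unfolding truncated_def by blast

lemma truncated_integrable:
  assumes "truncated w" shows "integrable lborel w"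
proof -
  obtain R where R: "\<And>k. norm (w k) \<le> R" "\<And>k. norm k > R \<Longrightarrow> w k = 0" and [measurable]: "w \<in> borel_measurable borel"
    using assms unfolding truncated_def by blast
  have "integrable lborel (\<lambda>k::'a. indicator (cball 0 R) k * R)"
    by (intro integrable_mult_left integrable_real_indicator emeasure_lborel_cball_finite) simp
  then show ?thesis
  proof (rule Bochner_Integration.integrable_bound)
    show "AE k in lborel. norm (w k) \<le> norm (indicator (cball 0 R) k * R)"
    proof (rule AE_I2)
      fix k show "norm (w k) \<le> norm (indicator (cball 0 R) k * R)"
        using R[of k] by (cases "norm k \<le> R") auto
    qed
  qed simp
qed

lemma truncated_diff:
  assumes "truncated w" "truncated w'" shows "truncated (\<lambda>k. w k - w' k)"
proof -
  obtain R where R: "\<And>k. norm (w k) \<le> R" "\<And>k. norm k > R \<Longrightarrow> w k = 0" using assms unfolding truncated_def by blast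
  obtain R' where R': "\<And>k. norm (w' k) \<le> R'" "\<And>k. norm k > R' \<Longrightarrow> w' k = 0" using assms unfolding truncated_def by blast
  have "0 \<le> R" "0 \<le> R'" using order_trans[OF norm_ge_zero R(1)] order_trans[OF norm_ge_zero R'(1)] by auto
  then have "norm (w k - w' k) \<le> R + R' \<and> (norm k > R + R' \<longrightarrow> w k - w' k = 0)" for k
    using R[of k] R'[of k] norm_triangle_ineq4[of "w k" "w' k"] by auto
  then show ?thesis using assms unfolding truncated_def by (auto intro!: exI[of _ "R + R'"])
qed

lemma truncated_section:
  assumes "truncated (w :: real \<times> real \<Rightarrow> complex)" shows "truncated (\<lambda>k2. w (k1, k2))"
proof -
  have [measurable]: "w \<in> borel_measurable borel" using assms by (rule truncated_measurable)
  obtain R where R: "\<And>k. norm (w k) \<le> R" "\<And>k. norm k > R \<Longrightarrow> w k = 0" using assms unfolding truncated_def by blast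
  have "norm k2 \<le> norm (k1, k2)" for k2 by (metis norm_snd_le)
  then have "norm (w (k1, k2)) \<le> R \<and> (norm k2 > R \<longrightarrow> w (k1, k2) = 0)" for k2
    using R[of "(k1, k2)"] by (meson less_le_trans)
  then show ?thesis unfolding truncated_def by auto
qed

lemma integral_tensor:
  fixes f :: "'a \<Rightarrow> complex" and g :: "'b \<Rightarrow> complex"
  assumes "sigma_finite_measure M" "sigma_finite_measure N" "integrable M f" "integrable N g"
  shows "(LINT p|(M \<Otimes>\<^sub>M N). f (fst p) * g (snd p)) = integral\<^sup>L M f * integral\<^sup>L N g"
proof -
  interpret M: sigma_finite_measure M by fact
  interpret N: sigma_finite_measure N by fact
  interpret pair_sigma_finite M N ..
  have "(LINT x|M. LINT y|N. f x * g y) = integral\<^sup>L (M \<Otimes>\<^sub>M N) (\<lambda>(x, y). f x * g y)"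
    by (rule integral_fst[OF integrable_tensor[OF assms]])
  then show ?thesis by (simp add: case_prod_unfold)
qed

text \<open>Expanding the square and integrating in \<open>t\<close> first leaves a quadratic form in \<open>w\<close> with a kernel dominated by \<open>\<kappa>\<close>.
  Splitting \<open>|w(k)| |w(l)|\<close> into half the sum of the squares, each term is controlled by the mass of
  \<open>\<kappa>\<close> in the other variable.\<close>

lemma schur_bound:
  fixes \<rho> :: "real \<Rightarrow> real" and \<theta> :: "real \<Rightarrow> real \<Rightarrow> real" and w :: "real \<Rightarrow> complex"
  assumes w: "truncated w" and \<rho>: "integrable lborel \<rho>" and \<rho>0: "\<And>t. 0 \<le> \<rho> t"
    and [measurable]: "(\<lambda>(t, k). \<theta> t k) \<in> borel_measurable borel" "(\<lambda>(k, l). \<kappa> k l) \<in> borel_measurable borel"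
    and \<kappa>: "\<And>k l. norm (LINT t|lborel. cis (\<theta> t k - \<theta> t l) * of_real (\<rho> t)) \<le> \<kappa> k l"
    and C1: "\<And>k. (\<integral>\<^sup>+l. ennreal (\<kappa> k l) \<partial>lborel) \<le> ennreal C"
    and C2: "\<And>l. (\<integral>\<^sup>+k. ennreal (\<kappa> k l) \<partial>lborel) \<le> ennreal C"
  shows "(\<integral>\<^sup>+t. ennreal (\<rho> t * (norm (LINT k|lborel. cis (\<theta> t k) * w k))\<^sup>2) \<partial>lborel)
    \<le> ennreal C * energy w"
proof -
  let ?L = "lborel :: real measure"
  let ?P = "?L \<Otimes>\<^sub>M ?L"
  have sf: "sigma_finite_measure ?L" "sigma_finite_measure ?P"
    by (simp_all add: lborel.sigma_finite_measure_axioms lborel_prod)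
  interpret tP: pair_sigma_finite ?L ?P
    unfolding pair_sigma_finite_def using sf by blast
  have [measurable]: "w \<in> borel_measurable borel" by (rule truncated_measurable[OF w])
  have [measurable]: "\<rho> \<in> borel_measurable borel" using \<rho> by auto
  have \<theta>m [measurable]: "(\<lambda>x. \<theta> (f x) (g x)) \<in> borel_measurable N"
    if [measurable]: "f \<in> borel_measurable N" "g \<in> borel_measurable N" for f g and N :: "'z measure"
  proof -
    have "(\<lambda>x. (\<lambda>(t, k). \<theta> t k) (f x, g x)) \<in> borel_measurable N" by measurable
    then show ?thesis by simp
  qed
  have \<kappa>m [measurable]: "(\<lambda>x. \<kappa> (f x) (g x)) \<in> borel_measurable N"
    if [measurable]: "f \<in> borel_measurable N" "g \<in> borel_measurable N" for f g and N :: "'z measure"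
  proof -
    have "(\<lambda>x. (\<lambda>(t, k). \<kappa> t k) (f x, g x)) \<in> borel_measurable N" by measurable
    then show ?thesis by simp
  qed
  have wi: "integrable ?L w" by (rule truncated_integrable[OF w])
  have wci: "integrable ?L (\<lambda>k. cnj (w k))" using wi by (rule integrable_cnj)
  define A where "A t = (LINT k|lborel. cis (\<theta> t k) * w k)" for t
  have [measurable]: "A \<in> borel_measurable borel"
    unfolding A_def using lborel.borel_measurable_lebesgue_integral[of "\<lambda>t k. cis (\<theta> t k) * w k" borel] by simp
  have Ab: "norm (A t) \<le> (LINT k|lborel. norm (w k))" for t
    unfolding A_def by (rule order_trans[OF integral_norm_bound]) (simp add: norm_mult)
  have Ai: "integrable ?L (\<lambda>t. \<rho> t * (norm (A t))\<^sup>2)"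
  proof (rule Bochner_Integration.integrable_bound[OF integrable_mult_left[OF \<rho>, of "(LINT k|lborel. norm (w k))\<^sup>2"]])
    show "AE t in lborel. norm (\<rho> t * (norm (A t))\<^sup>2) \<le> norm (\<rho> t * (LINT k|lborel. norm (w k))\<^sup>2)"
      unfolding real_norm_def abs_mult using Ab by (intro AE_I2 mult_left_mono) (auto intro!: power_mono)
  qed simp
  define W where "W p = w (fst p) * cnj (w (snd p))" for p
  have Wi: "integrable ?P W"
    using integrable_tensor[OF sf(1) sf(1) wi wci] by (simp add: W_def[abs_def] case_prod_unfold)
  have [measurable]: "W \<in> borel_measurable ?P" using Wi by auto
  have hi: "integrable (?L \<Otimes>\<^sub>M ?P) (\<lambda>(t, p). cis (\<theta> t (fst p) - \<theta> t (snd p)) * (of_real (\<rho> t) * W p))"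
  proof -
    have "integrable (?L \<Otimes>\<^sub>M ?P) (\<lambda>q. cis (\<theta> (fst q) (fst (snd q)) - \<theta> (fst q) (snd (snd q))) * (case q of (t, p) \<Rightarrow> complex_of_real (\<rho> t) * W p))"
      by (rule integrable_cis_mult[OF integrable_tensor[OF sf integrable_of_real[OF \<rho>] Wi]]) measurable
    then show ?thesis by (simp add: case_prod_unfold)
  qed
  have AA: "complex_of_real (\<rho> t * (norm (A t))\<^sup>2) = (LINT p|?P. cis (\<theta> t (fst p) - \<theta> t (snd p)) * (of_real (\<rho> t) * W p))" for t
  proof -
    have i: "integrable ?L (\<lambda>k. cis (\<theta> t k) * w k)" by (intro integrable_cis_mult wi) measurable
    have "complex_of_real ((norm (A t))\<^sup>2) = A t * cnj (A t)" by (rule complex_norm_square)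
    also have "\<dots> = (LINT p|?P. (cis (\<theta> t (fst p)) * w (fst p)) * cnj (cis (\<theta> t (snd p)) * w (snd p)))"
      using integral_tensor[OF sf(1) sf(1) i integrable_cnj[OF i]] Bochner_Integration.integral_cnj[of lborel "\<lambda>k. cis (\<theta> t k) * w k"]
      unfolding A_def by simp
    also have "\<dots> = (LINT p|?P. cis (\<theta> t (fst p) - \<theta> t (snd p)) * W p)"
    proof (intro Bochner_Integration.integral_cong refl)
      fix p :: "real \<times> real"
      have "cis (\<theta> t (fst p) - \<theta> t (snd p)) = cis (\<theta> t (fst p)) * cis (- \<theta> t (snd p))" by (simp add: cis_mult)
      then show "(cis (\<theta> t (fst p)) * w (fst p)) * cnj (cis (\<theta> t (snd p)) * w (snd p)) = cis (\<theta> t (fst p) - \<theta> t (snd p)) * W p"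
        by (simp add: W_def cis_cnj)
    qed
    finally show ?thesis by (simp add: mult.left_commute)
  qed
  have "(\<integral>\<^sup>+t. ennreal (\<rho> t * (norm (A t))\<^sup>2) \<partial>lborel) = ennreal (LINT t|lborel. \<rho> t * (norm (A t))\<^sup>2)"
    by (rule nn_integral_eq_integral[OF Ai]) (use \<rho>0 in auto)
  also have "(LINT t|lborel. \<rho> t * (norm (A t))\<^sup>2) \<le> norm (LINT t|lborel. complex_of_real (\<rho> t * (norm (A t))\<^sup>2))"
    by (subst integral_complex_of_real) simp
  also have "(LINT t|lborel. complex_of_real (\<rho> t * (norm (A t))\<^sup>2))
      = (LINT t|lborel. LINT p|?P. cis (\<theta> t (fst p) - \<theta> t (snd p)) * (of_real (\<rho> t) * W p))"
    unfolding AA ..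
  also have "\<dots> = (LINT p|?P. LINT t|lborel. cis (\<theta> t (fst p) - \<theta> t (snd p)) * (of_real (\<rho> t) * W p))"
    using tP.Fubini_integral[OF hi] by simp
  also have "\<dots> = (LINT p|?P. (LINT t|lborel. cis (\<theta> t (fst p) - \<theta> t (snd p)) * of_real (\<rho> t)) * W p)"
    by (simp add: mult.assoc[symmetric])
  finally have "(\<integral>\<^sup>+t. ennreal (\<rho> t * (norm (A t))\<^sup>2) \<partial>lborel)
    \<le> ennreal (norm (LINT p|?P. (LINT t|lborel. cis (\<theta> t (fst p) - \<theta> t (snd p)) * of_real (\<rho> t)) * W p))"
    by (simp add: ennreal_leI)
  also have "\<dots> \<le> (\<integral>\<^sup>+p. ennreal (norm ((LINT t|lborel. cis (\<theta> t (fst p) - \<theta> t (snd p)) * of_real (\<rho> t)) * W p)) \<partial>?P)"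
  proof (rule integral_norm_bound_ennreal)
    have "integrable ?P (\<lambda>p. LINT t|lborel. cis (\<theta> t (fst p) - \<theta> t (snd p)) * (of_real (\<rho> t) * W p))"
      using tP.integrable_snd[OF hi] by simp
    then show "integrable ?P (\<lambda>p. (LINT t|lborel. cis (\<theta> t (fst p) - \<theta> t (snd p)) * of_real (\<rho> t)) * W p)"
      by (simp add: mult.assoc[symmetric])
  qed
  also have "\<dots> \<le> (\<integral>\<^sup>+p. ennreal (1 / 2) * (ennreal ((norm (w (fst p)))\<^sup>2) * ennreal (\<kappa> (fst p) (snd p)))
      + ennreal (1 / 2) * (ennreal ((norm (w (snd p)))\<^sup>2) * ennreal (\<kappa> (fst p) (snd p))) \<partial>?P)"
  proof (intro nn_integral_mono)
    fix p
    have \<kappa>0: "0 \<le> \<kappa> (fst p) (snd p)" by (rule order_trans[OF norm_ge_zero \<kappa>])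
    have "norm ((LINT t|lborel. cis (\<theta> t (fst p) - \<theta> t (snd p)) * of_real (\<rho> t)) * W p)
      \<le> \<kappa> (fst p) (snd p) * (norm (w (fst p)) * norm (w (snd p)))"
      unfolding norm_mult[of "integral\<^sup>L _ _"] W_def by (intro mult_mono \<kappa> \<kappa>0) (simp_all add: norm_mult)
    also have "\<dots> \<le> \<kappa> (fst p) (snd p) * (((norm (w (fst p)))\<^sup>2 + (norm (w (snd p)))\<^sup>2) / 2)"
      using sum_squares_bound[of "norm (w (fst p))" "norm (w (snd p))"] by (intro mult_left_mono \<kappa>0) simp
    also have "\<dots> = 1 / 2 * ((norm (w (fst p)))\<^sup>2 * \<kappa> (fst p) (snd p)) + 1 / 2 * ((norm (w (snd p)))\<^sup>2 * \<kappa> (fst p) (snd p))"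
      by (simp add: field_simps)
    finally show "ennreal (norm ((LINT t|lborel. cis (\<theta> t (fst p) - \<theta> t (snd p)) * of_real (\<rho> t)) * W p))
      \<le> ennreal (1 / 2) * (ennreal ((norm (w (fst p)))\<^sup>2) * ennreal (\<kappa> (fst p) (snd p)))
      + ennreal (1 / 2) * (ennreal ((norm (w (snd p)))\<^sup>2) * ennreal (\<kappa> (fst p) (snd p)))"
    proof -
      assume le: "norm ((LINT t|lborel. cis (\<theta> t (fst p) - \<theta> t (snd p)) * of_real (\<rho> t)) * W p)
        \<le> 1 / 2 * ((norm (w (fst p)))\<^sup>2 * \<kappa> (fst p) (snd p)) + 1 / 2 * ((norm (w (snd p)))\<^sup>2 * \<kappa> (fst p) (snd p))"
      have m: "ennreal (1 / 2 * (x\<^sup>2 * \<kappa> (fst p) (snd p))) = ennreal (1 / 2) * (ennreal (x\<^sup>2) * ennreal (\<kappa> (fst p) (snd p)))" for x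
        using \<kappa>0 by (subst ennreal_mult, simp, simp, subst ennreal_mult) simp_all
      show ?thesis unfolding m[symmetric]
        using \<kappa>0 ennreal_leI[OF le] by (subst ennreal_plus[symmetric]) simp_all
    qed
  qed
  also have "\<dots> = ennreal (1 / 2) * (\<integral>\<^sup>+p. ennreal ((norm (w (fst p)))\<^sup>2) * ennreal (\<kappa> (fst p) (snd p)) \<partial>?P)
      + ennreal (1 / 2) * (\<integral>\<^sup>+p. ennreal ((norm (w (snd p)))\<^sup>2) * ennreal (\<kappa> (fst p) (snd p)) \<partial>?P)"
    by (simp add: nn_integral_add nn_integral_cmult)
  also have "(\<integral>\<^sup>+p. ennreal ((norm (w (fst p)))\<^sup>2) * ennreal (\<kappa> (fst p) (snd p)) \<partial>?P)
      \<le> ennreal C * energy w"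
  proof -
    have "(\<integral>\<^sup>+p. ennreal ((norm (w (fst p)))\<^sup>2) * ennreal (\<kappa> (fst p) (snd p)) \<partial>?P)
      = (\<integral>\<^sup>+k. \<integral>\<^sup>+l. ennreal ((norm (w k))\<^sup>2) * ennreal (\<kappa> k l) \<partial>lborel \<partial>lborel)"
      by (subst lborel.nn_integral_fst[symmetric]) auto
    also have "\<dots> = (\<integral>\<^sup>+k. ennreal ((norm (w k))\<^sup>2) * (\<integral>\<^sup>+l. ennreal (\<kappa> k l) \<partial>lborel) \<partial>lborel)"
      by (simp add: nn_integral_cmult)
    also have "\<dots> \<le> (\<integral>\<^sup>+k. ennreal ((norm (w k))\<^sup>2) * ennreal C \<partial>lborel)"
      by (intro nn_integral_mono mult_left_mono C1) simp
    also have "\<dots> = ennreal C * energy w"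
      by (simp add: nn_integral_cmult mult.commute)
    finally show ?thesis .
  qed
  also have "(\<integral>\<^sup>+p. ennreal ((norm (w (snd p)))\<^sup>2) * ennreal (\<kappa> (fst p) (snd p)) \<partial>?P)
      \<le> ennreal C * energy w"
  proof -
    have "(\<integral>\<^sup>+p. ennreal ((norm (w (snd p)))\<^sup>2) * ennreal (\<kappa> (fst p) (snd p)) \<partial>?P)
      = (\<integral>\<^sup>+l. \<integral>\<^sup>+k. ennreal ((norm (w l))\<^sup>2) * ennreal (\<kappa> k l) \<partial>lborel \<partial>lborel)"
      by (subst lborel_pair.nn_integral_snd[symmetric]) auto
    also have "\<dots> = (\<integral>\<^sup>+l. ennreal ((norm (w l))\<^sup>2) * (\<integral>\<^sup>+k. ennreal (\<kappa> k l) \<partial>lborel) \<partial>lborel)"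
      by (simp add: nn_integral_cmult)
    also have "\<dots> \<le> (\<integral>\<^sup>+k. ennreal ((norm (w k))\<^sup>2) * ennreal C \<partial>lborel)"
      by (intro nn_integral_mono mult_left_mono C2) simp
    also have "\<dots> = ennreal C * energy w"
      by (simp add: nn_integral_cmult mult.commute)
    finally show ?thesis .
  qed
  also have "ennreal (1 / 2) * (ennreal C * energy w)
      + ennreal (1 / 2) * (ennreal C * energy w) = ennreal C * energy w"
    unfolding distrib_right[symmetric] by (subst ennreal_plus[symmetric]) simp_all
  finally show ?thesis unfolding A_def by (simp add: add_left_mono add_right_mono mult_left_mono)
qed

text \<open>With a Gaussian weight in \<open>x\<close> the Schur test applies to a Gaussian kernel of total mass \<open>2 \<pi>\<close>,
  whatever its width.  Fatou's lemma removes the weight.\<close>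

lemma plancherel_le:
  assumes w: "truncated w"
  shows "energy (\<lambda>x. LINT k|lborel. cis (k * x) * w k)
    \<le> ennreal (2 * pi) * (\<integral>\<^sup>+k. ennreal ((norm (w k))\<^sup>2) \<partial>(lborel :: real measure))" (is "_ \<le> ?R")
proof -
  have [measurable]: "w \<in> borel_measurable borel" by (rule truncated_measurable[OF w])
  let ?A = "\<lambda>x. (norm (LINT k|lborel. cis (k * x) * w k))\<^sup>2"
  have [measurable]: "?A \<in> borel_measurable borel"
    using lborel.borel_measurable_lebesgue_integral[of "\<lambda>x k. cis (k * x) * w k" borel] by simp
  define e where "e n = 1 / real (Suc n)" for n
  have e: "e n > 0" for n unfolding e_def by simp
  define \<rho> where "\<rho> n x = exp (- ((e n * x)\<^sup>2 / 2))" for n x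
  have \<rho>g: "complex_of_real (\<rho> n x) = gauss (e n * x)" for n x
    unfolding \<rho>_def gauss_def by simp
  have bound: "(\<integral>\<^sup>+x. ennreal (\<rho> n x * ?A x) \<partial>lborel) \<le> ?R" for n
  proof (rule schur_bound[where \<theta>="\<lambda>x k. k * x" and \<kappa>="\<lambda>k l. inverse (e n) * sqrt (2 * pi) * exp (- (((k - l) / e n)\<^sup>2 / 2))"])
    have gi: "integrable lborel (\<lambda>x::real. exp (- (x\<^sup>2 / 2)))"
      using integrable_norm[OF gauss_integrable[where 'a=real]] unfolding gauss_def by simp
    show "integrable lborel (\<rho> n)"
      unfolding \<rho>_def using lborel_integrable_real_affine[OF gi, of "e n" 0] e[of n] by simp
    show "norm (LINT t|lborel. cis (k * t - l * t) * complex_of_real (\<rho> n t)) \<le> inverse (e n) * sqrt (2 * pi) * exp (- (((k - l) / e n)\<^sup>2 / 2))" for k l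
    proof -
      have "complex_of_real (sqrt (2 * pi)) * gauss ((l - k) / e n) = fourier gauss ((l - k) / e n)"
        using fourier_gauss[of "(l - k) / e n"] by simp
      also have "\<dots> = \<bar>e n\<bar> ^ DIM(real) *\<^sub>R (LINT t|lborel. cis (- (((l - k) / e n) \<bullet> (0 + e n *\<^sub>R t))) * gauss (0 + e n *\<^sub>R t))"
        unfolding fourier_def by (rule lborel_integral_affine) (use e[of n] in auto)
      also have "\<dots> = e n *\<^sub>R (LINT t|lborel. cis (k * t - l * t) * complex_of_real (\<rho> n t))"
      proof -
        have "- (((l - k) / e n) \<bullet> (0 + e n *\<^sub>R t)) = k * t - l * t" for t
          using e[of n] by (simp add: left_diff_distrib[of l k t])
        then show ?thesis unfolding \<rho>g using e[of n] by simp
      qed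
      finally have "(LINT t|lborel. cis (k * t - l * t) * complex_of_real (\<rho> n t)) = inverse (e n) *\<^sub>R (complex_of_real (sqrt (2 * pi)) * gauss ((l - k) / e n))"
        using e[of n] by simp
      then show ?thesis using e[of n]
        by (simp add: norm_mult gauss_def power_divide power2_commute[of l k])
    qed
    \<comment> \<open>the mass of the Gaussian kernel is \<open>sqrt (2 * pi) * sqrt (2 * pi)\<close>, whatever its width and centre\<close>
    have tot: "(\<integral>\<^sup>+l. ennreal (inverse (e n) * sqrt (2 * pi) * exp (- ((l / e n + a)\<^sup>2 / 2))) \<partial>lborel) \<le> ennreal (2 * pi)" for a
    proof -
      have "(LINT x::real|lborel. complex_of_real (exp (- (x\<^sup>2 / 2)))) = complex_of_real (sqrt (2 * pi))"
        using integral_gauss[where 'a=real] unfolding gauss_def by simp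
      then have gI: "(LINT x::real|lborel. exp (- (x\<^sup>2 / 2))) = sqrt (2 * pi)"
        unfolding integral_complex_of_real by (metis of_real_eq_iff)
      have "ennreal (sqrt (2 * pi)) = (\<integral>\<^sup>+x. ennreal (exp (- (x\<^sup>2 / 2))) \<partial>lborel)"
        unfolding gI[symmetric] by (rule nn_integral_eq_integral[OF gi, symmetric]) simp
      also have "\<dots> = \<bar>inverse (e n)\<bar> * (\<integral>\<^sup>+l. ennreal (exp (- ((a + inverse (e n) * l)\<^sup>2 / 2))) \<partial>lborel)"
        by (rule nn_integral_real_affine) (use e[of n] in auto)
      finally have "ennreal (sqrt (2 * pi)) * ennreal (sqrt (2 * pi)) = ennreal (sqrt (2 * pi)) * (\<bar>inverse (e n)\<bar> * (\<integral>\<^sup>+l. ennreal (exp (- ((a + inverse (e n) * l)\<^sup>2 / 2))) \<partial>lborel))"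
        by simp
      also have "\<dots> = (\<integral>\<^sup>+l. ennreal (inverse (e n) * sqrt (2 * pi) * exp (- ((l / e n + a)\<^sup>2 / 2))) \<partial>lborel)"
      proof -
        have "ennreal (inverse (e n) * sqrt (2 * pi) * exp (- ((l / e n + a)\<^sup>2 / 2)))
            = ennreal (sqrt (2 * pi)) * (ennreal \<bar>inverse (e n)\<bar> * ennreal (exp (- ((a + inverse (e n) * l)\<^sup>2 / 2))))" for l
        proof -
          have "l / e n + a = a + inverse (e n) * l" by (simp add: divide_inverse)
          moreover have "inverse (e n) * sqrt (2 * pi) * y = sqrt (2 * pi) * (\<bar>inverse (e n)\<bar> * y)" for y
            using e[of n] by simp
          ultimately show ?thesis by (simp only: ennreal_mult abs_ge_zero exp_ge_zero real_sqrt_ge_zero mult_nonneg_nonneg pi_ge_zero zero_le_numeral)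
        qed
        then show ?thesis by (simp add: nn_integral_cmult)
      qed
      finally have "(\<integral>\<^sup>+l. ennreal (inverse (e n) * sqrt (2 * pi) * exp (- ((l / e n + a)\<^sup>2 / 2))) \<partial>lborel)
        = ennreal (sqrt (2 * pi) * sqrt (2 * pi))" by (simp only: ennreal_mult real_sqrt_ge_zero mult_nonneg_nonneg pi_ge_zero zero_le_numeral)
      then show ?thesis by simp
    qed
    show "(\<integral>\<^sup>+k. ennreal (inverse (e n) * sqrt (2 * pi) * exp (- (((k - l) / e n)\<^sup>2 / 2))) \<partial>lborel) \<le> ennreal (2 * pi)" for l
      using tot[of "- (l / e n)"] by (simp add: diff_divide_distrib)
    show "(\<integral>\<^sup>+l. ennreal (inverse (e n) * sqrt (2 * pi) * exp (- (((k - l) / e n)\<^sup>2 / 2))) \<partial>lborel) \<le> ennreal (2 * pi)" for k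
      using tot[of "- (k / e n)"] by (simp add: diff_divide_distrib power2_commute[of "k / e n"])
    show "(\<lambda>(x, k). k * x) \<in> borel_measurable (borel :: (real \<times> real) measure)"
      unfolding case_prod_unfold by (intro borel_measurable_continuous_onI continuous_intros)
    show "(\<lambda>(k, l). inverse (e n) * sqrt (2 * pi) * exp (- (((k - l) / e n)\<^sup>2 / 2))) \<in> borel_measurable (borel :: (real \<times> real) measure)"
      unfolding case_prod_unfold by (intro borel_measurable_continuous_onI continuous_intros) (use e[of n] in auto)
  qed (use w in \<open>auto simp: \<rho>_def\<close>)
  have lim: "(\<lambda>n. ennreal (\<rho> n x * ?A x)) \<longlonglongrightarrow> ennreal (?A x)" for x
  proof (rule tendsto_ennrealI)
    have "e \<longlonglongrightarrow> 0" unfolding e_def using LIMSEQ_Suc[OF lim_1_over_n] by simp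
    then have "(\<lambda>n. exp (- ((e n * x)\<^sup>2 / 2)) * ?A x) \<longlonglongrightarrow> exp (- ((0 * x)\<^sup>2 / 2)) * ?A x"
      by (intro tendsto_intros) auto
    then show "(\<lambda>n. \<rho> n x * ?A x) \<longlonglongrightarrow> ?A x" unfolding \<rho>_def by simp
  qed
  have "(\<integral>\<^sup>+x. ennreal (?A x) \<partial>lborel) = (\<integral>\<^sup>+x. liminf (\<lambda>n. ennreal (\<rho> n x * ?A x)) \<partial>lborel)"
    using lim_imp_Liminf[OF sequentially_bot lim] by simp
  also have "\<dots> \<le> liminf (\<lambda>n. \<integral>\<^sup>+x. ennreal (\<rho> n x * ?A x) \<partial>lborel)"
    by (rule nn_integral_liminf) (simp add: \<rho>_def)
  also have "\<dots> \<le> ?R" by (rule Liminf_le) (use bound in auto)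
  finally show ?thesis .
qed

section \<open>The trace of truncated data on a line\<close>

lemma nn_integral_R2:
  assumes [measurable]: "f \<in> borel_measurable (borel :: (real \<times> real) measure)"
  shows "(\<integral>\<^sup>+p. f p \<partial>lborel) = (\<integral>\<^sup>+x. \<integral>\<^sup>+y. f (x, y) \<partial>lborel \<partial>lborel)"
    "(\<integral>\<^sup>+p. f p \<partial>lborel) = (\<integral>\<^sup>+y. \<integral>\<^sup>+x. f (x, y) \<partial>lborel \<partial>lborel)"
proof -
  have m: "f \<in> borel_measurable (lborel \<Otimes>\<^sub>M lborel)" by (simp add: lborel_prod)
  show "(\<integral>\<^sup>+p. f p \<partial>lborel) = (\<integral>\<^sup>+x. \<integral>\<^sup>+y. f (x, y) \<partial>lborel \<partial>lborel)"
    using lborel.nn_integral_fst[OF m] by (simp add: lborel_prod)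
  show "(\<integral>\<^sup>+p. f p \<partial>lborel) = (\<integral>\<^sup>+y. \<integral>\<^sup>+x. f (x, y) \<partial>lborel \<partial>lborel)"
    using lborel_pair.nn_integral_snd[OF m] by (simp add: lborel_prod)
qed

lemma AE_R2:
  assumes "AE p in (lborel :: (real \<times> real) measure). P p"
  shows "AE x in lborel. AE y in lborel. P (x, y)" "AE y in lborel. AE x in lborel. P (x, y)"
proof -
  have a: "AE p in lborel \<Otimes>\<^sub>M lborel. P p" using assms unfolding lborel_prod .
  show 1: "AE x in lborel. AE y in lborel. P (x, y)" by (rule lborel_pair.AE_pair[OF a])
  obtain N where N: "N \<in> null_sets (lborel :: (real \<times> real) measure)" "{p. \<not> P p} \<subseteq> N"
    using assms by (auto simp: eventually_ae_filter)
  then have [measurable]: "N \<in> sets borel" by auto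
  have "AE p in lborel \<Otimes>\<^sub>M lborel. p \<notin> N" using AE_not_in[OF N(1)] unfolding lborel_prod .
  then have "AE x in lborel. AE y in lborel. (x, y) \<notin> N" by (rule lborel_pair.AE_pair)
  moreover have "{p \<in> space (lborel \<Otimes>\<^sub>M lborel). (fst p, snd p) \<notin> N} \<in> sets (lborel \<Otimes>\<^sub>M lborel)"
    unfolding lborel_prod by simp
  ultimately have "AE y in lborel. AE x in lborel. (x, y) \<notin> N"
    using lborel_pair.AE_commute[of "\<lambda>x y. (x, y) \<notin> N"] by simp
  then show "AE y in lborel. AE x in lborel. P (x, y)"
    using N(2) by (auto elim!: eventually_mono)
qed

lemma AE_nn_integral_finite:
  assumes "f \<in> borel_measurable M" "(\<integral>\<^sup>+x. f x \<partial>M) < \<infinity>"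
  shows "AE x in M. f x < \<infinity>"
proof -
  have "AE x in M. f x \<noteq> \<infinity>" by (rule nn_integral_PInf_AE) (use assms in simp_all)
  then show ?thesis by eventually_elim (simp add: less_top)
qed

lemma schwartz_inverse_square:
  fixes f :: "real \<Rightarrow> complex"
  assumes "schwartz f" shows "\<exists>C>0. \<forall>\<xi>. norm (f \<xi>) \<le> C / (1 + \<xi>\<^sup>2)"
proof -
  obtain C where C: "\<And>x. (1 + norm x) ^ 2 * norm (f x) \<le> C" using schwartz_rapid[OF assms] by blast
  have "norm (f \<xi>) \<le> (\<bar>C\<bar> + 1) / (1 + \<xi>\<^sup>2)" for \<xi>
  proof -
    have "(1 + \<xi>\<^sup>2) * norm (f \<xi>) \<le> (1 + norm \<xi>) ^ 2 * norm (f \<xi>)"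
      by (intro mult_right_mono) (auto simp: power2_sum)
    also have "\<dots> \<le> \<bar>C\<bar> + 1" using C[of \<xi>] by linarith
    finally show ?thesis by (subst pos_le_divide_eq) (auto simp: add_pos_nonneg mult.commute)
  qed
  then show ?thesis by (intro exI[of _ "\<bar>C\<bar> + 1"]) auto
qed

lemma L2_mult_integrable:
  fixes f g :: "'a \<Rightarrow> complex"
  assumes [measurable]: "f \<in> borel_measurable M" "g \<in> borel_measurable M" "a \<in> borel_measurable M" "b \<in> borel_measurable M"
    and "(\<integral>\<^sup>+x. ennreal ((a x)\<^sup>2) \<partial>M) < \<infinity>" "(\<integral>\<^sup>+x. ennreal ((b x)\<^sup>2) \<partial>M) < \<infinity>"
    and ab: "AE x in M. norm (f x) \<le> a x" "AE x in M. norm (g x) \<le> (b x :: real)"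
  shows "integrable M (\<lambda>x. a x * b x)" "integrable M (\<lambda>x. f x * g x)"
proof -
  have i: "integrable M (\<lambda>x. (a x)\<^sup>2 + (b x)\<^sup>2)"
    by (intro Bochner_Integration.integrable_add integrableI_bounded) (use assms in auto)
  have ab2: "\<bar>a x * b x\<bar> \<le> (a x)\<^sup>2 + (b x)\<^sup>2" for x
  proof -
    have "2 * \<bar>a x\<bar> * \<bar>b x\<bar> \<le> \<bar>a x\<bar>\<^sup>2 + \<bar>b x\<bar>\<^sup>2" by (rule sum_squares_bound)
    moreover have "0 \<le> \<bar>a x\<bar> * \<bar>b x\<bar>" by simp
    ultimately show ?thesis unfolding abs_mult power2_abs by linarith
  qed
  show 1: "integrable M (\<lambda>x. a x * b x)"
    by (rule Bochner_Integration.integrable_bound[OF i]) (use ab2 in auto)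
  show "integrable M (\<lambda>x. f x * g x)"
  proof (rule Bochner_Integration.integrable_bound[OF 1])
    show "AE x in M. norm (f x * g x) \<le> norm (a x * b x)"
      using ab
    proof eventually_elim
      case (elim x)
      have "norm (f x) * norm (g x) \<le> a x * b x"
        using elim by (intro mult_mono) (auto intro: order_trans[OF norm_ge_zero])
      then show ?case by (simp add: norm_mult)
    qed
  qed measurable
qed

lemma schwartz_L2:
  assumes "schwartz (f :: 'a::euclidean_space \<Rightarrow> complex)"
  shows "energy f < \<infinity>"
proof -
  have "integrable lborel (\<lambda>x. norm (f x) * schwartz_seminorm 0 f)"
    by (intro integrable_mult_left integrable_norm schwartz_integrable assms)
  then have "(\<integral>\<^sup>+x. ennreal (norm (norm (f x) * schwartz_seminorm 0 f)) \<partial>lborel) < \<infinity>"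
    unfolding integrable_iff_bounded by blast
  moreover have "(norm (f x))\<^sup>2 \<le> norm (norm (f x) * schwartz_seminorm 0 f)" for x
    using mult_left_mono[OF schwartz_seminorm_bound[OF assms, of x 0, simplified] norm_ge_zero[of "f x"]]
    by (simp add: power2_eq_square)
  ultimately show ?thesis
    by (elim le_less_trans[rotated]) (intro nn_integral_mono ennreal_leI)
qed

text \<open>The partial transform in \<open>x\<^sub>1\<close> of the trace, times \<open>cis (k\<^sub>1\<^sup>2 t)\<close> and the cutoff in time.\<close>

definition lateral_hat :: "real \<Rightarrow> (real \<times> real \<Rightarrow> complex) \<Rightarrow> real \<times> real \<Rightarrow> complex" where
  "lateral_hat x2 w = (\<lambda>(k1, t). of_real (cutoff t / (2 * pi)) * (LINT k|lborel. cis (k * x2 - k\<^sup>2 * t) * w (k1, k)))"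

text \<open>The classical solution on the line, times the cutoff in time.\<close>

definition lateral :: "real \<Rightarrow> (real \<times> real \<Rightarrow> complex) \<Rightarrow> real \<times> real \<Rightarrow> complex" where
  "lateral x2 w = (\<lambda>(x1, t). of_real (1 / (2 * pi)) *
     (LINT k1|lborel. cis (k1 * x1) * (cis (- (k1\<^sup>2 * t)) * lateral_hat x2 w (k1, t))))"

lemma schwartz_cutoff: "schwartz (\<lambda>t. complex_of_real (cutoff t))"
  using schwartz_cutoff_power[of 1] by simp

lemma cutoff_measurable [measurable]: "cutoff \<in> borel_measurable borel"
proof -
  have "(\<lambda>t. Re (complex_of_real (cutoff t))) \<in> borel_measurable borel"
    using schwartz_measurable[OF schwartz_cutoff] by measurable
  then show ?thesis by simp
qed

lemma lateral_hat_measurable [measurable]: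
  assumes [measurable]: "w \<in> borel_measurable borel"
  shows "lateral_hat x2 w \<in> borel_measurable borel"
proof -
  have "(\<lambda>p::real \<times> real. LINT k|lborel. cis (k * x2 - k\<^sup>2 * snd p) * w (fst p, k)) \<in> borel_measurable (borel \<Otimes>\<^sub>M borel)"
    by (rule lborel.borel_measurable_lebesgue_integral) (simp only: case_prod_unfold, measurable)
  then have "(\<lambda>p::real \<times> real. of_real (cutoff (snd p) / (2 * pi)) * (LINT k|lborel. cis (k * x2 - k\<^sup>2 * snd p) * w (fst p, k))) \<in> borel_measurable (borel \<Otimes>\<^sub>M borel)"
    by measurable
  then show ?thesis unfolding lateral_hat_def case_prod_unfold borel_prod .
qed

lemma lateral_measurable [measurable]:
  assumes [measurable]: "w \<in> borel_measurable borel"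
  shows "lateral x2 w \<in> borel_measurable borel"
proof -
  have "(\<lambda>p::real \<times> real. LINT k1|lborel. cis (k1 * fst p) * (cis (- (k1\<^sup>2 * snd p)) * lateral_hat x2 w (k1, snd p))) \<in> borel_measurable (borel \<Otimes>\<^sub>M borel)"
    by (rule lborel.borel_measurable_lebesgue_integral) (simp only: case_prod_unfold, measurable)
  then have "(\<lambda>p::real \<times> real. of_real (1 / (2 * pi)) * (LINT k1|lborel. cis (k1 * fst p) * (cis (- (k1\<^sup>2 * snd p)) * lateral_hat x2 w (k1, snd p)))) \<in> borel_measurable (borel \<Otimes>\<^sub>M borel)"
    by measurable
  then show ?thesis unfolding lateral_def case_prod_unfold borel_prod .
qed

text \<open>In the Schur test the integral over \<open>t\<close> is a transform of the squared cutoff at \<open>k\<^sup>2 - l\<^sup>2\<close>; it decays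
  quadratically, and \<open>unweighted_kernel_integral_bound\<close> gives its mass.\<close>

lemma lateral_hat_slice_bound:
  "\<exists>C\<ge>0. \<forall>x2 w. truncated w \<longrightarrow> (\<forall>k1. energy (\<lambda>t. lateral_hat x2 w (k1, t))
     \<le> ennreal C * energy (\<lambda>k. w (k1, k)))"
proof -
  define \<rho> where "\<rho> t = (cutoff t / (2 * pi))\<^sup>2" for t
  have "schwartz (\<lambda>t. of_real (1 / (2 * pi)\<^sup>2) * complex_of_real (cutoff t ^ 2))"
    by (intro schwartz_cmult schwartz_cutoff_power) simp
  then have S: "schwartz (\<lambda>t. complex_of_real (\<rho> t))"
    by (simp add: \<rho>_def[abs_def] power_divide power_mult_distrib)
  obtain C where C0: "C > 0" and C: "\<And>\<xi>. norm (fourier (\<lambda>t. complex_of_real (\<rho> t)) \<xi>) \<le> C / (1 + \<xi>\<^sup>2)"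
    using schwartz_inverse_square[OF schwartz_fourier[OF S]] by blast
  have mass: "(\<integral>\<^sup>+l. ennreal (C / (1 + (k\<^sup>2 - l\<^sup>2)\<^sup>2)) \<partial>lborel) \<le> ennreal (C * kernel_mass)" for k
  proof -
    have "(\<integral>\<^sup>+l. ennreal (C / (1 + (k\<^sup>2 - l\<^sup>2)\<^sup>2)) \<partial>lborel) = (\<integral>\<^sup>+l. ennreal C * ennreal (1 / (1 + (- k\<^sup>2 + l\<^sup>2)\<^sup>2)) \<partial>lborel)"
    proof (intro nn_integral_cong)
      fix l
      have "(k\<^sup>2 - l\<^sup>2)\<^sup>2 = (- k\<^sup>2 + l\<^sup>2)\<^sup>2" by (subst power2_commute) simp
      then show "ennreal (C / (1 + (k\<^sup>2 - l\<^sup>2)\<^sup>2)) = ennreal C * ennreal (1 / (1 + (- k\<^sup>2 + l\<^sup>2)\<^sup>2))"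
        using C0 by (subst ennreal_mult[symmetric]) simp_all
    qed
    also have "\<dots> = ennreal C * (\<integral>\<^sup>+l. ennreal (1 / (1 + (- k\<^sup>2 + l\<^sup>2)\<^sup>2)) \<partial>lborel)"
      by (rule nn_integral_cmult) measurable
    also have "\<dots> \<le> ennreal C * ennreal kernel_mass"
      by (intro mult_left_mono unweighted_kernel_integral_bound) simp
    finally show ?thesis using C0 kernel_mass_pos by (simp add: ennreal_mult)
  qed
  have "energy (\<lambda>t. lateral_hat x2 w (k1, t))
     \<le> ennreal (C * kernel_mass) * energy (\<lambda>k. w (k1, k))" if w: "truncated w" for x2 w k1
  proof -
    have "(\<integral>\<^sup>+t. ennreal (\<rho> t * (norm (LINT k|lborel. cis (k * x2 - k\<^sup>2 * t) * w (k1, k)))\<^sup>2) \<partial>lborel)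
      \<le> ennreal (C * kernel_mass) * energy (\<lambda>k. w (k1, k))"
    proof (rule schur_bound[where \<theta>="\<lambda>t k. k * x2 - k\<^sup>2 * t" and \<kappa>="\<lambda>k l. C / (1 + (k\<^sup>2 - l\<^sup>2)\<^sup>2)"])
      show "truncated (\<lambda>k. w (k1, k))" by (rule truncated_section[OF w])
      show "integrable lborel \<rho>"
      proof -
        have "(\<lambda>t. norm (complex_of_real (\<rho> t))) = \<rho>"
          by (rule ext) (simp only: norm_of_real, simp add: \<rho>_def)
        then show ?thesis using integrable_norm[OF schwartz_integrable(1)[OF S]] by (simp only:)
      qed
      show "(\<lambda>(t, k). k * x2 - k\<^sup>2 * t) \<in> borel_measurable (borel :: (real \<times> real) measure)"
        unfolding case_prod_unfold borel_prod[symmetric] by measurable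
      show "(\<lambda>(k, l). C / (1 + (k\<^sup>2 - l\<^sup>2)\<^sup>2)) \<in> borel_measurable (borel :: (real \<times> real) measure)"
        unfolding case_prod_unfold borel_prod[symmetric] by measurable
      show "norm (LINT t|lborel. cis (k * x2 - k\<^sup>2 * t - (l * x2 - l\<^sup>2 * t)) * complex_of_real (\<rho> t)) \<le> C / (1 + (k\<^sup>2 - l\<^sup>2)\<^sup>2)" for k l
      proof -
        have "cis (k * x2 - k\<^sup>2 * t - (l * x2 - l\<^sup>2 * t)) = cis ((k - l) * x2) * cis (- ((k\<^sup>2 - l\<^sup>2) * t))" for t
          by (simp add: cis_mult algebra_simps)
        then have "(LINT t|lborel. cis (k * x2 - k\<^sup>2 * t - (l * x2 - l\<^sup>2 * t)) * complex_of_real (\<rho> t))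
          = cis ((k - l) * x2) * fourier (\<lambda>t. complex_of_real (\<rho> t)) (k\<^sup>2 - l\<^sup>2)"
          unfolding fourier_def by (simp add: mult.assoc)
        then show ?thesis using C[of "k\<^sup>2 - l\<^sup>2"] by (simp add: norm_mult)
      qed
      show "(\<integral>\<^sup>+k. ennreal (C / (1 + (k\<^sup>2 - l\<^sup>2)\<^sup>2)) \<partial>lborel) \<le> ennreal (C * kernel_mass)" for l
        using mass[of l] by (simp add: power2_commute[of _ "l\<^sup>2"])
    qed (use mass in \<open>auto simp: \<rho>_def\<close>)
    moreover have "(norm (lateral_hat x2 w (k1, t)))\<^sup>2 = \<rho> t * (norm (LINT k|lborel. cis (k * x2 - k\<^sup>2 * t) * w (k1, k)))\<^sup>2" for t
      unfolding lateral_hat_def \<rho>_def by (simp add: norm_mult norm_divide power_mult_distrib power_divide)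
    ultimately show ?thesis by simp
  qed
  then show ?thesis using C0 kernel_mass_pos by (intro exI[of _ "C * kernel_mass"]) auto
qed

lemma lateral_hat_bound:
  "\<exists>C\<ge>0. \<forall>x2 w. truncated w \<longrightarrow> energy (lateral_hat x2 w)
     \<le> ennreal C * energy w"
proof -
  obtain C where C0: "C \<ge> 0" and C: "\<And>x2 w k1. truncated w \<Longrightarrow> energy (\<lambda>t. lateral_hat x2 w (k1, t))
     \<le> ennreal C * energy (\<lambda>k. w (k1, k))"
    using lateral_hat_slice_bound by blast
  have "energy (lateral_hat x2 w) \<le> ennreal C * energy w"
    if w: "truncated w" for x2 w
  proof -
    have [measurable]: "w \<in> borel_measurable borel" by (rule truncated_measurable[OF w])
    have "energy (lateral_hat x2 w) = (\<integral>\<^sup>+k1. \<integral>\<^sup>+t. ennreal ((norm (lateral_hat x2 w (k1, t)))\<^sup>2) \<partial>lborel \<partial>lborel)"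
      by (rule nn_integral_R2) measurable
    also have "\<dots> \<le> (\<integral>\<^sup>+k1. ennreal C * energy (\<lambda>k. w (k1, k)) \<partial>lborel)"
      by (intro nn_integral_mono C w)
    also have "\<dots> = ennreal C * (\<integral>\<^sup>+k1. \<integral>\<^sup>+k. ennreal ((norm (w (k1, k)))\<^sup>2) \<partial>lborel \<partial>lborel)"
      by (rule nn_integral_cmult) measurable
    also have "\<dots> = ennreal C * energy w"
      by (subst nn_integral_R2(1)[of "\<lambda>k. ennreal ((norm (w k))\<^sup>2)"]) measurable
    finally show ?thesis .
  qed
  then show ?thesis using C0 by blast
qed

lemma truncated_slice_hat:
  assumes w: "truncated w" shows "truncated (\<lambda>k1. cis (- (k1\<^sup>2 * t)) * lateral_hat x2 w (k1, t))"
proof -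
  have [measurable]: "w \<in> borel_measurable borel" by (rule truncated_measurable[OF w])
  obtain R where R: "\<And>k. norm (w k) \<le> R" "\<And>k. norm k > R \<Longrightarrow> w k = 0" using w unfolding truncated_def by blast
  define B where "B = \<bar>cutoff t / (2 * pi)\<bar> * (LINT k|lborel. indicator (cball (0::real) R) k * R)"
  have iR: "integrable lborel (\<lambda>k::real. indicator (cball 0 R) k * R)"
    by (intro integrable_mult_left integrable_real_indicator emeasure_lborel_cball_finite) simp
  have "norm (cis (- (k1\<^sup>2 * t)) * lateral_hat x2 w (k1, t)) \<le> B" for k1
  proof -
    have "norm (LINT k|lborel. cis (k * x2 - k\<^sup>2 * t) * w (k1, k)) \<le> (LINT k|lborel. norm (cis (k * x2 - k\<^sup>2 * t) * w (k1, k)))"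
      by (rule integral_norm_bound)
    also have "\<dots> \<le> (LINT k|lborel. indicator (cball (0::real) R) k * R)"
    proof (rule integral_mono[OF integrable_norm iR])
      show "integrable lborel (\<lambda>k. cis (k * x2 - k\<^sup>2 * t) * w (k1, k))"
        by (intro integrable_cis_mult truncated_integrable truncated_section w) measurable
      fix k :: real
      have "norm k \<le> norm (k1, k)" by (metis norm_snd_le)
      then show "norm (cis (k * x2 - k\<^sup>2 * t) * w (k1, k)) \<le> indicator (cball 0 R) k * R"
        using R[of "(k1, k)"] by (cases "norm k \<le> R") (auto simp: norm_mult)
    qed
    finally show ?thesis unfolding B_def lateral_hat_def by (simp add: norm_mult norm_divide mult_left_mono divide_right_mono)
  qed
  moreover have "cis (- (k1\<^sup>2 * t)) * lateral_hat x2 w (k1, t) = 0" if "norm k1 > R" for k1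
  proof -
    have "w (k1, k) = 0" for k using that norm_fst_le[of k1 k] by (intro R(2)) auto
    then show ?thesis unfolding lateral_hat_def by simp
  qed
  ultimately show ?thesis unfolding truncated_def
    by (intro conjI exI[of _ "max B R"] allI impI) (measurable, auto simp: le_max_iff_disj)
qed

lemma lateral_slice_bound:
  assumes w: "truncated w"
  shows "energy (\<lambda>x. lateral x2 w (x, t)) \<le> energy (\<lambda>k. lateral_hat x2 w (k, t))"
proof -
  let ?h = "\<lambda>k1. cis (- (k1\<^sup>2 * t)) * lateral_hat x2 w (k1, t)"
  have [measurable]: "w \<in> borel_measurable borel" by (rule truncated_measurable[OF w])
  have m: "(\<lambda>x. LINT k|lborel. cis (k * x) * ?h k) \<in> borel_measurable borel"
    by (rule lborel.borel_measurable_lebesgue_integral) measurable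
  have "energy (\<lambda>x. lateral x2 w (x, t))
      = (\<integral>\<^sup>+x. ennreal ((1 / (2 * pi))\<^sup>2) * ennreal ((norm (LINT k|lborel. cis (k * x) * ?h k))\<^sup>2) \<partial>lborel)"
    unfolding lateral_def
    by (intro nn_integral_cong, subst ennreal_mult[symmetric]) (simp_all add: norm_mult norm_divide power_divide power_mult_distrib)
  also have "\<dots> = ennreal ((1 / (2 * pi))\<^sup>2) * energy (\<lambda>x. LINT k|lborel. cis (k * x) * ?h k)"
    by (rule nn_integral_cmult) (use m in measurable)
  also have "\<dots> \<le> ennreal ((1 / (2 * pi))\<^sup>2) * (ennreal (2 * pi) * energy ?h)"
    by (intro mult_left_mono plancherel_le truncated_slice_hat w) simp
  also have "\<dots> = ennreal ((1 / (2 * pi))\<^sup>2 * (2 * pi)) * energy (\<lambda>k. lateral_hat x2 w (k, t))"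
    by (simp add: norm_mult ennreal_mult mult.assoc)
  also have "\<dots> \<le> 1 * energy (\<lambda>k. lateral_hat x2 w (k, t))"
  proof (rule mult_right_mono)
    have "(1 / (2 * pi))\<^sup>2 * (2 * pi) \<le> 1" using pi_gt3 by (simp add: power2_eq_square field_simps)
    then show "ennreal ((1 / (2 * pi))\<^sup>2 * (2 * pi)) \<le> 1" by (metis ennreal_1 ennreal_leI)
  qed simp
  finally show ?thesis by simp
qed

lemma lateral_bound:
  assumes w: "truncated w"
  shows "energy (lateral x2 w) \<le> energy (lateral_hat x2 w)"
proof -
  have [measurable]: "w \<in> borel_measurable borel" by (rule truncated_measurable[OF w])
  have "energy (lateral x2 w) = (\<integral>\<^sup>+t. \<integral>\<^sup>+x. ennreal ((norm (lateral x2 w (x, t)))\<^sup>2) \<partial>lborel \<partial>lborel)"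
    by (rule nn_integral_R2) measurable
  also have "\<dots> \<le> (\<integral>\<^sup>+t. \<integral>\<^sup>+k. ennreal ((norm (lateral_hat x2 w (k, t)))\<^sup>2) \<partial>lborel \<partial>lborel)"
    by (intro nn_integral_mono lateral_slice_bound w)
  also have "\<dots> = energy (lateral_hat x2 w)"
    by (rule nn_integral_R2(2)[symmetric]) measurable
  finally show ?thesis .
qed

lemma lateral_hat_diff:
  assumes "truncated w" "truncated w'"
  shows "lateral_hat x2 (\<lambda>k. w k - w' k) p = lateral_hat x2 w p - lateral_hat x2 w' p"
proof -
  obtain k1 t where p: "p = (k1, t)" by force
  have "integrable lborel (\<lambda>k. cis (k * x2 - k\<^sup>2 * t) * w (k1, k))" "integrable lborel (\<lambda>k. cis (k * x2 - k\<^sup>2 * t) * w' (k1, k))"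
    by (intro integrable_cis_mult truncated_integrable truncated_section assms; measurable)+
  then show ?thesis unfolding lateral_hat_def p
    by (simp add: right_diff_distrib Bochner_Integration.integral_diff diff_divide_distrib)
qed

lemma lateral_diff:
  assumes "truncated w" "truncated w'"
  shows "lateral x2 (\<lambda>k. w k - w' k) p = lateral x2 w p - lateral x2 w' p"
proof -
  obtain x1 t where p: "p = (x1, t)" by force
  have "integrable lborel (\<lambda>k1. cis (k1 * x1) * (cis (- (k1\<^sup>2 * t)) * lateral_hat x2 w (k1, t)))"
       "integrable lborel (\<lambda>k1. cis (k1 * x1) * (cis (- (k1\<^sup>2 * t)) * lateral_hat x2 w' (k1, t)))"
    by (intro integrable_cis_mult truncated_integrable truncated_slice_hat assms; measurable)+
  then show ?thesis unfolding lateral_def p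
    by (simp add: right_diff_distrib lateral_hat_diff[OF assms] Bochner_Integration.integral_diff diff_divide_distrib)
qed

section \<open>Pairing the trace with Schwartz functions\<close>

text \<open>On truncated functions the inverse transform has the given function as its Fourier transform in
  the distributional sense.\<close>

lemma inverse_transform_pairing:
  assumes h: "truncated h" and \<phi>: "schwartz (\<phi> :: real \<Rightarrow> complex)"
  shows "(LINT x|lborel. (of_real (1 / (2 * pi)) * (LINT k|lborel. cis (k * x) * h k)) * fourier \<phi> x) = (LINT k|lborel. h k * \<phi> k)"
proof -
  \<comment> \<open>the Schwartz function whose Fourier transform is \<open>\<phi>\<close>\<close>
  let ?\<Phi> = "\<lambda>x. inverse (of_real ((2 * pi) ^ DIM(real))) * fourier \<phi> (- x)"
  have S: "schwartz ?\<Phi>" by (intro schwartz_cmult schwartz_reflect schwartz_fourier \<phi>)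
  note [measurable] = truncated_measurable[OF h] schwartz_measurable[OF schwartz_fourier[OF \<phi>]]
  let ?f = "\<lambda>x. (of_real (1 / (2 * pi)) * (LINT k|lborel. cis (k * x) * h k)) * fourier \<phi> x"
  have [measurable]: "(\<lambda>x. LINT k|lborel. cis (k * x) * h k) \<in> borel_measurable borel"
    by (rule lborel.borel_measurable_lebesgue_integral) measurable
  have "(LINT x|lborel. ?f x) = \<bar>-1\<bar> ^ DIM(real) *\<^sub>R (LINT x|lborel. ?f (0 + (-1) *\<^sub>R x))"
    by (rule lborel_integral_affine) measurable
  also have "\<dots> = (LINT x|lborel. fourier h x * ?\<Phi> x)"
    unfolding fourier_def[of h] by (simp add: mult.commute mult.left_commute inverse_eq_divide)
  also have "\<dots> = (LINT k|lborel. h k * fourier ?\<Phi> k)"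
    by (rule fourier_multiplication[OF truncated_integrable[OF h] schwartz_integrable(1)[OF S]])
  also have "\<dots> = (LINT k|lborel. h k * \<phi> k)" unfolding schwartz_is_fourier[OF \<phi>] ..
  finally show ?thesis .
qed

text \<open>The transpose of the slices of \<open>lateral_hat\<close>, applied to a Fourier transform.\<close>

definition dual_symbol :: "real \<Rightarrow> (real \<Rightarrow> complex) \<Rightarrow> real \<Rightarrow> complex" where
  "dual_symbol x2 \<phi> k = cis (k * x2) * (of_real (1 / (2 * pi)) * fourier (\<lambda>t. of_real (cutoff t) * fourier \<phi> t) (k\<^sup>2))"

lemma schwartz_cutoff_times: "schwartz f \<Longrightarrow> schwartz (\<lambda>t. of_real (cutoff t) * f t)"
proof -
  assume f: "schwartz f"
  have "multiplier (\<lambda>t. complex_of_real (cutoff t))"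
    unfolding multiplier_def
  proof
    fix n
    have "tame rapid n (\<lambda>t. complex_of_real (cutoff t))" using schwartz_cutoff unfolding schwartz_iff_tame by blast
    moreover have "rapid g \<Longrightarrow> poly_bounded g" for g :: "real \<Rightarrow> complex"
      unfolding rapid_def poly_bounded_def by (metis mult_1 mult.right_neutral power_0)
    ultimately show "tame poly_bounded n (\<lambda>t. complex_of_real (cutoff t))"
      unfolding tame_iff_iter_deriv by blast
  qed
  then show ?thesis by (rule multiplier_times_schwartz[OF _ f])
qed

lemma lateral_hat_pairing:
  assumes w: "truncated w" and \<phi>: "schwartz \<phi>"
  shows "(LINT t|lborel. lateral_hat x2 w (k1, t) * fourier \<phi> t) = (LINT k|lborel. w (k1, k) * dual_symbol x2 \<phi> k)"
proof -
  let ?\<psi> = "\<lambda>t. of_real (cutoff t) * fourier \<phi> t"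
  let ?L = "lborel :: real measure"
  have S: "schwartz ?\<psi>" by (intro schwartz_cutoff_times schwartz_fourier \<phi>)
  have wi: "integrable lborel (\<lambda>k. w (k1, k))" by (intro truncated_integrable truncated_section w)
  have [measurable]: "w \<in> borel_measurable borel" by (rule truncated_measurable[OF w])
  have "integrable (?L \<Otimes>\<^sub>M ?L) (\<lambda>p. cis (snd p * x2 - (snd p)\<^sup>2 * fst p) * (case p of (t, k) \<Rightarrow> ?\<psi> t * w (k1, k)))"
    by (rule integrable_cis_mult[OF integrable_tensor[OF _ _ schwartz_integrable(1)[OF S] wi]])
      (simp_all add: lborel.sigma_finite_measure_axioms)
  then have i: "integrable (?L \<Otimes>\<^sub>M ?L) (\<lambda>(t, k). cis (k * x2 - k\<^sup>2 * t) * (?\<psi> t * w (k1, k)))"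
    by (simp add: case_prod_unfold)
  have "(LINT t|lborel. lateral_hat x2 w (k1, t) * fourier \<phi> t)
      = (LINT t|lborel. of_real (1 / (2 * pi)) * (LINT k|lborel. cis (k * x2 - k\<^sup>2 * t) * (?\<psi> t * w (k1, k))))"
  proof (intro Bochner_Integration.integral_cong refl)
    fix t
    have "(LINT k|lborel. cis (k * x2 - k\<^sup>2 * t) * (?\<psi> t * w (k1, k))) = ?\<psi> t * (LINT k|lborel. cis (k * x2 - k\<^sup>2 * t) * w (k1, k))"
      by (subst mult.left_commute) simp
    then show "lateral_hat x2 w (k1, t) * fourier \<phi> t = of_real (1 / (2 * pi)) * (LINT k|lborel. cis (k * x2 - k\<^sup>2 * t) * (?\<psi> t * w (k1, k)))"
      unfolding lateral_hat_def by simp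
  qed
  also have "\<dots> = of_real (1 / (2 * pi)) * (LINT t|lborel. LINT k|lborel. cis (k * x2 - k\<^sup>2 * t) * (?\<psi> t * w (k1, k)))"
    by (simp only: integral_mult_right_zero)
  also have "(LINT t|lborel. LINT k|lborel. cis (k * x2 - k\<^sup>2 * t) * (?\<psi> t * w (k1, k)))
      = (LINT k|lborel. LINT t|lborel. cis (k * x2 - k\<^sup>2 * t) * (?\<psi> t * w (k1, k)))"
    by (rule lborel_pair.Fubini_integral[OF i, symmetric])
  also have "\<dots> = (LINT k|lborel. w (k1, k) * (cis (k * x2) * fourier ?\<psi> (k\<^sup>2)))"
  proof (intro Bochner_Integration.integral_cong refl)
    fix k
    have "cis (k * x2 - k\<^sup>2 * t) * (?\<psi> t * w (k1, k)) = (w (k1, k) * cis (k * x2)) * (cis (- (k\<^sup>2 * t)) * ?\<psi> t)" for t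
    proof -
      have "cis (k * x2 - k\<^sup>2 * t) = cis (k * x2) * cis (- (k\<^sup>2 * t))" by (simp add: cis_mult)
      then show ?thesis by (simp only: mult_ac)
    qed
    then show "(LINT t|lborel. cis (k * x2 - k\<^sup>2 * t) * (?\<psi> t * w (k1, k))) = w (k1, k) * (cis (k * x2) * fourier ?\<psi> (k\<^sup>2))"
      unfolding fourier_def[of ?\<psi>] by (simp only: integral_mult_right_zero inner_real_def mult.assoc)
  qed
  also have "of_real (1 / (2 * pi)) * (LINT k|lborel. w (k1, k) * (cis (k * x2) * fourier ?\<psi> (k\<^sup>2)))
      = (LINT k|lborel. w (k1, k) * dual_symbol x2 \<phi> k)"
    unfolding dual_symbol_def integral_mult_right_zero[symmetric]
    by (intro Bochner_Integration.integral_cong refl) (simp only: mult_ac)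
  finally show ?thesis .
qed

text \<open>The form in which dominated convergence is applied to each pairing below.\<close>

lemma L2_dominated_pairing:
  fixes F :: "nat \<Rightarrow> 'a \<Rightarrow> complex"
  assumes [measurable]: "\<And>n. F n \<in> borel_measurable M" "G \<in> borel_measurable M" "D \<in> borel_measurable M" "\<psi> \<in> borel_measurable M"
    and D: "(\<integral>\<^sup>+x. ennreal ((D x)\<^sup>2) \<partial>M) < \<infinity>" and \<psi>: "(\<integral>\<^sup>+x. ennreal ((norm (\<psi> x))\<^sup>2) \<partial>M) < \<infinity>"
    and lim: "AE x in M. (\<lambda>n. F n x) \<longlonglongrightarrow> G x \<and> (\<forall>n. norm (F n x) \<le> D x) \<and> norm (G x) \<le> (D x :: real)"
  shows "integrable M (\<lambda>x. G x * \<psi> x)" "(\<lambda>n. LINT x|M. F n x * \<psi> x) \<longlonglongrightarrow> (LINT x|M. G x * (\<psi> x :: complex))"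
proof -
  have b: "AE x in M. norm (G x) \<le> D x" using lim by eventually_elim simp
  show "integrable M (\<lambda>x. G x * \<psi> x)"
    by (rule L2_mult_integrable(2)[OF _ _ _ _ D \<psi> b]) auto
  show "(\<lambda>n. LINT x|M. F n x * \<psi> x) \<longlonglongrightarrow> (LINT x|M. G x * \<psi> x)"
  proof (rule integral_dominated_convergence)
    show "integrable M (\<lambda>x. D x * norm (\<psi> x))"
      by (rule L2_mult_integrable(1)[OF _ _ _ _ D \<psi> b]) auto
    show "AE x in M. (\<lambda>n. F n x * \<psi> x) \<longlonglongrightarrow> G x * \<psi> x"
      using lim by eventually_elim (auto intro!: tendsto_intros)
    show "AE x in M. norm (F n x * \<psi> x) \<le> D x * norm (\<psi> x)" for n
      using lim by eventually_elim (auto simp: norm_mult intro!: mult_right_mono)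
  qed measurable
qed

text \<open>The truncation levels are chosen so large that the remainders decrease geometrically.\<close>

lemma truncation_sequence:
  fixes v :: "'a::euclidean_space \<Rightarrow> complex"
  assumes [measurable]: "v \<in> borel_measurable borel" and fin: "energy v < \<infinity>"
  shows "\<exists>vs. (\<forall>n. truncated (vs n)) \<and> (\<forall>n k. norm (vs n k) \<le> norm (v k)) \<and> (\<forall>k. (\<lambda>n. vs n k) \<longlonglongrightarrow> v k) \<and>
    (\<forall>n. energy (\<lambda>k. vs (Suc n) k - vs n k) \<le> ennreal (4 / 8 ^ n))"
proof -
  define tr where "tr N k = (if norm k \<le> real N \<and> norm (v k) \<le> real N then v k else 0)" for N k
  have [measurable]: "tr N \<in> borel_measurable borel" for N unfolding tr_def by measurable
  have tt: "truncated (tr N)" for N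
    unfolding truncated_def
  proof (rule conjI, measurable, rule exI[of _ "real N"], intro allI)
    fix k show "norm (tr N k) \<le> real N \<and> (norm k > real N \<longrightarrow> tr N k = 0)" by (simp add: tr_def)
  qed
  have ev: "\<forall>\<^sub>F N in sequentially. tr N k = v k" for k
    using eventually_ge_at_top[of "nat \<lceil>max (norm k) (norm (v k))\<rceil>"]
  proof eventually_elim
    case (elim N)
    then have "max (norm k) (norm (v k)) \<le> real N" by linarith
    then show ?case unfolding tr_def by simp
  qed
  have i: "integrable lborel (\<lambda>k. (norm (v k))\<^sup>2)"
    by (rule integrableI_bounded) (use fin in auto)
  have "(\<lambda>N. LINT k|lborel. (norm (v k - tr N k))\<^sup>2) \<longlonglongrightarrow> (LINT k::'a|lborel. 0)"
  proof (rule integral_dominated_convergence[OF _ _ i])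
    show "AE k in lborel. (\<lambda>N. (norm (v k - tr N k))\<^sup>2) \<longlonglongrightarrow> 0"
    proof (rule AE_I2)
      fix k show "(\<lambda>N. (norm (v k - tr N k))\<^sup>2) \<longlonglongrightarrow> 0"
        by (rule tendsto_eventually) (use ev[of k] in eventually_elim, simp)
    qed
    show "AE k in lborel. norm ((norm (v k - tr N k))\<^sup>2) \<le> (norm (v k))\<^sup>2" for N
      by (rule AE_I2) (simp add: tr_def)
  qed auto
  then have E: "(\<lambda>N. LINT k|lborel. (norm (v k - tr N k))\<^sup>2) \<longlonglongrightarrow> 0" by simp
  \<comment> \<open>\<open>n \<le> N\<close> keeps the pointwise convergence along the chosen levels\<close>
  have "\<exists>N\<ge>n. (LINT k|lborel. (norm (v k - tr N k))\<^sup>2) \<le> 1 / 8 ^ n" for n :: nat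
  proof -
    have "\<forall>\<^sub>F N in sequentially. (LINT k|lborel. (norm (v k - tr N k))\<^sup>2) < 1 / 8 ^ n"
      using order_tendstoD(2)[OF E, of "1 / 8 ^ n"] by simp
    then have "\<forall>\<^sub>F N in sequentially. (LINT k|lborel. (norm (v k - tr N k))\<^sup>2) < 1 / 8 ^ n \<and> n \<le> N"
      using eventually_ge_at_top[of n] by eventually_elim simp
    then show ?thesis by (auto simp: eventually_sequentially intro: less_imp_le)
  qed
  then obtain r where r: "\<And>n. r n \<ge> n" "\<And>n. (LINT k|lborel. (norm (v k - tr (r n) k))\<^sup>2) \<le> 1 / 8 ^ n" by metis
  have nE: "energy (\<lambda>k. v k - tr (r n) k) \<le> ennreal (1 / 8 ^ n)" for n
  proof -
    have "integrable lborel (\<lambda>k. (norm (v k - tr (r n) k))\<^sup>2)"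
      by (rule Bochner_Integration.integrable_bound[OF i]) (measurable, auto simp: tr_def)
    then have "energy (\<lambda>k. v k - tr (r n) k) = ennreal (LINT k|lborel. (norm (v k - tr (r n) k))\<^sup>2)"
      by (rule nn_integral_eq_integral) auto
    then show ?thesis using r(2)[of n] by (simp add: ennreal_leI)
  qed
  have "energy (\<lambda>k. tr (r (Suc n)) k - tr (r n) k) \<le> ennreal (4 / 8 ^ n)" for n
  proof -
    have "ennreal ((norm (tr (r (Suc n)) k - tr (r n) k))\<^sup>2)
        \<le> 2 * ennreal ((norm (v k - tr (r n) k))\<^sup>2) + 2 * ennreal ((norm (v k - tr (r (Suc n)) k))\<^sup>2)" for k
    proof -
      let ?a = "norm (v k - tr (r n) k)" and ?b = "norm (v k - tr (r (Suc n)) k)"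
      have "norm (tr (r (Suc n)) k - tr (r n) k) \<le> ?a + ?b"
        using norm_triangle_ineq4[of "v k - tr (r n) k" "v k - tr (r (Suc n)) k"] by simp
      then have "(norm (tr (r (Suc n)) k - tr (r n) k))\<^sup>2 \<le> (?a + ?b)\<^sup>2" by (rule power_mono) simp
      also have "\<dots> \<le> 2 * ?a\<^sup>2 + 2 * ?b\<^sup>2" using sum_squares_bound[of ?a ?b] by (simp add: power2_sum)
      finally have "ennreal ((norm (tr (r (Suc n)) k - tr (r n) k))\<^sup>2) \<le> ennreal (2 * ?a\<^sup>2 + 2 * ?b\<^sup>2)" by (rule ennreal_leI)
      also have "\<dots> = 2 * ennreal (?a\<^sup>2) + 2 * ennreal (?b\<^sup>2)" by (simp add: ennreal_mult)
      finally show ?thesis .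
    qed
    then have "energy (\<lambda>k. tr (r (Suc n)) k - tr (r n) k)
      \<le> (\<integral>\<^sup>+k. 2 * ennreal ((norm (v k - tr (r n) k))\<^sup>2) + 2 * ennreal ((norm (v k - tr (r (Suc n)) k))\<^sup>2) \<partial>lborel)"
      by (intro nn_integral_mono)
    also have "\<dots> = 2 * energy (\<lambda>k. v k - tr (r n) k) + 2 * energy (\<lambda>k. v k - tr (r (Suc n)) k)"
      by (simp add: nn_integral_add nn_integral_cmult)
    also have "\<dots> \<le> 2 * ennreal (1 / 8 ^ n) + 2 * ennreal (1 / 8 ^ n)"
    proof (intro add_mono mult_left_mono nE)
      have "ennreal (1 / 8 ^ Suc n) \<le> ennreal (1 / 8 ^ n)" by (intro ennreal_leI) (simp add: field_simps)
      then show "energy (\<lambda>k. v k - tr (r (Suc n)) k) \<le> ennreal (1 / 8 ^ n)"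
        using nE[of "Suc n"] by (rule order_trans[rotated])
    qed simp_all
    also have "\<dots> = ennreal (4 / 8 ^ n)"
    proof -
      have "2 * ennreal (1 / 8 ^ n) = ennreal (2 * (1 / 8 ^ n))" by (subst ennreal_mult) simp_all
      moreover have "ennreal (2 * (1 / 8 ^ n)) + ennreal (2 * (1 / 8 ^ n)) = ennreal (2 * (1 / 8 ^ n) + 2 * (1 / 8 ^ n))"
        by (rule ennreal_plus[symmetric]) simp_all
      ultimately show ?thesis by simp
    qed
    finally show ?thesis .
  qed
  moreover have "(\<lambda>n. tr (r n) k) \<longlonglongrightarrow> v k" for k
  proof (rule tendsto_eventually)
    have "filterlim r sequentially sequentially"
      by (rule filterlim_at_top_mono[OF filterlim_ident]) (use r(1) in auto)
    then show "\<forall>\<^sub>F n in sequentially. tr (r n) k = v k" by (rule eventually_compose_filterlim[OF ev])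
  qed
  moreover have "norm (tr (r n) k) \<le> norm (v k)" for n k unfolding tr_def by simp
  ultimately show ?thesis using tt by (intro exI[of _ "\<lambda>n. tr (r n)"]) blast
qed

text \<open>The Fourier transform in time of a slice of the trace multiplied by the cutoff: the frequency
  \<open>- k\<^sup>2\<close> is replaced by the transform of the cutoff centred there.\<close>

definition profile :: "real \<Rightarrow> (real \<Rightarrow> complex) \<Rightarrow> real \<Rightarrow> complex" where
  "profile x2 w \<tau> = of_real (1 / (2 * pi)) *
     (LINT k|lborel. fourier (\<lambda>t. of_real (cutoff t)) (\<tau> + k\<^sup>2) * (cis (k * x2) * w k))"

abbreviation cutoff_hat :: "real \<Rightarrow> complex" where
  "cutoff_hat \<equiv> fourier (\<lambda>t. complex_of_real (cutoff t))"

lemma cutoff_hat_measurable [measurable]: "cutoff_hat \<in> borel_measurable borel"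
  by (rule schwartz_measurable[OF schwartz_fourier[OF schwartz_cutoff]])

lemma profile_measurable [measurable]:
  assumes [measurable]: "w \<in> borel_measurable borel"
  shows "profile x2 w \<in> borel_measurable borel"
proof -
  have "(\<lambda>\<tau>. LINT k|lborel. cutoff_hat (\<tau> + k\<^sup>2) * (cis (k * x2) * w k)) \<in> borel_measurable borel"
    by (rule lborel.borel_measurable_lebesgue_integral) (simp only: case_prod_unfold, measurable)
  then show ?thesis unfolding profile_def by measurable
qed

lemma fourier_cutoff_product:
  assumes \<phi>: "schwartz \<phi>"
  shows "fourier (\<lambda>t. of_real (cutoff t) * fourier \<phi> t) \<xi> = (LINT \<tau>|lborel. \<phi> \<tau> * cutoff_hat (\<tau> + \<xi>))"
proof -
  let ?g = "\<lambda>t. cis (- (\<xi> * t)) * complex_of_real (cutoff t)"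
  have g: "integrable lborel ?g" by (intro integrable_cis_mult schwartz_integrable schwartz_cutoff) simp
  have "fourier ?g \<tau> = cutoff_hat (\<tau> + \<xi>)" for \<tau>
    unfolding fourier_def by (simp add: mult.assoc[symmetric] cis_mult distrib_right)
  moreover have "(LINT t|lborel. fourier \<phi> t * ?g t) = (LINT \<tau>|lborel. \<phi> \<tau> * fourier ?g \<tau>)"
    by (rule fourier_multiplication[OF schwartz_integrable(1)[OF \<phi>] g])
  moreover have "fourier (\<lambda>t. of_real (cutoff t) * fourier \<phi> t) \<xi> = (LINT t|lborel. fourier \<phi> t * ?g t)"
    unfolding fourier_def[of "\<lambda>t. of_real (cutoff t) * fourier \<phi> t"]
    by (intro Bochner_Integration.integral_cong refl) (simp add: mult_ac)
  ultimately show ?thesis by simp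
qed

lemma dual_symbol_L2:
  assumes \<phi>: "schwartz \<phi>"
  shows "dual_symbol x2 \<phi> \<in> borel_measurable borel" "energy (\<lambda>k. dual_symbol x2 \<phi> k) < \<infinity>"
proof -
  let ?f = "fourier (\<lambda>t. of_real (cutoff t) * fourier \<phi> t)"
  have S: "schwartz ?f" by (intro schwartz_fourier schwartz_cutoff_times \<phi>)
  note [measurable] = schwartz_measurable[OF S]
  show "dual_symbol x2 \<phi> \<in> borel_measurable borel" unfolding dual_symbol_def by measurable
  obtain C where C0: "C > 0" and C: "\<And>\<xi>. norm (?f \<xi>) \<le> C / (1 + \<xi>\<^sup>2)" using schwartz_inverse_square[OF S] by blast
  have "(norm (dual_symbol x2 \<phi> k))\<^sup>2 \<le> C\<^sup>2 * (1 / (1 + (0 + k\<^sup>2)\<^sup>2))" for k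
  proof -
    define D where "D = 1 + (k\<^sup>2)\<^sup>2"
    have D: "D \<ge> 1" unfolding D_def by simp
    have "norm (dual_symbol x2 \<phi> k) = 1 / (2 * pi) * norm (?f (k\<^sup>2))" unfolding dual_symbol_def by (simp add: norm_mult norm_divide)
    also have "\<dots> \<le> 1 * norm (?f (k\<^sup>2))" using pi_gt3 by (intro mult_right_mono) auto
    also have "\<dots> \<le> C / D" using C[of "k\<^sup>2"] unfolding D_def by simp
    finally have "(norm (dual_symbol x2 \<phi> k))\<^sup>2 \<le> (C / D)\<^sup>2" by (rule power_mono) simp
    also have "\<dots> = C\<^sup>2 * (1 / D\<^sup>2)" by (simp add: power_divide)
    also have "\<dots> \<le> C\<^sup>2 * (1 / D)"
      using D self_le_power[of D 2] by (intro mult_left_mono divide_left_mono) auto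
    finally show ?thesis unfolding D_def by simp
  qed
  then have "energy (\<lambda>k. dual_symbol x2 \<phi> k) \<le> (\<integral>\<^sup>+k. ennreal (C\<^sup>2) * ennreal (1 / (1 + (0 + k\<^sup>2)\<^sup>2)) \<partial>lborel)"
    by (intro nn_integral_mono) (subst ennreal_mult[symmetric], simp_all add: ennreal_leI)
  also have "\<dots> = ennreal (C\<^sup>2) * (\<integral>\<^sup>+k. ennreal (1 / (1 + (0 + k\<^sup>2)\<^sup>2)) \<partial>lborel)"
    by (rule nn_integral_cmult) measurable
  also have "\<dots> \<le> ennreal (C\<^sup>2) * ennreal kernel_mass"
    by (intro mult_left_mono unweighted_kernel_integral_bound) simp
  also have "\<dots> < \<infinity>" by (simp add: ennreal_mult_less_top)
  finally show "energy (\<lambda>k. dual_symbol x2 \<phi> k) < \<infinity>" .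
qed

text \<open>Fubini's theorem in \<open>\<tau>\<close> and \<open>k\<close>.  It applies to every square integrable \<open>w\<close>, since the transform of the cutoff is
  dominated by a kernel that is square integrable in \<open>k\<close> uniformly in \<open>\<tau>\<close>.\<close>

lemma profile_pairing:
  assumes [measurable]: "w \<in> borel_measurable borel" and fin: "energy w < \<infinity>"
    and \<phi>: "schwartz \<phi>"
  shows "integrable lborel (\<lambda>\<tau>. profile x2 w \<tau> * \<phi> \<tau>)"
    "(LINT \<tau>|lborel. profile x2 w \<tau> * \<phi> \<tau>) = (LINT k|lborel. w k * dual_symbol x2 \<phi> k)"
proof -
  note [measurable] = schwartz_measurable[OF \<phi>]
  define Q where "Q p = \<phi> (fst p) * (of_real (1 / (2 * pi)) * (cutoff_hat (fst p + (snd p)\<^sup>2) * (cis (snd p * x2) * w (snd p))))" for p :: "real \<times> real"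
  obtain C where C0: "C > 0" and C: "\<And>\<xi>. norm (cutoff_hat \<xi>) \<le> C / (1 + \<xi>\<^sup>2)"
    using schwartz_inverse_square[OF schwartz_fourier[OF schwartz_cutoff]] by blast
  have [measurable]: "Q \<in> borel_measurable (lborel \<Otimes>\<^sub>M lborel)" unfolding Q_def by measurable
  have Qi: "integrable (lborel \<Otimes>\<^sub>M lborel) Q"
  proof (rule integrableI_bounded)
    have pt: "norm (Q (\<tau>, k)) \<le> norm (\<phi> \<tau>) * (C * (1 / (1 + (\<tau> + k\<^sup>2)\<^sup>2) + (norm (w k))\<^sup>2))" for \<tau> k
    proof -
      define J where "J = 1 / (1 + (\<tau> + k\<^sup>2)\<^sup>2)"
      have J: "0 \<le> J" "J \<le> 1" unfolding J_def by (simp, subst divide_le_eq_1_pos) (auto simp: add_pos_nonneg)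
      have "norm (Q (\<tau>, k)) = norm (\<phi> \<tau>) * ((1 / (2 * pi)) * (norm (cutoff_hat (\<tau> + k\<^sup>2)) * norm (w k)))"
        unfolding Q_def by (simp add: norm_mult norm_divide)
      also have "\<dots> \<le> norm (\<phi> \<tau>) * (1 * ((C * J) * norm (w k)))"
      proof (intro mult_left_mono[OF _ norm_ge_zero] mult_mono mult_right_mono)
        show "1 / (2 * pi) \<le> 1" using pi_gt3 by simp
        show "norm (cutoff_hat (\<tau> + k\<^sup>2)) \<le> C * J" unfolding J_def using C[of "\<tau> + k\<^sup>2"] by simp
      qed (use C0 J in auto)
      also have "\<dots> = norm (\<phi> \<tau>) * (C * (J * norm (w k)))" by simp
      also have "\<dots> \<le> norm (\<phi> \<tau>) * (C * (J + (norm (w k))\<^sup>2))"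
      proof (intro mult_left_mono norm_ge_zero)
        have "2 * J * norm (w k) \<le> J\<^sup>2 + (norm (w k))\<^sup>2" by (rule sum_squares_bound)
        moreover have "J\<^sup>2 \<le> J" using J by (simp add: power2_eq_square mult_left_le)
        moreover have "0 \<le> J * norm (w k)" using J by simp
        ultimately show "J * norm (w k) \<le> J + (norm (w k))\<^sup>2" by linarith
      qed (use C0 in simp)
      finally show ?thesis unfolding J_def .
    qed
    define B where "B = ennreal C * (ennreal kernel_mass + energy w)"
    have B: "B < \<infinity>" unfolding B_def using fin by (simp add: ennreal_mult_less_top)
    have "(\<integral>\<^sup>+p. ennreal (norm (Q p)) \<partial>(lborel \<Otimes>\<^sub>M lborel)) = (\<integral>\<^sup>+\<tau>. \<integral>\<^sup>+k. ennreal (norm (Q (\<tau>, k))) \<partial>lborel \<partial>lborel)"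
      by (rule lborel.nn_integral_fst[symmetric]) measurable
    also have "\<dots> \<le> (\<integral>\<^sup>+\<tau>. ennreal (norm (\<phi> \<tau>)) * B \<partial>lborel)"
    proof (intro nn_integral_mono)
      fix \<tau>
      have "(\<integral>\<^sup>+k. ennreal (norm (Q (\<tau>, k))) \<partial>lborel)
         \<le> (\<integral>\<^sup>+k. ennreal (norm (\<phi> \<tau>)) * (ennreal C * (ennreal (1 / (1 + (\<tau> + k\<^sup>2)\<^sup>2)) + ennreal ((norm (w k))\<^sup>2))) \<partial>lborel)"
      proof (intro nn_integral_mono)
        fix k
        have "ennreal (norm (Q (\<tau>, k))) \<le> ennreal (norm (\<phi> \<tau>) * (C * (1 / (1 + (\<tau> + k\<^sup>2)\<^sup>2) + (norm (w k))\<^sup>2)))"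
          by (rule ennreal_leI[OF pt])
        also have "\<dots> = ennreal (norm (\<phi> \<tau>)) * (ennreal C * (ennreal (1 / (1 + (\<tau> + k\<^sup>2)\<^sup>2)) + ennreal ((norm (w k))\<^sup>2)))"
          using C0 by (subst ennreal_plus[symmetric], simp, simp, subst ennreal_mult[symmetric], simp, simp, subst ennreal_mult[symmetric]) simp_all
        finally show "ennreal (norm (Q (\<tau>, k))) \<le> ennreal (norm (\<phi> \<tau>)) * (ennreal C * (ennreal (1 / (1 + (\<tau> + k\<^sup>2)\<^sup>2)) + ennreal ((norm (w k))\<^sup>2)))" .
      qed
      also have "\<dots> = ennreal (norm (\<phi> \<tau>)) * (ennreal C * ((\<integral>\<^sup>+k. ennreal (1 / (1 + (\<tau> + k\<^sup>2)\<^sup>2)) \<partial>lborel) + energy w))"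
        by (simp add: nn_integral_cmult nn_integral_add)
      also have "\<dots> \<le> ennreal (norm (\<phi> \<tau>)) * B" unfolding B_def
        by (intro mult_left_mono add_mono unweighted_kernel_integral_bound order_refl) simp_all
      finally show "(\<integral>\<^sup>+k. ennreal (norm (Q (\<tau>, k))) \<partial>lborel) \<le> ennreal (norm (\<phi> \<tau>)) * B" .
    qed
    also have "\<dots> = (\<integral>\<^sup>+\<tau>. ennreal (norm (\<phi> \<tau>)) \<partial>lborel) * B" by (rule nn_integral_multc) measurable
    also have "\<dots> < \<infinity>"
      using B schwartz_integrable(1)[OF \<phi>] unfolding integrable_iff_bounded by (simp add: ennreal_mult_less_top)
    finally show "(\<integral>\<^sup>+p. ennreal (norm (Q p)) \<partial>(lborel \<Otimes>\<^sub>M lborel)) < \<infinity>" .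
  qed measurable
  have row: "(LINT k|lborel. Q (\<tau>, k)) = profile x2 w \<tau> * \<phi> \<tau>" for \<tau>
    unfolding Q_def profile_def fst_conv snd_conv integral_mult_right_zero by (simp only: mult_ac)
  have col: "(LINT \<tau>|lborel. Q (\<tau>, k)) = w k * dual_symbol x2 \<phi> k" for k
  proof -
    have "Q (\<tau>, k) = (w k * (cis (k * x2) * of_real (1 / (2 * pi)))) * (\<phi> \<tau> * cutoff_hat (\<tau> + k\<^sup>2))" for \<tau>
      unfolding Q_def by (simp only: fst_conv snd_conv mult_ac)
    then show ?thesis unfolding dual_symbol_def fourier_cutoff_product[OF \<phi>] by (simp only: integral_mult_right_zero mult.assoc)
  qed
  have Qi': "integrable (lborel \<Otimes>\<^sub>M lborel) (\<lambda>(\<tau>, k). Q (\<tau>, k))" using Qi by (simp add: case_prod_unfold)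
  show "integrable lborel (\<lambda>\<tau>. profile x2 w \<tau> * \<phi> \<tau>)"
    using lborel_pair.integrable_fst[OF Qi'] by (simp only: row)
  show "(LINT \<tau>|lborel. profile x2 w \<tau> * \<phi> \<tau>) = (LINT k|lborel. w k * dual_symbol x2 \<phi> k)"
    using lborel_pair.Fubini_integral[OF Qi'] by (simp only: row col)
qed

text \<open>For these times the cutoff is 1, and the iterated integrals are one integral over the plane.\<close>

lemma lateral_eq_kernel_integral:
  assumes w: "truncated w" and t: "0 \<le> t" "t \<le> 1"
  shows "lateral x2 w (x1, t) = of_real (1 / (2 * pi)\<^sup>2) * (LINT k|lborel. schroedinger_kernel k x1 x2 t * w k)"
proof -
  have [measurable]: "w \<in> borel_measurable borel" by (rule truncated_measurable[OF w])
  have ker: "schroedinger_kernel k x1 x2 t = cis (fst k * x1) * (cis (- ((fst k)\<^sup>2 * t)) * cis (snd k * x2 - (snd k)\<^sup>2 * t))" for k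
    unfolding schroedinger_kernel_def by (simp add: case_prod_unfold cis_mult algebra_simps)
  have "integrable lborel (\<lambda>k. cis (fst k * x1 + snd k * x2 - ((fst k)\<^sup>2 + (snd k)\<^sup>2) * t) * w k)"
    by (rule integrable_cis_mult[OF truncated_integrable[OF w]]) (simp add: borel_prod[symmetric])
  then have i: "integrable (lborel \<Otimes>\<^sub>M lborel) (\<lambda>k. schroedinger_kernel k x1 x2 t * w k)"
    unfolding schroedinger_kernel_def lborel_prod by (simp add: case_prod_unfold)
  have "(LINT k|lborel. schroedinger_kernel k x1 x2 t * w k) = (LINT k1|lborel. LINT k2|lborel. schroedinger_kernel (k1, k2) x1 x2 t * w (k1, k2))"
    using lborel_pair.integral_fst'[OF i] by (simp add: lborel_prod)
  also have "\<dots> = (LINT k1|lborel. cis (k1 * x1) * (cis (- (k1\<^sup>2 * t)) * (LINT k2|lborel. cis (k2 * x2 - k2\<^sup>2 * t) * w (k1, k2))))"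
    unfolding ker fst_conv snd_conv mult.assoc integral_mult_right_zero ..
  finally have e: "(LINT k|lborel. schroedinger_kernel k x1 x2 t * w k) = \<dots>" .
  have "lateral x2 w (x1, t) = of_real (1 / (2 * pi)) * (LINT k1|lborel. of_real (1 / (2 * pi)) * (cis (k1 * x1) * (cis (- (k1\<^sup>2 * t)) * (LINT k2|lborel. cis (k2 * x2 - k2\<^sup>2 * t) * w (k1, k2)))))"
    unfolding lateral_def lateral_hat_def using cutoff_eq_1[OF t] by (simp add: mult.left_commute)
  also have "\<dots> = of_real (1 / (2 * pi)) * (of_real (1 / (2 * pi)) * (LINT k|lborel. schroedinger_kernel k x1 x2 t * w k))"
    unfolding e by (simp only: integral_mult_right_zero)
  also have "\<dots> = of_real (1 / (2 * pi)\<^sup>2) * (LINT k|lborel. schroedinger_kernel k x1 x2 t * w k)"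
    by (simp add: power2_eq_square)
  finally show ?thesis .
qed

lemma lateral_pairing:
  assumes w: "truncated w" and \<phi>: "schwartz \<phi>" and supp: "\<And>x t. \<phi> (x, t) \<noteq> 0 \<Longrightarrow> 0 \<le> t \<and> t \<le> 1"
  shows "(LINT p|lborel. lateral x2 w p * \<phi> p)
    = of_real (1 / (2 * pi)\<^sup>2) * (LINT k|lborel. w k * (LINT p|lborel. schroedinger_kernel k (fst p) x2 (snd p) * \<phi> p))"
proof -
  let ?L = "lborel :: (real \<times> real) measure"
  have [measurable]: "w \<in> borel_measurable borel" by (rule truncated_measurable[OF w])
  define \<theta> where "\<theta> k p = fst k * fst p + snd k * x2 - ((fst k)\<^sup>2 + (snd k)\<^sup>2) * snd p" for k p :: "real \<times> real"
  have ker: "schroedinger_kernel k (fst p) x2 (snd p) = cis (\<theta> k p)" for k p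
    unfolding schroedinger_kernel_def \<theta>_def by (simp add: case_prod_unfold)
  have "continuous_on UNIV (\<lambda>q :: (real \<times> real) \<times> (real \<times> real). \<theta> (snd q) (fst q))"
    unfolding \<theta>_def by (intro continuous_intros)
  then have tm: "(\<lambda>q. \<theta> (snd q) (fst q)) \<in> borel_measurable (?L \<Otimes>\<^sub>M ?L)"
    by (simp add: lborel_prod borel_measurable_continuous_onI)
  have "integrable (?L \<Otimes>\<^sub>M ?L) (\<lambda>q. cis (\<theta> (snd q) (fst q)) * (case q of (p, k) \<Rightarrow> \<phi> p * w k))"
    by (rule integrable_cis_mult[OF integrable_tensor[OF _ _ schwartz_integrable(1)[OF \<phi>] truncated_integrable[OF w]] tm])
      (simp_all add: lborel.sigma_finite_measure_axioms)
  then have i: "integrable (?L \<Otimes>\<^sub>M ?L) (\<lambda>(p, k). cis (\<theta> k p) * (\<phi> p * w k))"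
    by (simp add: case_prod_unfold)
  have "(LINT p|lborel. lateral x2 w p * \<phi> p) = (LINT p|lborel. of_real (1 / (2 * pi)\<^sup>2) * (LINT k|lborel. cis (\<theta> k p) * (\<phi> p * w k)))"
  proof (intro Bochner_Integration.integral_cong refl)
    fix p :: "real \<times> real"
    obtain x1 t where p: "p = (x1, t)" by force
    have "(LINT k|lborel. cis (\<theta> k p) * (\<phi> p * w k)) = \<phi> p * (LINT k|lborel. schroedinger_kernel k x1 x2 t * w k)"
      using ker[of _ p] unfolding p by (simp add: mult.left_commute[of _ "\<phi> _"])
    then show "lateral x2 w p * \<phi> p = of_real (1 / (2 * pi)\<^sup>2) * (LINT k|lborel. cis (\<theta> k p) * (\<phi> p * w k))"
      using lateral_eq_kernel_integral[OF w, of t x2 x1] supp[of x1 t] unfolding p by (cases "\<phi> (x1, t) = 0") auto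
  qed
  also have "\<dots> = of_real (1 / (2 * pi)\<^sup>2) * (LINT p|lborel. LINT k|lborel. cis (\<theta> k p) * (\<phi> p * w k))"
    by (simp only: integral_mult_right_zero)
  also have "(LINT p|lborel. LINT k|lborel. cis (\<theta> k p) * (\<phi> p * w k)) = (LINT k|lborel. LINT p|lborel. cis (\<theta> k p) * (\<phi> p * w k))"
    by (rule lborel_pair.Fubini_integral[OF i, symmetric])
  also have "\<dots> = (LINT k|lborel. w k * (LINT p|lborel. schroedinger_kernel k (fst p) x2 (snd p) * \<phi> p))"
    unfolding ker integral_mult_right_zero[symmetric] by (intro Bochner_Integration.integral_cong refl) (simp only: mult_ac)
  finally show ?thesis .
qed

text \<open>The kernel turns \<open>\<phi>\<close> into its Fourier transform at \<open>(- k\<^sub>1, |k|\<^sup>2)\<close>, which decays at least like the inverse of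
  \<open>1 + |k|\<^sup>2\<close>.\<close>

lemma kernel_symbol_L2:
  fixes x2 :: real
  assumes \<phi>: "schwartz (\<phi> :: real \<times> real \<Rightarrow> complex)"
  defines "K \<equiv> \<lambda>k. LINT p|lborel. schroedinger_kernel k (fst p) x2 (snd p) * \<phi> p"
  shows "K \<in> borel_measurable borel" "energy K < \<infinity>"
proof -
  have K: "K k = cis (snd k * x2) * fourier \<phi> (- fst k, (norm k)\<^sup>2)" for k
  proof -
    obtain k1 k2 where k: "k = (k1, k2)" by force
    have "schroedinger_kernel k (fst p) x2 (snd p) * \<phi> p = cis (snd k * x2) * (cis (- ((- fst k, (norm k)\<^sup>2) \<bullet> p)) * \<phi> p)" for p
    proof -
      have n: "(norm k)\<^sup>2 = k1\<^sup>2 + k2\<^sup>2" unfolding k by (simp add: norm_Pair)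
      have "k1 * fst p + k2 * x2 - (k1\<^sup>2 + k2\<^sup>2) * snd p = snd k * x2 + - ((- fst k, (norm k)\<^sup>2) \<bullet> p)"
        unfolding n unfolding k inner_prod_def by simp
      then have "schroedinger_kernel k (fst p) x2 (snd p) = cis (snd k * x2) * cis (- ((- fst k, (norm k)\<^sup>2) \<bullet> p))"
        unfolding schroedinger_kernel_def k by (simp only: prod.case cis_mult)
      then show ?thesis by (simp only: mult.assoc)
    qed
    then show ?thesis unfolding K_def fourier_def by (simp only: integral_mult_right_zero)
  qed
  note [measurable] = schwartz_measurable[OF schwartz_fourier[OF \<phi>]]
  have "(\<lambda>k :: real \<times> real. (- fst k, (norm k)\<^sup>2)) \<in> borel_measurable borel"
    by (intro borel_measurable_continuous_onI continuous_intros)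
  from measurable_compose[OF this schwartz_measurable[OF schwartz_fourier[OF \<phi>]]]
  have [measurable]: "(\<lambda>k :: real \<times> real. fourier \<phi> (- fst k, (norm k)\<^sup>2)) \<in> borel_measurable borel" .
  have [measurable]: "(\<lambda>k :: real \<times> real. cis (snd k * x2)) \<in> borel_measurable borel"
    by (intro borel_measurable_continuous_onI continuous_intros)
  have "K = (\<lambda>k. cis (snd k * x2) * fourier \<phi> (- fst k, (norm k)\<^sup>2))" by (rule ext) (rule K)
  then show "K \<in> borel_measurable borel" by (rule ssubst) measurable
  obtain C where C: "\<And>\<xi>. (1 + norm \<xi>) ^ 1 * norm (fourier \<phi> \<xi>) \<le> C" using schwartz_rapid[OF schwartz_fourier[OF \<phi>]] by blast
  have C0: "0 \<le> C" by (rule order_trans[OF _ C[of 0]]) simp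
  have Kb: "(norm (K k))\<^sup>2 \<le> (4 * C\<^sup>2) * (1 / (1 + norm k) ^ decay_order TYPE(real \<times> real))" for k
  proof -
    let ?\<xi> = "(- fst k, (norm k)\<^sup>2)"
    have x: "(norm k)\<^sup>2 \<le> norm ?\<xi>" using norm_snd_le[of "(norm k)\<^sup>2" "- fst k"] by simp
    have "(1 + norm k)\<^sup>2 \<le> 2 * (1 + (norm k)\<^sup>2)"
      using sum_squares_bound[of 1 "norm k"] by (simp add: power2_sum)
    also have "\<dots> \<le> 2 * (1 + norm ?\<xi>)" using x by simp
    finally have y: "(1 + norm k)\<^sup>2 \<le> 2 * (1 + norm ?\<xi>)" .
    have "(1 + norm k)\<^sup>2 * norm (K k) \<le> 2 * (1 + norm ?\<xi>) * norm (fourier \<phi> ?\<xi>)"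
      unfolding K norm_mult norm_cis mult_1 by (intro mult_right_mono y) simp
    also have "\<dots> = 2 * ((1 + norm ?\<xi>) ^ 1 * norm (fourier \<phi> ?\<xi>))" by (simp only: power_one_right mult.assoc)
    also have "\<dots> \<le> 2 * C" by (intro mult_left_mono C) simp
    finally have "((1 + norm k)\<^sup>2 * norm (K k))\<^sup>2 \<le> (2 * C)\<^sup>2" by (rule power_mono) simp
    then have "(1 + norm k) ^ 4 * (norm (K k))\<^sup>2 \<le> 4 * C\<^sup>2"
      by (simp add: power_mult_distrib power_mult[symmetric])
    moreover have "decay_order TYPE(real \<times> real) = 4" by (simp add: decay_order_def)
    moreover have "0 < (1 + norm k) ^ 4" by (intro zero_less_power add_pos_nonneg) simp_all
    ultimately show ?thesis by (simp only: mult_1_right times_divide_eq_right pos_le_divide_eq mult.commute)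
  qed
  have "integrable lborel (\<lambda>k::real \<times> real. (4 * C\<^sup>2) * (1 / (1 + norm k) ^ decay_order TYPE(real \<times> real)))"
    by (intro integrable_mult_right integrable_decay)
  then have "(\<integral>\<^sup>+k. ennreal (norm ((4 * C\<^sup>2) * (1 / (1 + norm k) ^ decay_order TYPE(real \<times> real)))) \<partial>(lborel :: (real \<times> real) measure)) < \<infinity>"
    unfolding integrable_iff_bounded by blast
  moreover have "energy K
      \<le> (\<integral>\<^sup>+k. ennreal (norm ((4 * C\<^sup>2) * (1 / (1 + norm k) ^ decay_order TYPE(real \<times> real)))) \<partial>(lborel :: (real \<times> real) measure))"
    unfolding real_norm_def by (intro nn_integral_mono ennreal_leI order_trans[OF Kb abs_ge_self])
  ultimately show "energy K < \<infinity>" by (rule le_less_trans[rotated])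
qed

section \<open>The trace of square integrable data\<close>

text \<open>\<open>g\<close> is the trace and \<open>F\<close> its partial transform with the phase \<open>cis (k\<^sub>1\<^sup>2 t)\<close>, continued to all
  times by the cutoff.  Each identity holds for the truncated data; the bounds \<open>D\<close> and \<open>E\<close> are square integrable
  on the plane, hence on almost every slice in either direction, which is what the passage to the limit needs.\<close>

lemma lateral_limits:
  fixes v :: "real \<times> real \<Rightarrow> complex" and x2 :: real
  assumes [measurable]: "v \<in> borel_measurable borel" and fin: "energy v < \<infinity>"
  shows "\<exists>F g. F \<in> borel_measurable borel \<and> g \<in> borel_measurable borel \<and>
    energy g < \<infinity> \<and>
    (AE k1 in lborel. energy (\<lambda>t. F (k1, t)) < \<infinity> \<and>
       has_fourier (distr_of (\<lambda>t. F (k1, t))) (profile x2 (\<lambda>k. v (k1, k)))) \<and>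
    (AE t in lborel. has_fourier (distr_of (\<lambda>x. g (x, t))) (\<lambda>k1. cis (- (k1\<^sup>2 * t)) * F (k1, t))) \<and>
    (\<forall>\<phi>. schwartz \<phi> \<longrightarrow> (\<forall>x t. \<phi> (x, t) \<noteq> 0 \<longrightarrow> 0 \<le> t \<and> t \<le> 1) \<longrightarrow>
       integrable lborel (\<lambda>p. g p * \<phi> p) \<and>
       (LINT p|lborel. g p * \<phi> p)
         = of_real (1 / (2 * pi)\<^sup>2) * (LINT k|lborel. v k * (LINT p|lborel. schroedinger_kernel k (fst p) x2 (snd p) * \<phi> p)))"
proof -
  obtain vs where tr: "\<And>n. truncated (vs n)" and dom: "\<And>n k. norm (vs n k) \<le> norm (v k)"
    and lim: "\<And>k. (\<lambda>n. vs n k) \<longlonglongrightarrow> v k"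
    and step: "\<And>n. energy (\<lambda>k. vs (Suc n) k - vs n k) \<le> ennreal (4 / 8 ^ n)"
    using truncation_sequence[OF assms] by blast
  have vm [measurable]: "vs n \<in> borel_measurable borel" for n by (rule truncated_measurable[OF tr])
  obtain C where C0: "C \<ge> 0" and C: "\<And>x2 w. truncated w \<Longrightarrow> energy (lateral_hat x2 w)
     \<le> ennreal C * energy w" using lateral_hat_bound by blast
  let ?F = "\<lambda>n. lateral_hat x2 (vs n)"
  let ?g = "\<lambda>n. lateral x2 (vs n)"
  have F0: "energy (?F 0) < \<infinity>"
  proof -
    have "energy (?F 0) \<le> ennreal C * energy (vs 0)" by (rule C[OF tr])
    also have "\<dots> \<le> ennreal C * energy v"
      by (intro mult_left_mono nn_integral_mono ennreal_leI power_mono dom) auto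
    also have "\<dots> < \<infinity>" using fin by (simp add: ennreal_mult_less_top)
    finally show ?thesis .
  qed
  have Fs: "energy (\<lambda>p. ?F (Suc n) p - ?F n p) \<le> ennreal ((4 * C) / 8 ^ n)" for n
  proof -
    have "energy (\<lambda>p. ?F (Suc n) p - ?F n p) \<le> ennreal C * energy (\<lambda>k. vs (Suc n) k - vs n k)"
      using C[OF truncated_diff[OF tr tr], of x2 "Suc n" n] by (simp only: lateral_hat_diff[OF tr tr])
    also have "\<dots> \<le> ennreal C * ennreal (4 / 8 ^ n)" by (intro mult_left_mono step) simp
    also have "\<dots> = ennreal ((4 * C) / 8 ^ n)" using C0 by (subst ennreal_mult[symmetric]) (simp_all add: mult.commute)
    finally show ?thesis .
  qed
  have gs: "energy (\<lambda>p. ?g (Suc n) p - ?g n p) \<le> ennreal ((4 * C) / 8 ^ n)" for n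
    using order_trans[OF lateral_bound[OF truncated_diff[OF tr tr], of x2 "Suc n" n]] Fs[of n]
    by (simp only: lateral_diff[OF tr tr] lateral_hat_diff[OF tr tr])
  have C4: "0 \<le> 4 * C" using C0 by simp
  have Fm: "?F n \<in> borel_measurable lborel" and gm: "?g n \<in> borel_measurable lborel" for n by measurable
  obtain F D where Fm' [measurable]: "F \<in> borel_measurable borel" "D \<in> borel_measurable borel" and D: "(\<integral>\<^sup>+p. ennreal ((D p)\<^sup>2) \<partial>lborel) < \<infinity>"
    and Fl: "AE p in lborel. (\<lambda>n. ?F n p) \<longlonglongrightarrow> F p \<and> (\<forall>n. norm (?F n p) \<le> D p) \<and> norm (F p) \<le> D p"
    using fast_L2_limit[of ?F lborel, OF Fm F0 Fs C4] by auto
  obtain g E where gm' [measurable]: "g \<in> borel_measurable borel" "E \<in> borel_measurable borel" and E: "(\<integral>\<^sup>+p. ennreal ((E p)\<^sup>2) \<partial>lborel) < \<infinity>"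
    and gl: "AE p in lborel. (\<lambda>n. ?g n p) \<longlonglongrightarrow> g p \<and> (\<forall>n. norm (?g n p) \<le> E p) \<and> norm (g p) \<le> E p"
    using fast_L2_limit[of ?g lborel, OF gm le_less_trans[OF lateral_bound[OF tr] F0] gs C4] by auto
  have gfin: "energy g < \<infinity>"
  proof (rule le_less_trans[OF nn_integral_mono_AE E])
    show "AE p in lborel. ennreal ((norm (g p))\<^sup>2) \<le> ennreal ((E p)\<^sup>2)"
      using gl by eventually_elim (auto intro!: ennreal_leI power_mono)
  qed
  have "AE k1 in lborel. (\<integral>\<^sup>+t. ennreal ((D (k1, t))\<^sup>2) \<partial>lborel) < \<infinity>"
    by (rule AE_nn_integral_finite) (use D nn_integral_R2(1)[of "\<lambda>p. ennreal ((D p)\<^sup>2)"] in \<open>auto simp: less_top[symmetric]\<close>)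
  moreover have "AE k1 in lborel. energy (\<lambda>k. v (k1, k)) < \<infinity>"
    by (rule AE_nn_integral_finite) (use fin nn_integral_R2(1)[of "\<lambda>p. ennreal ((norm (v p))\<^sup>2)"] in \<open>auto simp: less_top[symmetric]\<close>)
  ultimately have R1: "AE k1 in lborel. energy (\<lambda>t. F (k1, t)) < \<infinity> \<and>
       has_fourier (distr_of (\<lambda>t. F (k1, t))) (profile x2 (\<lambda>k. v (k1, k)))"
    using AE_R2(1)[OF Fl]
  proof eventually_elim
    case (elim k1)
    have "energy (\<lambda>t. F (k1, t)) \<le> (\<integral>\<^sup>+t. ennreal ((D (k1, t))\<^sup>2) \<partial>lborel)"
    proof (rule nn_integral_mono_AE)
      show "AE t in lborel. ennreal ((norm (F (k1, t)))\<^sup>2) \<le> ennreal ((D (k1, t))\<^sup>2)"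
        using elim(3) by eventually_elim (auto intro!: ennreal_leI power_mono)
    qed
    then have fF: "energy (\<lambda>t. F (k1, t)) < \<infinity>" using elim(1) by (rule le_less_trans)
    have "has_fourier (distr_of (\<lambda>t. F (k1, t))) (profile x2 (\<lambda>k. v (k1, k)))"
      unfolding has_fourier_def
    proof (intro conjI allI impI)
      show "profile x2 (\<lambda>k. v (k1, k)) \<in> borel_measurable lborel" by measurable
      fix \<phi> :: "real \<Rightarrow> complex" assume \<phi>: "schwartz \<phi>"
      have [measurable]: "fourier \<phi> \<in> borel_measurable borel" by (rule schwartz_measurable[OF schwartz_fourier[OF \<phi>]])
      have [measurable]: "dual_symbol x2 \<phi> \<in> borel_measurable borel" by (rule dual_symbol_L2[OF \<phi>])
      have vsec: "(\<lambda>k. v (k1, k)) \<in> borel_measurable borel" by measurable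
      show "integrable lborel (\<lambda>k. profile x2 (\<lambda>k. v (k1, k)) k * \<phi> k)"
        by (rule profile_pairing(1)[OF vsec elim(2) \<phi>])
      have 1: "(\<lambda>n. LINT t|lborel. ?F n (k1, t) * fourier \<phi> t) \<longlonglongrightarrow> (LINT t|lborel. F (k1, t) * fourier \<phi> t)"
        by (rule L2_dominated_pairing(2)[OF _ _ _ _ elim(1) schwartz_L2[OF schwartz_fourier[OF \<phi>]] elim(3)]) measurable
      have 2: "(\<lambda>n. LINT k|lborel. vs n (k1, k) * dual_symbol x2 \<phi> k) \<longlonglongrightarrow> (LINT k|lborel. v (k1, k) * dual_symbol x2 \<phi> k)"
        by (rule L2_dominated_pairing(2)[where D="\<lambda>k. norm (v (k1, k))", OF _ _ _ _ elim(2) dual_symbol_L2(2)[OF \<phi>]])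
          (measurable, simp add: lim dom)
      have "(LINT t|lborel. F (k1, t) * fourier \<phi> t) = (LINT k|lborel. v (k1, k) * dual_symbol x2 \<phi> k)"
        by (rule LIMSEQ_unique[OF 1[unfolded lateral_hat_pairing[OF tr \<phi>]] 2])
      also have "\<dots> = (LINT k|lborel. profile x2 (\<lambda>k. v (k1, k)) k * \<phi> k)"
        by (rule profile_pairing(2)[OF vsec elim(2) \<phi>, symmetric])
      finally show "distr_of (\<lambda>t. F (k1, t)) (fourier \<phi>) = (LINT k|lborel. profile x2 (\<lambda>k. v (k1, k)) k * \<phi> k)"
        unfolding distr_of_def .
    qed
    then show ?case using fF by blast
  qed
  have "AE t in lborel. (\<integral>\<^sup>+k. ennreal ((D (k, t))\<^sup>2) \<partial>lborel) < \<infinity>"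
    by (rule AE_nn_integral_finite) (use D nn_integral_R2(2)[of "\<lambda>p. ennreal ((D p)\<^sup>2)"] in \<open>auto simp: less_top[symmetric]\<close>)
  moreover have "AE t in lborel. (\<integral>\<^sup>+x. ennreal ((E (x, t))\<^sup>2) \<partial>lborel) < \<infinity>"
    by (rule AE_nn_integral_finite) (use E nn_integral_R2(2)[of "\<lambda>p. ennreal ((E p)\<^sup>2)"] in \<open>auto simp: less_top[symmetric]\<close>)
  ultimately have R2: "AE t in lborel. has_fourier (distr_of (\<lambda>x. g (x, t))) (\<lambda>k1. cis (- (k1\<^sup>2 * t)) * F (k1, t))"
    using AE_R2(2)[OF Fl] AE_R2(2)[OF gl]
  proof eventually_elim
    case (elim t)
    let ?h = "\<lambda>n k1. cis (- (k1\<^sup>2 * t)) * ?F n (k1, t)"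
    \<comment> \<open>the phase of modulus 1 affects neither the convergence nor the bound\<close>
    have hl: "AE k1 in lborel. (\<lambda>n. ?h n k1) \<longlonglongrightarrow> cis (- (k1\<^sup>2 * t)) * F (k1, t) \<and> (\<forall>n. norm (?h n k1) \<le> D (k1, t))
        \<and> norm (cis (- (k1\<^sup>2 * t)) * F (k1, t)) \<le> D (k1, t)"
      using elim(3) by eventually_elim (auto simp: norm_mult intro!: tendsto_intros)
    show ?case
      unfolding has_fourier_def
    proof (intro conjI allI impI)
      show "(\<lambda>k1. cis (- (k1\<^sup>2 * t)) * F (k1, t)) \<in> borel_measurable lborel" by measurable
      fix \<phi> :: "real \<Rightarrow> complex" assume \<phi>: "schwartz \<phi>"
      have [measurable]: "\<phi> \<in> borel_measurable borel" by (rule schwartz_measurable[OF \<phi>])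
      have [measurable]: "fourier \<phi> \<in> borel_measurable borel" by (rule schwartz_measurable[OF schwartz_fourier[OF \<phi>]])
      show "integrable lborel (\<lambda>k1. cis (- (k1\<^sup>2 * t)) * F (k1, t) * \<phi> k1)"
        by (rule L2_dominated_pairing(1)[OF _ _ _ _ elim(1) schwartz_L2[OF \<phi>] hl]) measurable
      have 1: "(\<lambda>n. LINT k|lborel. ?h n k * \<phi> k) \<longlonglongrightarrow> (LINT k|lborel. cis (- (k\<^sup>2 * t)) * F (k, t) * \<phi> k)"
        by (rule L2_dominated_pairing(2)[OF _ _ _ _ elim(1) schwartz_L2[OF \<phi>] hl]) measurable
      have 2: "(\<lambda>n. LINT x|lborel. ?g n (x, t) * fourier \<phi> x) \<longlonglongrightarrow> (LINT x|lborel. g (x, t) * fourier \<phi> x)"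
        by (rule L2_dominated_pairing(2)[OF _ _ _ _ elim(2) schwartz_L2[OF schwartz_fourier[OF \<phi>]] elim(4)]) measurable
      have "(LINT x|lborel. ?g n (x, t) * fourier \<phi> x) = (LINT k|lborel. ?h n k * \<phi> k)" for n
        using inverse_transform_pairing[OF truncated_slice_hat[OF tr] \<phi>, of t x2 n] unfolding lateral_def by simp
      then have "(LINT x|lborel. g (x, t) * fourier \<phi> x) = (LINT k|lborel. cis (- (k\<^sup>2 * t)) * F (k, t) * \<phi> k)"
        using LIMSEQ_unique[OF 2] 1 by simp
      then show "distr_of (\<lambda>x. g (x, t)) (fourier \<phi>) = (LINT k1|lborel. cis (- (k1\<^sup>2 * t)) * F (k1, t) * \<phi> k1)"
        unfolding distr_of_def .
    qed
  qed
  have R3: "integrable lborel (\<lambda>p. g p * \<phi> p) \<and> (LINT p|lborel. g p * \<phi> p)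
         = of_real (1 / (2 * pi)\<^sup>2) * (LINT k|lborel. v k * (LINT p|lborel. schroedinger_kernel k (fst p) x2 (snd p) * \<phi> p))"
    if \<phi>: "schwartz \<phi>" and supp: "\<forall>x t. \<phi> (x, t) \<noteq> 0 \<longrightarrow> 0 \<le> t \<and> t \<le> 1" for \<phi>
  proof -
    let ?K = "\<lambda>k. LINT p|lborel. schroedinger_kernel k (fst p) x2 (snd p) * \<phi> p"
    note K = kernel_symbol_L2[OF \<phi>, of x2]
    note [measurable] = K(1) schwartz_measurable[OF \<phi>]
    note \<phi>2 = schwartz_L2[OF \<phi>]
    have 1: "(\<lambda>n. LINT p|lborel. ?g n p * \<phi> p) \<longlonglongrightarrow> (LINT p|lborel. g p * \<phi> p)"
      by (rule L2_dominated_pairing(2)[OF _ _ _ _ E \<phi>2 gl]) measurable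
    have "(\<lambda>n. LINT k|lborel. vs n k * ?K k) \<longlonglongrightarrow> (LINT k|lborel. v k * ?K k)"
      by (rule L2_dominated_pairing(2)[where D="\<lambda>k. norm (v k)", OF _ _ _ _ fin K(2)]) (measurable, simp add: lim dom)
    then have 2: "(\<lambda>n. of_real (1 / (2 * pi)\<^sup>2) * (LINT k|lborel. vs n k * ?K k)) \<longlonglongrightarrow> of_real (1 / (2 * pi)\<^sup>2) * (LINT k|lborel. v k * ?K k)"
      by (intro tendsto_intros)
    have "(LINT p|lborel. ?g n p * \<phi> p) = of_real (1 / (2 * pi)\<^sup>2) * (LINT k|lborel. vs n k * ?K k)" for n
      by (rule lateral_pairing[OF tr \<phi>]) (use supp in blast)
    then have "(LINT p|lborel. g p * \<phi> p) = of_real (1 / (2 * pi)\<^sup>2) * (LINT k|lborel. v k * ?K k)"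
      using LIMSEQ_unique[OF 1] 2 by simp
    moreover have "integrable lborel (\<lambda>p. g p * \<phi> p)"
      by (rule L2_dominated_pairing(1)[OF _ _ _ _ E \<phi>2 gl]) measurable
    ultimately show ?thesis by blast
  qed
  show ?thesis using Fm'(1) gm'(1) gfin R1 R2 R3 by blast
qed

section \<open>Sobolev regularity in time\<close>

lemma cutoff_hat_weighted_bound:
  assumes "0 \<le> m"
  shows "\<exists>C>0. \<forall>\<xi>. norm (cutoff_hat \<xi>) * (1 + \<xi>\<^sup>2) powr (m / 2) \<le> C / (1 + \<xi>\<^sup>2)"
proof -
  \<comment> \<open>\<open>m\<close> powers for the weight and two for the denominator\<close>
  define N where "N = nat \<lceil>m + 2\<rceil>"
  obtain C where C: "\<And>\<xi>. (1 + norm \<xi>) ^ N * norm (cutoff_hat \<xi>) \<le> C"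
    using schwartz_rapid[OF schwartz_fourier[OF schwartz_cutoff]] by blast
  have "norm (cutoff_hat \<xi>) * (1 + \<xi>\<^sup>2) powr (m / 2) \<le> (\<bar>C\<bar> + 1) / (1 + \<xi>\<^sup>2)" for \<xi>
  proof -
    define X where "X = 1 + \<xi>\<^sup>2"
    have X: "X \<ge> 1" unfolding X_def by simp
    have "X powr (m / 2) * X = X powr (m / 2 + 1)" using X by (simp add: powr_add)
    also have "\<dots> \<le> ((1 + \<bar>\<xi>\<bar>)\<^sup>2) powr (m / 2 + 1)"
      unfolding X_def using assms by (intro powr_mono2) (auto simp: power2_sum)
    also have "\<dots> = (1 + \<bar>\<xi>\<bar>) powr (m + 2)" by (simp add: powr_powr distrib_left flip: powr_numeral)
    also have "\<dots> \<le> (1 + \<bar>\<xi>\<bar>) powr (real N)" unfolding N_def by (intro powr_mono) (auto, linarith)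
    also have "\<dots> = (1 + norm \<xi>) ^ N" by (simp add: powr_realpow)
    finally have "norm (cutoff_hat \<xi>) * (X powr (m / 2) * X) \<le> norm (cutoff_hat \<xi>) * (1 + norm \<xi>) ^ N"
      by (rule mult_left_mono) simp
    also have "\<dots> \<le> \<bar>C\<bar> + 1" using C[of \<xi>] by (simp add: mult.commute)
    finally show ?thesis unfolding X_def[symmetric] using X by (simp add: pos_le_divide_eq mult.assoc)
  qed
  then show ?thesis by (intro exI[of _ "\<bar>C\<bar> + 1"]) auto
qed

lemma ennreal_norm_integral_le: "ennreal (norm (LINT x|M. f x)) \<le> (\<integral>\<^sup>+x. ennreal (norm (f x :: complex)) \<partial>M)"
  by (cases "integrable M f") (auto intro: integral_norm_bound_ennreal simp: not_integrable_integral_eq)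

text \<open>Peetre's inequality \<open>1 + \<tau>\<^sup>2 \<le> 2 (1 + \<xi>\<^sup>2) (1 + k\<^sup>2)\<^sup>2\<close> with \<open>\<xi> = \<tau> + k\<^sup>2\<close> moves the weight from \<open>\<tau>\<close> to \<open>k\<close>, at the expense of
  decay of the cutoff's transform.  In the Cauchy-Schwarz inequality one factor \<open>(1 + k\<^sup>2) powr (1/4)\<close> is
  spent on the mass of the kernel (\<open>kernel_integral_bound\<close>, the Jacobian); the other factor keeps the exponent
  \<open>m - 1/4\<close>, whose double is \<open>2 m - 1/2\<close>.\<close>

lemma profile_bound:
  assumes m: "0 \<le> m"
  shows "\<exists>C>0. \<forall>x2 w. w \<in> borel_measurable borel \<longrightarrow>
    (\<integral>\<^sup>+\<tau>. ennreal ((1 + \<tau>\<^sup>2) powr m * (norm (profile x2 w \<tau>))\<^sup>2) \<partial>lborel)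
      \<le> ennreal C * (\<integral>\<^sup>+k. ennreal ((1 + k\<^sup>2) powr (2 * m - 1 / 2) * (norm (w k))\<^sup>2) \<partial>lborel)"
proof -
  obtain C where C0: "C > 0" and C: "\<And>\<xi>. norm (cutoff_hat \<xi>) * (1 + \<xi>\<^sup>2) powr (m / 2) \<le> C / (1 + \<xi>\<^sup>2)"
    using cutoff_hat_weighted_bound[OF m] by blast
  \<comment> \<open>Peetre's inequality to the power \<open>m / 2\<close> brings in the factor \<open>2 powr (m / 2)\<close>\<close>
  define A where "A = 2 powr (m / 2) * C"
  have A0: "A > 0" unfolding A_def using C0 by simp
  have "(\<integral>\<^sup>+\<tau>. ennreal ((1 + \<tau>\<^sup>2) powr m * (norm (profile x2 w \<tau>))\<^sup>2) \<partial>lborel)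
      \<le> ennreal (kernel_mass * A\<^sup>2 * (2 * pi)) * (\<integral>\<^sup>+k. ennreal ((1 + k\<^sup>2) powr (2 * m - 1 / 2) * (norm (w k))\<^sup>2) \<partial>lborel)"
    if [measurable]: "w \<in> borel_measurable borel" for x2 w
  proof -
    define H where "H k = (1 + k\<^sup>2) powr (2 * m - 1 / 2) * (norm (w k))\<^sup>2" for k
    have [measurable]: "H \<in> borel_measurable borel" unfolding H_def by measurable
    have H0: "0 \<le> H k" for k unfolding H_def by simp
    define J where "J \<tau> k = 1 / (1 + (\<tau> + k\<^sup>2)\<^sup>2)" for \<tau> k :: real
    have J0: "0 \<le> J \<tau> k" for \<tau> k unfolding J_def by simp
    have pt: "ennreal ((1 + \<tau>\<^sup>2) powr m * (norm (profile x2 w \<tau>))\<^sup>2)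
        \<le> ennreal kernel_mass * (\<integral>\<^sup>+k. ennreal (A\<^sup>2 * (J \<tau> k * H k)) \<partial>lborel)" for \<tau>
    proof -
      define f where "f k = sqrt (J \<tau> k) * (1 + k\<^sup>2) powr (1 / 4)" for k
      define g where "g k = A * (sqrt (J \<tau> k) * ((1 + k\<^sup>2) powr (m - 1 / 4) * norm (w k)))" for k
      have [measurable]: "f \<in> borel_measurable borel" "g \<in> borel_measurable borel"
        unfolding f_def g_def J_def by measurable
      have fg0: "0 \<le> f k" "0 \<le> g k" for k unfolding f_def g_def using A0 J0 by auto
      have one: "(1 + \<tau>\<^sup>2) powr (m / 2) * norm (1 / (2 * pi) * (cutoff_hat (\<tau> + k\<^sup>2) * (cis (k * x2) * w k))) \<le> f k * g k" for k
      proof -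
        let ?\<xi> = "\<tau> + k\<^sup>2"
        have "1 + \<tau>\<^sup>2 \<le> 2 * (1 + ?\<xi>\<^sup>2) * (1 + k\<^sup>2)\<^sup>2"
        proof -
          have gen: "(a - b)\<^sup>2 \<le> 2 * a\<^sup>2 + 2 * b\<^sup>2" for a b :: real
          proof -
            have "0 \<le> (a + b)\<^sup>2" by simp
            then show ?thesis unfolding power2_sum power2_diff by linarith
          qed
          have "1 + \<tau>\<^sup>2 \<le> 1 + (2 * ?\<xi>\<^sup>2 + 2 * (k\<^sup>2)\<^sup>2)" using gen[of ?\<xi> "k\<^sup>2"] by simp
          also have "\<dots> \<le> 2 * ((1 + ?\<xi>\<^sup>2) * (1 + (k\<^sup>2)\<^sup>2))"
          proof -
            have e: "1 + (2 * a + 2 * b) \<le> 2 * ((1 + a) * (1 + b))" if "0 \<le> a" "0 \<le> b" for a b :: real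
              using that by (simp add: algebra_simps)
            show ?thesis by (rule e) simp_all
          qed
          also have "\<dots> \<le> 2 * ((1 + ?\<xi>\<^sup>2) * (1 + k\<^sup>2)\<^sup>2)"
          proof -
            have "1 + (k\<^sup>2)\<^sup>2 \<le> (1 + k\<^sup>2)\<^sup>2" unfolding power2_sum[of 1 "k\<^sup>2"] by simp
            then show ?thesis by (intro mult_left_mono) simp_all
          qed
          finally show ?thesis by (simp only: mult.assoc)
        qed
        then have "(1 + \<tau>\<^sup>2) powr (m / 2) \<le> (2 * (1 + ?\<xi>\<^sup>2) * (1 + k\<^sup>2)\<^sup>2) powr (m / 2)"
          using m by (intro powr_mono2) auto
        also have "\<dots> = 2 powr (m / 2) * (1 + ?\<xi>\<^sup>2) powr (m / 2) * (1 + k\<^sup>2) powr m"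
        proof -
          have e: "(2 * X * Y\<^sup>2) powr (m / 2) = 2 powr (m / 2) * X powr (m / 2) * Y powr m" if "0 < X" "0 < Y" for X Y :: real
            using that by (simp add: powr_mult powr_powr flip: powr_numeral)
          show ?thesis by (rule e) (simp_all add: add_pos_nonneg)
        qed
        finally have a: "(1 + \<tau>\<^sup>2) powr (m / 2) \<le> 2 powr (m / 2) * (1 + ?\<xi>\<^sup>2) powr (m / 2) * (1 + k\<^sup>2) powr m" .
        have "(1 + \<tau>\<^sup>2) powr (m / 2) * norm (1 / (2 * pi) * (cutoff_hat ?\<xi> * (cis (k * x2) * w k)))
          \<le> (2 powr (m / 2) * (1 + ?\<xi>\<^sup>2) powr (m / 2) * (1 + k\<^sup>2) powr m) * (1 * (norm (cutoff_hat ?\<xi>) * norm (w k)))"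
        proof (rule mult_mono[OF a])
          have "norm (complex_of_real (1 / (2 * pi))) \<le> 1" using pi_gt3 by (simp add: norm_divide)
          then have "norm (complex_of_real (1 / (2 * pi))) * (norm (cutoff_hat ?\<xi>) * norm (w k)) \<le> 1 * (norm (cutoff_hat ?\<xi>) * norm (w k))"
            by (rule mult_right_mono) simp
          then show "norm (1 / (2 * pi) * (cutoff_hat ?\<xi> * (cis (k * x2) * w k))) \<le> 1 * (norm (cutoff_hat ?\<xi>) * norm (w k))"
            by (simp only: norm_mult norm_cis mult_1)
        qed auto
        also have "\<dots> = 2 powr (m / 2) * (norm (cutoff_hat ?\<xi>) * (1 + ?\<xi>\<^sup>2) powr (m / 2)) * ((1 + k\<^sup>2) powr m * norm (w k))"
          by (simp only: mult_ac mult_1)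
        also have "\<dots> \<le> 2 powr (m / 2) * (C * J \<tau> k) * ((1 + k\<^sup>2) powr m * norm (w k))"
          using C[of ?\<xi>] by (intro mult_right_mono mult_left_mono) (auto simp: J_def)
        also have "\<dots> = f k * g k"
        proof -
          have s: "sqrt (J \<tau> k) * sqrt (J \<tau> k) = J \<tau> k" using J0 by simp
          have p: "(1 + k\<^sup>2) powr (1 / 4) * (1 + k\<^sup>2) powr (m - 1 / 4) = (1 + k\<^sup>2) powr m"
            by (simp flip: powr_add)
          have "f k * g k = A * (sqrt (J \<tau> k) * sqrt (J \<tau> k)) * (((1 + k\<^sup>2) powr (1 / 4) * (1 + k\<^sup>2) powr (m - 1 / 4)) * norm (w k))"
            unfolding f_def g_def by (simp only: mult_ac)
          then show ?thesis unfolding s p A_def by (simp only: mult_ac)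
        qed
        finally show ?thesis .
      qed
      have f2: "(\<integral>\<^sup>+k. ennreal ((f k)\<^sup>2) \<partial>lborel) \<le> ennreal kernel_mass"
      proof (rule order_trans[OF nn_integral_mono kernel_integral_bound[of \<tau>]])
        fix k
        have "(f k)\<^sup>2 = J \<tau> k * ((1 + k\<^sup>2) powr (1 / 4))\<^sup>2" unfolding f_def using J0 by (simp add: power_mult_distrib)
        also have "((1 + k\<^sup>2) powr (1 / 4))\<^sup>2 = sqrt (1 + k\<^sup>2)"
          by (simp add: power2_eq_square powr_half_sqrt add_nonneg_nonneg flip: powr_add)
        also have "J \<tau> k * sqrt (1 + k\<^sup>2) \<le> J \<tau> k * (1 + \<bar>k\<bar>)"
          by (intro mult_left_mono J0 real_le_lsqrt) (auto simp: power2_sum)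
        finally show "ennreal ((f k)\<^sup>2) \<le> ennreal ((1 + \<bar>k\<bar>) / (1 + (\<tau> + k\<^sup>2)\<^sup>2))"
          unfolding J_def by (intro ennreal_leI) simp
      qed
      have g2: "(g k)\<^sup>2 = A\<^sup>2 * (J \<tau> k * H k)" for k
      proof -
        have "((1 + k\<^sup>2) powr (m - 1 / 4))\<^sup>2 = (1 + k\<^sup>2) powr (2 * m - 1 / 2)"
          by (simp add: power2_eq_square flip: powr_add)
        then show ?thesis unfolding g_def H_def using J0 by (simp add: power_mult_distrib)
      qed
      define P where "P = (1 + \<tau>\<^sup>2) powr (m / 2)"
      have P0: "0 \<le> P" unfolding P_def by simp
      have prof: "profile x2 w \<tau> = (LINT k|lborel. 1 / (2 * pi) * (cutoff_hat (\<tau> + k\<^sup>2) * (cis (k * x2) * w k)))"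
        unfolding profile_def by (simp only: integral_mult_right_zero)
      have "ennreal (P * norm (profile x2 w \<tau>)) = ennreal P * ennreal (norm (profile x2 w \<tau>))"
        using P0 by (simp add: ennreal_mult)
      also have "\<dots> \<le> ennreal P * (\<integral>\<^sup>+k. ennreal (norm (1 / (2 * pi) * (cutoff_hat (\<tau> + k\<^sup>2) * (cis (k * x2) * w k)))) \<partial>lborel)"
        unfolding prof by (intro mult_left_mono ennreal_norm_integral_le) simp
      also have "\<dots> = (\<integral>\<^sup>+k. ennreal P * ennreal (norm (1 / (2 * pi) * (cutoff_hat (\<tau> + k\<^sup>2) * (cis (k * x2) * w k)))) \<partial>lborel)"
        by (rule nn_integral_cmult[symmetric]) measurable
      also have "\<dots> \<le> (\<integral>\<^sup>+k. ennreal (f k * g k) \<partial>lborel)"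
        using one P0 by (intro nn_integral_mono) (subst ennreal_mult[symmetric], auto simp: P_def intro!: ennreal_leI)
      finally have "(ennreal (P * norm (profile x2 w \<tau>)))\<^sup>2 \<le> (\<integral>\<^sup>+k. ennreal (f k * g k) \<partial>lborel)\<^sup>2"
        by (rule power_mono) simp
      also have "\<dots> \<le> ennreal kernel_mass * (\<integral>\<^sup>+k. ennreal ((g k)\<^sup>2) \<partial>lborel)"
        by (rule nn_integral_cauchy_schwarz[OF _ _ _ _ f2 kernel_mass_pos]) (use fg0 in auto)
      finally have fin: "(ennreal (P * norm (profile x2 w \<tau>)))\<^sup>2 \<le> ennreal kernel_mass * (\<integral>\<^sup>+k. ennreal ((g k)\<^sup>2) \<partial>lborel)" .
      have "P\<^sup>2 = (1 + \<tau>\<^sup>2) powr m" unfolding P_def by (simp add: power2_eq_square flip: powr_add)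
      then have "(ennreal (P * norm (profile x2 w \<tau>)))\<^sup>2 = ennreal ((1 + \<tau>\<^sup>2) powr m * (norm (profile x2 w \<tau>))\<^sup>2)"
        using P0 by (simp add: ennreal_power power_mult_distrib)
      then show ?thesis using fin unfolding g2 by simp
    qed
    have "(\<integral>\<^sup>+\<tau>. ennreal ((1 + \<tau>\<^sup>2) powr m * (norm (profile x2 w \<tau>))\<^sup>2) \<partial>lborel)
      \<le> (\<integral>\<^sup>+\<tau>. ennreal kernel_mass * (\<integral>\<^sup>+k. ennreal (A\<^sup>2 * (J \<tau> k * H k)) \<partial>lborel) \<partial>lborel)"
      by (intro nn_integral_mono pt)
    also have "\<dots> = ennreal kernel_mass * (\<integral>\<^sup>+\<tau>. \<integral>\<^sup>+k. ennreal (A\<^sup>2 * (J \<tau> k * H k)) \<partial>lborel \<partial>lborel)"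
      unfolding J_def by (rule nn_integral_cmult) measurable
    also have "(\<integral>\<^sup>+\<tau>. \<integral>\<^sup>+k. ennreal (A\<^sup>2 * (J \<tau> k * H k)) \<partial>lborel \<partial>lborel) = (\<integral>\<^sup>+k. \<integral>\<^sup>+\<tau>. ennreal (A\<^sup>2 * (J \<tau> k * H k)) \<partial>lborel \<partial>lborel)"
      unfolding J_def by (rule lborel_pair.Fubini') measurable
    also have "\<dots> \<le> (\<integral>\<^sup>+k. ennreal (A\<^sup>2 * H k) * ennreal (2 * pi) \<partial>lborel)"
    proof (intro nn_integral_mono)
      fix k
      have "(\<integral>\<^sup>+\<tau>. ennreal (A\<^sup>2 * (J \<tau> k * H k)) \<partial>lborel) = (\<integral>\<^sup>+\<tau>. ennreal (A\<^sup>2 * H k) * ennreal (J \<tau> k) \<partial>lborel)"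
        using H0[of k] J0 by (intro nn_integral_cong) (subst ennreal_mult[symmetric], auto simp: mult_ac)
      also have "\<dots> = ennreal (A\<^sup>2 * H k) * (\<integral>\<^sup>+\<tau>. ennreal (J \<tau> k) \<partial>lborel)"
        unfolding J_def by (rule nn_integral_cmult) measurable
      also have "\<dots> \<le> ennreal (A\<^sup>2 * H k) * ennreal (2 * pi)"
        unfolding J_def by (intro mult_left_mono cauchy_kernel_integral) simp
      finally show "(\<integral>\<^sup>+\<tau>. ennreal (A\<^sup>2 * (J \<tau> k * H k)) \<partial>lborel) \<le> ennreal (A\<^sup>2 * H k) * ennreal (2 * pi)" .
    qed
    also have "\<dots> = (\<integral>\<^sup>+k. ennreal (A\<^sup>2 * (2 * pi)) * ennreal (H k) \<partial>lborel)"
      using H0 by (intro nn_integral_cong) (simp add: mult_ac flip: ennreal_mult)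
    also have "\<dots> = ennreal (A\<^sup>2 * (2 * pi)) * (\<integral>\<^sup>+k. ennreal (H k) \<partial>lborel)"
      by (rule nn_integral_cmult) measurable
    finally have "(\<integral>\<^sup>+\<tau>. ennreal ((1 + \<tau>\<^sup>2) powr m * (norm (profile x2 w \<tau>))\<^sup>2) \<partial>lborel)
      \<le> ennreal kernel_mass * (ennreal (A\<^sup>2 * (2 * pi)) * (\<integral>\<^sup>+k. ennreal (H k) \<partial>lborel))"
      by (simp add: mult_left_mono)
    also have "\<dots> = ennreal (kernel_mass * A\<^sup>2 * (2 * pi)) * (\<integral>\<^sup>+k. ennreal (H k) \<partial>lborel)"
      using kernel_mass_pos by (simp add: ennreal_mult mult.assoc)
    finally show ?thesis unfolding H_def .
  qed
  moreover have "kernel_mass * A\<^sup>2 * (2 * pi) > 0" using kernel_mass_pos A0 by simp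
  ultimately show ?thesis by blast
qed

section \<open>The two estimates\<close>

lemma ennreal_sqrt_power2: "(ennreal_sqrt x)\<^sup>2 = x"
  by (cases x) (simp_all add: ennreal_sqrt_def ennreal_power infinity_ennreal_def)

lemma ennreal_sqrt_mono: "x \<le> y \<Longrightarrow> ennreal_sqrt x \<le> ennreal_sqrt y"
  unfolding ennreal_sqrt_def infinity_ennreal_def
  by (cases x; cases y) (auto simp: top_unique intro!: ennreal_leI)

lemma ennreal_sqrt_cmult:
  assumes "C > 0" shows "ennreal_sqrt (ennreal C * x) = ennreal (sqrt C) * ennreal_sqrt x"
  using assms unfolding ennreal_sqrt_def infinity_ennreal_def
  by (cases x) (auto simp: ennreal_mult_top real_sqrt_mult simp flip: ennreal_mult)

text \<open>Uniqueness of the transform holds on almost every horizontal slice.  Since both sides are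
  jointly measurable on the strip, Fubini's theorem turns this into almost every vertical slice.\<close>

lemma partial_fourier_AE:
  assumes h: "has_partial_fourier T g h"
  shows "AE k1 in lborel. AE t in lborel. t \<in> {0..T} \<longrightarrow> partial_fourier T g (k1, t) = h (k1, t)"
proof -
  let ?p = "partial_fourier T g"
  let ?A = "(UNIV :: real set) \<times> {0..T}"
  have p: "has_partial_fourier T g ?p" unfolding partial_fourier_def by (rule someI[of "has_partial_fourier T g", OF h])
  let ?H = "\<lambda>q. indicator ?A q *\<^sub>R h q" and ?P = "\<lambda>q. indicator ?A q *\<^sub>R ?p q"
  have m: "?H \<in> borel_measurable lborel" "?P \<in> borel_measurable lborel"
    using h p unfolding has_partial_fourier_def set_borel_measurable_def by blast+
  have hf: "AE t in lborel. t \<in> {0..T} \<longrightarrow> has_fourier (distr_of (\<lambda>x. g (x, t))) (\<lambda>k. h (k, t))"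
    "AE t in lborel. t \<in> {0..T} \<longrightarrow> has_fourier (distr_of (\<lambda>x. g (x, t))) (\<lambda>k. ?p (k, t))"
    using h p unfolding has_partial_fourier_def by blast+
  have "AE t in lborel. AE k in lborel. ?P (k, t) = ?H (k, t)"
    using hf
  proof eventually_elim
    case (elim t)
    show ?case
    proof (cases "t \<in> {0..T}")
      case True
      with elim have "AE k in lborel. ?p (k, t) = h (k, t)" using has_fourier_unique by blast
      then show ?thesis by eventually_elim simp
    qed (auto simp: indicator_def)
  qed
  moreover have "{q \<in> space (lborel \<Otimes>\<^sub>M lborel). ?P (fst q, snd q) = ?H (fst q, snd q)} \<in> sets (lborel \<Otimes>\<^sub>M lborel)"
    unfolding lborel_prod prod.collapse using m by measurable
  ultimately have "AE k in lborel. AE t in lborel. ?P (k, t) = ?H (k, t)"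
    using lborel_pair.AE_commute[of "\<lambda>k t. ?P (k, t) = ?H (k, t)"] by blast
  then show ?thesis
    by eventually_elim (erule eventually_mono, auto simp: indicator_def)
qed

lemma sobolev_norm_interval_le:
  assumes "square_integrable_on UNIV F" "AE t in lborel. t \<in> {0<..<T} \<longrightarrow> F t = f t"
  shows "sobolev_norm_interval m T f \<le> sobolev_norm m (distr_of F)"
  unfolding sobolev_norm_interval_def by (rule INF_lower) (use assms in blast)

lemma L2_tempered:
  assumes "F \<in> borel_measurable borel" "energy F < \<infinity>"
  shows "tempered (distr_of F)"
proof (rule moderate_tempered, rule moderate_weighted_L2[where s=0, OF assms(1)])
  have "(1 + (norm k)\<^sup>2) powr 0 = 1" for k :: 'a
    using add_pos_nonneg[OF zero_less_one zero_le_power2[of "norm k"]] by simp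
  then show "(\<integral>\<^sup>+t. ennreal ((1 + (norm t)\<^sup>2) powr 0 * (norm (F t))\<^sup>2) \<partial>lborel) < \<infinity>"
    using assms(2) by (simp only: mult_1)
qed

text \<open>The extension \<open>F\<close> is admissible in the restriction norm, and its transform is the profile.\<close>

lemma lateral_trace:
  fixes v :: "real \<times> real \<Rightarrow> complex"
  assumes T: "0 < T" "T < 1" and [measurable]: "v \<in> borel_measurable borel"
    and fin: "energy v < \<infinity>"
    and bound: "\<And>i. i \<in> I \<Longrightarrow> \<forall>x2 w. w \<in> borel_measurable borel \<longrightarrow>
      (\<integral>\<^sup>+\<tau>. ennreal ((1 + \<tau>\<^sup>2) powr m i * (norm (profile x2 w \<tau>))\<^sup>2) \<partial>lborel)
      \<le> ennreal (C i) * (\<integral>\<^sup>+k. ennreal ((1 + k\<^sup>2) powr (2 * m i - 1 / 2) * (norm (w k))\<^sup>2) \<partial>lborel)"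
  shows "\<exists>g. square_integrable_on (UNIV \<times> {0..T}) g \<and>
    (\<forall>\<phi>. schwartz \<phi> \<longrightarrow> (\<forall>x t. \<phi> (x, t) \<noteq> 0 \<longrightarrow> 0 \<le> t \<and> t \<le> 1) \<longrightarrow>
       integrable lborel (\<lambda>p. g p * \<phi> p) \<and>
       (LINT p|lborel. g p * \<phi> p)
         = of_real (1 / (2 * pi)\<^sup>2) * (LINT k|lborel. v k * (LINT p|lborel. schroedinger_kernel k (fst p) x2 (snd p) * \<phi> p))) \<and>
    (\<forall>i\<in>I. AE k1 in lborel. (sobolev_norm_interval (m i) T (\<lambda>t. cis (k1\<^sup>2 * t) * partial_fourier T g (k1, t)))\<^sup>2
       \<le> ennreal (C i) * (\<integral>\<^sup>+k. ennreal ((1 + k\<^sup>2) powr (2 * m i - 1 / 2) * (norm (v (k1, k)))\<^sup>2) \<partial>lborel))"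
proof -
  obtain F g where [measurable]: "F \<in> borel_measurable borel" "g \<in> borel_measurable borel"
    and gfin: "energy g < \<infinity>"
    and A1: "AE k1 in lborel. energy (\<lambda>t. F (k1, t)) < \<infinity> \<and>
       has_fourier (distr_of (\<lambda>t. F (k1, t))) (profile x2 (\<lambda>k. v (k1, k)))"
    and A2: "AE t in lborel. has_fourier (distr_of (\<lambda>x. g (x, t))) (\<lambda>k1. cis (- (k1\<^sup>2 * t)) * F (k1, t))"
    and A3: "\<forall>\<phi>. schwartz \<phi> \<longrightarrow> (\<forall>x t. \<phi> (x, t) \<noteq> 0 \<longrightarrow> 0 \<le> t \<and> t \<le> 1) \<longrightarrow>
       integrable lborel (\<lambda>p. g p * \<phi> p) \<and>
       (LINT p|lborel. g p * \<phi> p)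
         = of_real (1 / (2 * pi)\<^sup>2) * (LINT k|lborel. v k * (LINT p|lborel. schroedinger_kernel k (fst p) x2 (snd p) * \<phi> p))"
    using lateral_limits[OF assms(3) fin, of x2] by blast
  let ?h = "\<lambda>q. cis (- ((fst q)\<^sup>2 * snd q)) * F q"
  have "(\<lambda>q :: real \<times> real. cis (- ((fst q)\<^sup>2 * snd q))) \<in> borel_measurable borel"
    by (intro borel_measurable_continuous_onI continuous_intros)
  then have [measurable]: "?h \<in> borel_measurable borel" by measurable
  have setm: "(UNIV :: real set) \<times> {0..T} \<in> sets borel"
    by (intro borel_closed closed_Times) auto
  have hp: "has_partial_fourier T g ?h"
    unfolding has_partial_fourier_def set_borel_measurable_def
  proof
    show "(\<lambda>x. indicat_real (UNIV \<times> {0..T}) x *\<^sub>R ?h x) \<in> borel_measurable lborel"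
      using setm by measurable
    show "AE t in lborel. t \<in> {0..T} \<longrightarrow> has_fourier (distr_of (\<lambda>x1. g (x1, t))) (\<lambda>k1. cis (- ((fst (k1, t))\<^sup>2 * snd (k1, t))) * F (k1, t))"
      using A2 by eventually_elim simp
  qed
  have sq: "square_integrable_on (UNIV \<times> {0..T}) g"
    unfolding square_integrable_on_def set_borel_measurable_def
  proof
    show "(\<lambda>x. indicat_real (UNIV \<times> {0..T}) x *\<^sub>R g x) \<in> borel_measurable lborel" using setm by measurable
    have "(\<integral>\<^sup>+x\<in>UNIV \<times> {0..T}. ennreal ((norm (g x))\<^sup>2) \<partial>lborel) \<le> energy g"
      by (intro nn_integral_mono) (auto simp: indicator_def)
    then show "(\<integral>\<^sup>+x\<in>UNIV \<times> {0..T}. ennreal ((norm (g x))\<^sup>2) \<partial>lborel) < \<infinity>" using gfin by (rule le_less_trans)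
  qed
  have "AE k1 in lborel. (sobolev_norm_interval (m i) T (\<lambda>t. cis (k1\<^sup>2 * t) * partial_fourier T g (k1, t)))\<^sup>2
       \<le> ennreal (C i) * (\<integral>\<^sup>+k. ennreal ((1 + k\<^sup>2) powr (2 * m i - 1 / 2) * (norm (v (k1, k)))\<^sup>2) \<partial>lborel)"
    if i: "i \<in> I" for i
    using A1 partial_fourier_AE[OF hp]
  proof eventually_elim
    case (elim k1)
    have Fm: "(\<lambda>t. F (k1, t)) \<in> borel_measurable borel" by measurable
    have F2: "energy (\<lambda>t. F (k1, t)) < \<infinity>"
      and hf: "has_fourier (distr_of (\<lambda>t. F (k1, t))) (profile x2 (\<lambda>k. v (k1, k)))" using elim(1) by auto
    have "sobolev_norm_interval (m i) T (\<lambda>t. cis (k1\<^sup>2 * t) * partial_fourier T g (k1, t)) \<le> sobolev_norm (m i) (distr_of (\<lambda>t. F (k1, t)))"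
    proof (rule sobolev_norm_interval_le)
      show "square_integrable_on UNIV (\<lambda>t. F (k1, t))"
        unfolding square_integrable_on_def set_borel_measurable_def using F2 Fm by simp
      show "AE t in lborel. t \<in> {0<..<T} \<longrightarrow> F (k1, t) = cis (k1\<^sup>2 * t) * partial_fourier T g (k1, t)"
        using elim(2)
      proof eventually_elim
        case (elim t)
        have "cis (k1\<^sup>2 * t) * (cis (- (k1\<^sup>2 * t)) * F (k1, t)) = F (k1, t)"
          unfolding mult.assoc[symmetric] cis_mult by simp
        then show ?case using elim by simp
      qed
    qed
    also have "\<dots> = ennreal_sqrt (\<integral>\<^sup>+\<tau>. ennreal ((1 + (norm \<tau>)\<^sup>2) powr m i * (norm (profile x2 (\<lambda>k. v (k1, k)) \<tau>))\<^sup>2) \<partial>lborel)"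
      by (rule sobolev_norm_eq[OF L2_tempered[OF Fm F2] hf])
    finally have "(sobolev_norm_interval (m i) T (\<lambda>t. cis (k1\<^sup>2 * t) * partial_fourier T g (k1, t)))\<^sup>2
      \<le> (ennreal_sqrt (\<integral>\<^sup>+\<tau>. ennreal ((1 + (norm \<tau>)\<^sup>2) powr m i * (norm (profile x2 (\<lambda>k. v (k1, k)) \<tau>))\<^sup>2) \<partial>lborel))\<^sup>2"
      by (rule power_mono) simp
    also have "\<dots> = (\<integral>\<^sup>+\<tau>. ennreal ((1 + \<tau>\<^sup>2) powr m i * (norm (profile x2 (\<lambda>k. v (k1, k)) \<tau>))\<^sup>2) \<partial>lborel)"
      unfolding ennreal_sqrt_power2 by simp
    also have "\<dots> \<le> ennreal (C i) * (\<integral>\<^sup>+k. ennreal ((1 + k\<^sup>2) powr (2 * m i - 1 / 2) * (norm (v (k1, k)))\<^sup>2) \<partial>lborel)"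
      by (rule bound[OF i, rule_format]) measurable
    finally show ?case .
  qed
  then show ?thesis using sq A3 by blast
qed

lemma lateral_is_function:
  assumes T: "0 < T" "T < 1"
    and A: "\<forall>\<phi>. schwartz \<phi> \<longrightarrow> (\<forall>x t. \<phi> (x, t) \<noteq> 0 \<longrightarrow> 0 \<le> t \<and> t \<le> 1) \<longrightarrow>
       integrable lborel (\<lambda>p. g p * \<phi> p) \<and>
       (LINT p|lborel. g p * \<phi> p)
         = of_real (1 / (2 * pi)\<^sup>2) * (LINT k|lborel. fourier_fun U0 k * (LINT p|lborel. schroedinger_kernel k (fst p) x2 (snd p) * \<phi> p))"
  shows "is_function_on (UNIV \<times> {0<..<T}) (solution_at_x2 U0 x2) g"
  unfolding is_function_on_def
proof (intro allI impI, elim conjE)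
  fix \<phi> :: "real \<times> real \<Rightarrow> complex"
  assume \<phi>: "schwartz \<phi>" and supp: "closure {x. \<phi> x \<noteq> 0} \<subseteq> UNIV \<times> {0<..<T}"
  have z: "\<phi> p = 0" if "p \<notin> UNIV \<times> {0<..<T}" for p
    using that supp closure_subset[of "{x. \<phi> x \<noteq> 0}"] by blast
  have s01: "\<forall>x t. \<phi> (x, t) \<noteq> 0 \<longrightarrow> 0 \<le> t \<and> t \<le> 1"
  proof (intro allI impI)
    fix x t assume "\<phi> (x, t) \<noteq> 0"
    then have "(x, t) \<in> UNIV \<times> {0<..<T}" using z by blast
    then show "0 \<le> t \<and> t \<le> 1" using T by simp
  qed
  \<comment> \<open>integrals over the strip are integrals over the plane, as \<open>\<phi>\<close> vanishes outside it\<close>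
  have e: "indicat_real (UNIV \<times> {0<..<T}) p *\<^sub>R (g p * \<phi> p) = g p * \<phi> p" for p
    using z[of p] by (cases "p \<in> UNIV \<times> {0<..<T}") simp_all
  have "solution_at_x2 U0 x2 \<phi> = (LINT p|lborel. g p * \<phi> p)"
    using A[rule_format, OF \<phi>, of] s01 unfolding solution_at_x2_def by (simp add: case_prod_unfold)
  then show "set_integrable lborel (UNIV \<times> {0<..<T}) (\<lambda>x. g x * \<phi> x) \<and>
      solution_at_x2 U0 x2 \<phi> = set_lebesgue_integral lborel (UNIV \<times> {0<..<T}) (\<lambda>x. g x * \<phi> x)"
    unfolding set_integrable_def set_lebesgue_integral_def e using A \<phi> s01 by simp
qed

text \<open>The index \<open>b\<close> distinguishes the two terms of the norm of \<open>B\<^sub>T\<^sup>s\<close>.\<close>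

theorem lateral_regularity:
  assumes s: "s \<ge> 0"
  shows "\<exists>c::real. c > 0 \<and>
     (\<forall>(T::real) (U0 :: (real \<times> real) distr). 0 < T \<and> T < 1 \<and> U0 \<in> sobolev_space s \<longrightarrow>
        (\<exists>g :: real \<Rightarrow> real \<times> real \<Rightarrow> complex.
           (\<forall>x2. is_function_on (UNIV \<times> {0<..<T}) (solution_at_x2 U0 x2) (g x2)) \<and>
           (SUP x2. B_norm s T (g x2)) \<le> ennreal c * sobolev_norm s U0))"
proof -
  \<comment> \<open>both exponents satisfy \<open>2 m - 1/2 \<in> {s, 0}\<close>\<close>
  define m where "m b = (if b then (2 * s + 1) / 4 else 1 / 4)" for b
  have "0 \<le> m b" for b unfolding m_def using s by simp
  then have "\<forall>b. \<exists>C>0. \<forall>x2 w. w \<in> borel_measurable borel \<longrightarrow>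
    (\<integral>\<^sup>+\<tau>. ennreal ((1 + \<tau>\<^sup>2) powr m b * (norm (profile x2 w \<tau>))\<^sup>2) \<partial>lborel)
      \<le> ennreal C * (\<integral>\<^sup>+k. ennreal ((1 + k\<^sup>2) powr (2 * m b - 1 / 2) * (norm (w k))\<^sup>2) \<partial>lborel)"
    using profile_bound by blast
  from choice[OF this] obtain C where C: "\<forall>b. 0 < C b \<and> (\<forall>x2 w. w \<in> borel_measurable borel \<longrightarrow>
    (\<integral>\<^sup>+\<tau>. ennreal ((1 + \<tau>\<^sup>2) powr m b * (norm (profile x2 w \<tau>))\<^sup>2) \<partial>lborel)
      \<le> ennreal (C b) * (\<integral>\<^sup>+k. ennreal ((1 + k\<^sup>2) powr (2 * m b - 1 / 2) * (norm (w k))\<^sup>2) \<partial>lborel))" ..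
  then have C0: "C b > 0" for b by blast
  define c where "c = sqrt (C True) + sqrt (C False)"
  have c0: "c > 0" unfolding c_def using C0 by (simp add: add_pos_pos)
  have main: "\<exists>g. is_function_on (UNIV \<times> {0<..<T}) (solution_at_x2 U0 x2) g \<and> B_norm s T g \<le> ennreal c * sobolev_norm s U0"
    if T: "0 < T" "T < 1" and U0: "U0 \<in> sobolev_space s" for T U0 x2
  proof -
    note U = sobolev_space_D[OF U0]
    let ?v = "fourier_fun U0"
    have [measurable]: "?v \<in> borel_measurable borel" using U(2) unfolding moderate_def by blast
    define N where "N = (\<integral>\<^sup>+k. ennreal ((1 + (norm k)\<^sup>2) powr s * (norm (?v k))\<^sup>2) \<partial>lborel)"
    have "energy ?v \<le> N"
      unfolding N_def
    proof (intro nn_integral_mono ennreal_leI)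
      fix k :: "real \<times> real"
      have "1 \<le> (1 + (norm k)\<^sup>2) powr s" using s by (intro ge_one_powr_ge_zero) auto
      then show "(norm (?v k))\<^sup>2 \<le> (1 + (norm k)\<^sup>2) powr s * (norm (?v k))\<^sup>2"
        using mult_right_mono[of 1 "(1 + (norm k)\<^sup>2) powr s" "(norm (?v k))\<^sup>2"] by simp
    qed
    then have fin: "energy ?v < \<infinity>"
      using U(4) unfolding N_def by (rule le_less_trans)
    have vm: "?v \<in> borel_measurable borel" by measurable
    obtain g where sq: "square_integrable_on (UNIV \<times> {0..T}) g"
      and A: "\<forall>\<phi>. schwartz \<phi> \<longrightarrow> (\<forall>x t. \<phi> (x, t) \<noteq> 0 \<longrightarrow> 0 \<le> t \<and> t \<le> 1) \<longrightarrow>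
       integrable lborel (\<lambda>p. g p * \<phi> p) \<and>
       (LINT p|lborel. g p * \<phi> p)
         = of_real (1 / (2 * pi)\<^sup>2) * (LINT k|lborel. ?v k * (LINT p|lborel. schroedinger_kernel k (fst p) x2 (snd p) * \<phi> p))"
      and B: "\<forall>i\<in>UNIV. AE k1 in lborel. (sobolev_norm_interval (m i) T (\<lambda>t. cis (k1\<^sup>2 * t) * partial_fourier T g (k1, t)))\<^sup>2
       \<le> ennreal (C i) * (\<integral>\<^sup>+k. ennreal ((1 + k\<^sup>2) powr (2 * m i - 1 / 2) * (norm (?v (k1, k)))\<^sup>2) \<partial>lborel)"
      using lateral_trace[OF T vm fin, of UNIV m C x2] C by blast
    let ?S = "\<lambda>b k1. (sobolev_norm_interval (m b) T (\<lambda>t. cis (k1\<^sup>2 * t) * partial_fourier T g (k1, t)))\<^sup>2"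
    have slice: "(\<integral>\<^sup>+k1. ennreal (p k1) * (ennreal (C b) * (\<integral>\<^sup>+k. ennreal ((1 + k\<^sup>2) powr (2 * m b - 1 / 2) * (norm (?v (k1, k)))\<^sup>2) \<partial>lborel)) \<partial>lborel)
      \<le> ennreal (C b) * N"
      if [measurable]: "p \<in> borel_measurable borel" and p0: "\<And>k1. 0 \<le> p k1"
        and p: "\<And>k1 k. p k1 * (1 + k\<^sup>2) powr (2 * m b - 1 / 2) \<le> (1 + (norm (k1, k))\<^sup>2) powr s" for b and p :: "real \<Rightarrow> real"
    proof -
      have "(\<integral>\<^sup>+k1. ennreal (p k1) * (ennreal (C b) * (\<integral>\<^sup>+k. ennreal ((1 + k\<^sup>2) powr (2 * m b - 1 / 2) * (norm (?v (k1, k)))\<^sup>2) \<partial>lborel)) \<partial>lborel)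
        = (\<integral>\<^sup>+k1. ennreal (C b) * (\<integral>\<^sup>+k. ennreal (p k1) * ennreal ((1 + k\<^sup>2) powr (2 * m b - 1 / 2) * (norm (?v (k1, k)))\<^sup>2) \<partial>lborel) \<partial>lborel)"
        by (intro nn_integral_cong) (subst nn_integral_cmult, measurable, simp add: mult.left_commute)
      also have "\<dots> = ennreal (C b) * (\<integral>\<^sup>+k1. \<integral>\<^sup>+k. ennreal (p k1) * ennreal ((1 + k\<^sup>2) powr (2 * m b - 1 / 2) * (norm (?v (k1, k)))\<^sup>2) \<partial>lborel \<partial>lborel)"
        by (rule nn_integral_cmult) measurable
      also have "\<dots> \<le> ennreal (C b) * (\<integral>\<^sup>+k1. \<integral>\<^sup>+k. ennreal ((1 + (norm (k1, k))\<^sup>2) powr s * (norm (?v (k1, k)))\<^sup>2) \<partial>lborel \<partial>lborel)"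
      proof (intro mult_left_mono nn_integral_mono)
        fix k1 k
        have "ennreal (p k1) * ennreal ((1 + k\<^sup>2) powr (2 * m b - 1 / 2) * (norm (?v (k1, k)))\<^sup>2)
          = ennreal ((p k1 * (1 + k\<^sup>2) powr (2 * m b - 1 / 2)) * (norm (?v (k1, k)))\<^sup>2)"
          using p0[of k1] by (subst ennreal_mult[symmetric]) (simp_all add: mult.assoc)
        also have "\<dots> \<le> ennreal ((1 + (norm (k1, k))\<^sup>2) powr s * (norm (?v (k1, k)))\<^sup>2)"
          by (intro ennreal_leI mult_right_mono p) simp
        finally show "ennreal (p k1) * ennreal ((1 + k\<^sup>2) powr (2 * m b - 1 / 2) * (norm (?v (k1, k)))\<^sup>2)
          \<le> ennreal ((1 + (norm (k1, k))\<^sup>2) powr s * (norm (?v (k1, k)))\<^sup>2)" .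
      qed simp
      also have "\<dots> = ennreal (C b) * N"
        unfolding N_def by (subst nn_integral_R2(1)) measurable
      finally show ?thesis .
    qed
    have n2: "(norm (k1, k))\<^sup>2 = k1\<^sup>2 + k\<^sup>2" for k1 k :: real by (simp add: norm_Pair)
    have t1: "(\<integral>\<^sup>+k1. ?S True k1 \<partial>lborel) \<le> ennreal (C True) * N"
    proof -
      have "(\<integral>\<^sup>+k1. ?S True k1 \<partial>lborel) \<le> (\<integral>\<^sup>+k1. ennreal 1 * (ennreal (C True) * (\<integral>\<^sup>+k. ennreal ((1 + k\<^sup>2) powr (2 * m True - 1 / 2) * (norm (?v (k1, k)))\<^sup>2) \<partial>lborel)) \<partial>lborel)"
        using bspec[OF B, of True] by (intro nn_integral_mono_AE) simp
      also have "\<dots> \<le> ennreal (C True) * N"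
      proof (rule slice)
        have e: "2 * m True - 1 / 2 = s" unfolding m_def by (simp add: field_simps)
        show "1 * (1 + k\<^sup>2) powr (2 * m True - 1 / 2) \<le> (1 + (norm (k1, k))\<^sup>2) powr s" for k1 k :: real
          unfolding e n2 mult_1 using s by (intro powr_mono2) auto
      qed simp_all
      finally show ?thesis .
    qed
    have t2: "(\<integral>\<^sup>+k1. ennreal ((1 + k1\<^sup>2) powr s) * ?S False k1 \<partial>lborel) \<le> ennreal (C False) * N"
    proof -
      have "(\<integral>\<^sup>+k1. ennreal ((1 + k1\<^sup>2) powr s) * ?S False k1 \<partial>lborel) \<le> (\<integral>\<^sup>+k1. ennreal ((1 + k1\<^sup>2) powr s) * (ennreal (C False) * (\<integral>\<^sup>+k. ennreal ((1 + k\<^sup>2) powr (2 * m False - 1 / 2) * (norm (?v (k1, k)))\<^sup>2) \<partial>lborel)) \<partial>lborel)"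
      proof (rule nn_integral_mono_AE)
        show "AE k1 in lborel. ennreal ((1 + k1\<^sup>2) powr s) * ?S False k1 \<le> ennreal ((1 + k1\<^sup>2) powr s) * (ennreal (C False) * (\<integral>\<^sup>+k. ennreal ((1 + k\<^sup>2) powr (2 * m False - 1 / 2) * (norm (?v (k1, k)))\<^sup>2) \<partial>lborel))"
          using bspec[OF B UNIV_I, of False] by eventually_elim (intro mult_left_mono, auto)
      qed
      also have "\<dots> \<le> ennreal (C False) * N"
      proof (rule slice)
        have e: "2 * m False - 1 / 2 = 0" unfolding m_def by simp
        show "(1 + k1\<^sup>2) powr s * (1 + k\<^sup>2) powr (2 * m False - 1 / 2) \<le> (1 + (norm (k1, k))\<^sup>2) powr s" for k1 k :: real
        proof -
          have "(1 + k\<^sup>2) powr 0 = 1" using add_pos_nonneg[OF zero_less_one zero_le_power2[of k]] by simp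
          then show ?thesis unfolding e n2 using s by (simp only: mult_1_right) (intro powr_mono2, auto)
        qed
      qed simp_all
      finally show ?thesis .
    qed
    have "B_norm s T g = ennreal_sqrt (\<integral>\<^sup>+k1. ?S True k1 \<partial>lborel) + ennreal_sqrt (\<integral>\<^sup>+k1. ennreal ((1 + k1\<^sup>2) powr s) * ?S False k1 \<partial>lborel)"
      unfolding B_norm_def m_def using sq by simp
    also have "\<dots> \<le> ennreal_sqrt (ennreal (C True) * N) + ennreal_sqrt (ennreal (C False) * N)"
      by (intro add_mono ennreal_sqrt_mono t1 t2)
    also have "\<dots> = ennreal c * ennreal_sqrt N"
      unfolding ennreal_sqrt_cmult[OF C0] c_def distrib_right[symmetric]
      using C0[of True] C0[of False] by (subst ennreal_plus) simp_all
    also have "ennreal_sqrt N = sobolev_norm s U0" unfolding U(3) N_def ..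
    finally show ?thesis using lateral_is_function[OF T A] by blast
  qed
  show ?thesis
  proof (intro exI[of _ c] conjI c0 allI impI, elim conjE)
    fix T :: real and U0 :: "(real \<times> real) distr" assume T: "0 < T" "T < 1" and U0: "U0 \<in> sobolev_space s"
    have "\<forall>x2. \<exists>g. is_function_on (UNIV \<times> {0<..<T}) (solution_at_x2 U0 x2) g \<and> B_norm s T g \<le> ennreal c * sobolev_norm s U0"
      using main[OF T U0] by blast
    from choice[OF this] obtain g where "\<forall>x2. is_function_on (UNIV \<times> {0<..<T}) (solution_at_x2 U0 x2) (g x2) \<and> B_norm s T (g x2) \<le> ennreal c * sobolev_norm s U0" ..
    then show "\<exists>g :: real \<Rightarrow> real \<times> real \<Rightarrow> complex.
           (\<forall>x2. is_function_on (UNIV \<times> {0<..<T}) (solution_at_x2 U0 x2) (g x2)) \<and>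
           (SUP x2. B_norm s T (g x2)) \<le> ennreal c * sobolev_norm s U0"
      by (intro exI[of _ g] conjI allI SUP_least) auto
  qed
qed

theorem theorem3p1:
  shows "(\<forall>(s::real) (T::real) (U0 :: (real \<times> real) distr).
            0 < T \<and> T < 1 \<and> U0 \<in> sobolev_space s \<longrightarrow>
              solves_schroedinger_ivp T U0 (solution_at_time U0) \<and>
              (SUP t\<in>{0..T}. sobolev_norm s (solution_at_time U0 t)) = sobolev_norm s U0)
       \<and> (\<forall>s::real. s \<ge> 0 \<longrightarrow>
            (\<exists>c::real. c > 0 \<and>
              (\<forall>(T::real) (U0 :: (real \<times> real) distr).
                 0 < T \<and> T < 1 \<and> U0 \<in> sobolev_space s \<longrightarrow>
                 (\<exists>g :: real \<Rightarrow> real \<times> real \<Rightarrow> complex.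
                    (\<forall>x2. is_function_on (UNIV \<times> {0<..<T}) (solution_at_x2 U0 x2) (g x2)) \<and>
                    (SUP x2. B_norm s T (g x2)) \<le> ennreal c * sobolev_norm s U0))))"
  using initial_value_problem lateral_regularity by blast

end
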